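(* Let $\alpha>\frac32$, $\beta\ge-\frac12$, and let $\{\tilde P_n\}_{n\ge 0}$ be a complete orthonormal system of exceptional Jacobi polynomials on $(-1,1)$ obtained from the Jacobi polynomials $p_n^{\alpha,\beta}$ by one Darboux transformation with data $(b,w,\tilde\lambda)$ (as described in the context), where the polynomial $b$ satisfies $b>0$ on $(-1,1)$, $b(1)=0$ and $b'(1)\ne 0$. Let $Q$ be a primitive function of $b$ (i.e. $Q'=b$), and let $W^{\alpha,\beta,e}_*$ be the maximal operator of the associated discrete diffusion semigroup $\{W_t^{\alpha,\beta,e}\}_{t\ge0}$. Then: (1) If $1<p<\infty$ and $\omega\in A_p(\mathbb N)$, then there is a constant $C$ such that for all $f\in l^2(\mathbb N)\cap l^p(\mathbb N,\omega)$ $$\|W^{\alpha,\beta,e}_*f\|_{p,\omega}\le C\|f\|_{p,\omega},$$ where $C$ is independent of $f$. That is, $W^{\alpha,\beta,e}_*$ can be extended uniquely to a bounded operator from $l^p(\mathbb N,\omega)$ into itself. (2) If $\omega\in A_1(\mathbb N)$, then there is a constant $C$ such that for all $f\in l^2(\mathbb N)\cap l^1(\mathbb N,\omega)$ $$\|W^{\alpha,\beta,e}_*f\|_{1,\infty,\omega}\le C\|f\|_{1,\omega},$$ where $C$ is independent of $f$. That is, $W^{\alpha,\beta,e}_*$ can be extended uniquely to a bounded operator from $l^1(\mathbb N,\omega)$ into $l^{1,\infty}(\mathbb N,\omega)$.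
   Context: Here $\mathbb N=\{0,1,2,\dots\}$ and sequences are complex valued. Jacobi polynomials: $w^{\alpha,\beta}(x)=(1-x)^\alpha(1+x)^\beta$ on $(-1,1)$, and $p_n^{\alpha,\beta}$ ($n\ge 0$) is the degree-$n$ Jacobi polynomial orthonormal in $L^2((-1,1),w^{\alpha,\beta}dx)$ with positive leading coefficient. They are eigenfunctions of $T[y]=py''+qy'$ with $p(x)=1-x^2$, $q(x)=\beta-\alpha-(\alpha+\beta+2)x$. Exceptional Jacobi polynomials (one Darboux transformation): let $b,w$ be rational functions and $\tilde\lambda$ a real constant such that $T=BA+\tilde\lambda$, where $A[y]=b(y'-wy)$, $B[y]=\hat b(y'-\hat w y)$, $\hat b=\frac pb$, $\hat w=-w-\frac qp+\frac{b'}{b}$; equivalently $w$ satisfies the Riccati equation $p(w'+w^2)+qw=\tilde\lambda$. It is assumed that $b$ and $bw$ are polynomials and $b>0$ on $(-1,1)$. Put $$P_n^{[1]}=A[p_n^{\alpha,\beta}]=b\,(p_n^{\alpha,\beta})'-bw\,p_n^{\alpha,\beta},\qquad W=\frac{p\,w^{\alpha,\beta}}{b^2},\qquad \tilde P_n=\frac{1}{\sigma_n}P_n^{[1]},\quad \sigma_n=\|P_n^{[1]}\|_{L^2(W dx)} .$$ It is a standing assumption that $W$ has finite moments on $(-1,1)$, that only finitely many nonnegative integers are missing from the degrees of the $P_n^{[1]}$, and that $\{\tilde P_n\}_{n\ge0}$ is a complete orthonormal system in $L^2((-1,1),W\,dx)$. Semigroup and maximal operator: for $t\ge 0$ and $n,m\in\mathbb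 N$, $$K^{\alpha,\beta,e}_t(n,m)=\int_{-1}^1e^{-(Q(1)-Q(x))t}\tilde P_n(x)\tilde P_m(x)W(x)\,dx,$$ and for $f\in l^2(\mathbb N)$, $W_t^{\alpha,\beta,e}f(n)=\sum_{m=0}^\infty f(m)K_t^{\alpha,\beta,e}(n,m)$, $\;W_*^{\alpha,\beta,e}f(n)=\sup_{t>0}|W_t^{\alpha,\beta,e}f(n)|$. Weighted spaces: a weight on $\mathbb N$ is a strictly positive sequence $\omega=\{\omega(n)\}_{n\in\mathbb N}$. For $1\le p<\infty$, $l^p(\mathbb N,\omega)$ is the space of sequences with $\|f\|_{p,\omega}^p=\sum_{m}|f(m)|^p\omega(m)<\infty$, and $l^{1,\infty}(\mathbb N,\omega)$ is the space of sequences with $\|f\|_{1,\infty,\omega}=\sup_{\tau>0}\tau\sum_{m:|f(m)|>\tau}\omega(m)<\infty$. Discrete Muckenhoupt classes: for $1<p<\infty$, $\omega\in A_p(\mathbb N)$ if $$\sup_{m\le n}\frac{1}{(n-m+1)^p}\Big(\sum_{k=m}^n\omega(k)\Big)\Big(\sum_{k=m}^n\omega(k)^{-\frac1{p-1}}\Big)^{p-1}<\infty,$$ and $\omega\in A_1(\mathbb N)$ if $$\sup_{m\le n}\frac{1}{n-m+1}\Big(\sum_{k=m}^n\omega(k)\Big)\max_{m\le k\le n}\omega(k)^{-1}<\infty,$$ the suprema being over $m,n\in\mathbb N$ with $m\le n$. (In these definitions and in parts (1), (2), $p$ is an exponent, not the polynomial $1-x^2$.) *)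

theory Defs
  imports "HOL-Analysis.Analysis" "HOL-Computational_Algebra.Polynomial"
begin

section \<open>Orthonormal systems on the interval from -1 to 1\<close>

definition orthonormal_wrt :: "(real \<Rightarrow> real) \<Rightarrow> (nat \<Rightarrow> real \<Rightarrow> real) \<Rightarrow> bool" where
  "orthonormal_wrt W \<phi> \<longleftrightarrow>
     (\<forall>n m. set_integrable lborel {-1<..<1} (\<lambda>x. \<phi> n x * \<phi> m x * W x) \<and>
            (LBINT x:{-1<..<1}. \<phi> n x * \<phi> m x * W x) = (if n = m then 1 else 0))"

text \<open>Completeness: only the zero element of the weighted \<open>L\<^sup>2\<close> space is orthogonal to all
  \<open>\<phi> n\<close>.  The \<open>\<phi> n\<close> are real valued, so it is enough to test with real functions.\<close>

definition complete_orthonormal_wrt :: "(real \<Rightarrow> real) \<Rightarrow> (nat \<Rightarrow> real \<Rightarrow> real) \<Rightarrow> bool" where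
  "complete_orthonormal_wrt W \<phi> \<longleftrightarrow>
     orthonormal_wrt W \<phi> \<and>
     (\<forall>f\<in>borel_measurable lborel.
        set_integrable lborel {-1<..<1} (\<lambda>x. (f x)\<^sup>2 * W x) \<longrightarrow>
        (\<forall>n. (LBINT x:{-1<..<1}. f x * \<phi> n x * W x) = 0) \<longrightarrow>
        (AE x in lborel. x \<in> {-1<..<1} \<longrightarrow> f x = 0))"

definition finite_moments :: "(real \<Rightarrow> real) \<Rightarrow> bool" where
  "finite_moments W \<longleftrightarrow> (\<forall>k::nat. set_integrable lborel {-1<..<1} (\<lambda>x. x ^ k * W x))"

section \<open>Jacobi polynomials and their Darboux transformation\<close>

definition jacobi_weight :: "real \<Rightarrow> real \<Rightarrow> real \<Rightarrow> real" where
  "jacobi_weight \<alpha> \<beta> x = (1 - x) powr \<alpha> * (1 + x) powr \<beta>"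

text \<open>For \<open>\<alpha>, \<beta> > -1\<close> these conditions determine the sequence uniquely.\<close>

definition orthonormal_jacobi :: "real \<Rightarrow> real \<Rightarrow> (nat \<Rightarrow> real poly) \<Rightarrow> bool" where
  "orthonormal_jacobi \<alpha> \<beta> pn \<longleftrightarrow>
     (\<forall>n. degree (pn n) = n \<and> lead_coeff (pn n) > 0) \<and>
     orthonormal_wrt (jacobi_weight \<alpha> \<beta>) (\<lambda>n. poly (pn n))"

definition jacobi_p :: "real \<Rightarrow> real" where
  "jacobi_p x = 1 - x\<^sup>2"

definition jacobi_q :: "real \<Rightarrow> real \<Rightarrow> real \<Rightarrow> real" where
  "jacobi_q \<alpha> \<beta> x = \<beta> - \<alpha> - (\<alpha> + \<beta> + 2) * x"

definition jacobi_T :: "real \<Rightarrow> real \<Rightarrow> (real \<Rightarrow> real) \<Rightarrow> real \<Rightarrow> real" where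
  "jacobi_T \<alpha> \<beta> y x = jacobi_p x * deriv (deriv y) x + jacobi_q \<alpha> \<beta> x * deriv y x"

definition darboux_A :: "real poly \<Rightarrow> (real \<Rightarrow> real) \<Rightarrow> (real \<Rightarrow> real) \<Rightarrow> real \<Rightarrow> real" where
  "darboux_A b w y x = poly b x * (deriv y x - w x * y x)"

definition darboux_bhat :: "real poly \<Rightarrow> real \<Rightarrow> real" where
  "darboux_bhat b x = jacobi_p x / poly b x"

definition darboux_what ::
  "real \<Rightarrow> real \<Rightarrow> real poly \<Rightarrow> (real \<Rightarrow> real) \<Rightarrow> real \<Rightarrow> real" where
  "darboux_what \<alpha> \<beta> b w x =
     - w x - jacobi_q \<alpha> \<beta> x / jacobi_p x + poly (pderiv b) x / poly b x"

definition darboux_B ::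
  "real \<Rightarrow> real \<Rightarrow> real poly \<Rightarrow> (real \<Rightarrow> real) \<Rightarrow> (real \<Rightarrow> real) \<Rightarrow> real \<Rightarrow> real" where
  "darboux_B \<alpha> \<beta> b w y x = darboux_bhat b x * (deriv y x - darboux_what \<alpha> \<beta> b w x * y x)"

text \<open>The rational function \<open>w\<close> is the quotient of the polynomial \<open>bw\<close> by the polynomial \<open>b\<close>;
  its values at the zeros of \<open>b\<close> are irrelevant.  All coefficients of the operators are rational and
  regular on the open interval, so the operator identity \<open>T = B A + \<lambda>\<close> is the same as equality on
  the interval for all polynomial arguments.\<close>

definition darboux_data ::
  "real \<Rightarrow> real \<Rightarrow> real poly \<Rightarrow> (real \<Rightarrow> real) \<Rightarrow> real poly \<Rightarrow> real \<Rightarrow> bool" where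
  "darboux_data \<alpha> \<beta> b w bw lam \<longleftrightarrow>
     (\<forall>x\<in>{-1<..<1}. poly b x > 0) \<and>
     (\<forall>x. poly b x \<noteq> 0 \<longrightarrow> poly b x * w x = poly bw x) \<and>
     (\<forall>y :: real poly. \<forall>x\<in>{-1<..<1}.
        jacobi_T \<alpha> \<beta> (poly y) x =
        darboux_B \<alpha> \<beta> b w (darboux_A b w (poly y)) x + lam * poly y x)"

text \<open>The polynomial that represents \<open>darboux_A b w (poly (pn n))\<close>.\<close>

definition exc_poly ::
  "real poly \<Rightarrow> real poly \<Rightarrow> (nat \<Rightarrow> real poly) \<Rightarrow> nat \<Rightarrow> real poly" where
  "exc_poly b bw pn n = b * pderiv (pn n) - bw * pn n"

lemma poly_exc_poly:
  assumes "darboux_data \<alpha> \<beta> b w bw lam" and "x \<in> {-1<..<1}"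
  shows "poly (exc_poly b bw pn n) x = darboux_A b w (poly (pn n)) x"
proof -
  have "poly b x * w x = poly bw x"
    using assms by (force simp: darboux_data_def)
  then have "poly bw x * poly (pn n) x = poly b x * (w x * poly (pn n) x)"
    by (metis mult.assoc)
  moreover have "deriv (poly (pn n)) x = poly (pderiv (pn n)) x"
    by (rule DERIV_imp_deriv) (rule poly_DERIV)
  ultimately show ?thesis
    by (simp add: exc_poly_def darboux_A_def right_diff_distrib)
qed

definition exc_weight :: "real \<Rightarrow> real \<Rightarrow> real poly \<Rightarrow> real \<Rightarrow> real" where
  "exc_weight \<alpha> \<beta> b x = jacobi_p x * jacobi_weight \<alpha> \<beta> x / (poly b x)\<^sup>2"

definition exc_sigma ::
  "real \<Rightarrow> real \<Rightarrow> real poly \<Rightarrow> real poly \<Rightarrow> (nat \<Rightarrow> real poly) \<Rightarrow> nat \<Rightarrow> real" where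
  "exc_sigma \<alpha> \<beta> b bw pn n =
     sqrt (LBINT x:{-1<..<1}. (poly (exc_poly b bw pn n) x)\<^sup>2 * exc_weight \<alpha> \<beta> b x)"

definition exc_jacobi ::
  "real \<Rightarrow> real \<Rightarrow> real poly \<Rightarrow> real poly \<Rightarrow> (nat \<Rightarrow> real poly) \<Rightarrow> nat \<Rightarrow> real \<Rightarrow> real" where
  "exc_jacobi \<alpha> \<beta> b bw pn n x = poly (exc_poly b bw pn n) x / exc_sigma \<alpha> \<beta> b bw pn n"

section \<open>The discrete semigroup and its maximal operator\<close>

definition exc_kernel ::
  "real \<Rightarrow> real \<Rightarrow> real poly \<Rightarrow> real poly \<Rightarrow> (nat \<Rightarrow> real poly) \<Rightarrow> (real \<Rightarrow> real) \<Rightarrow>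
     real \<Rightarrow> nat \<Rightarrow> nat \<Rightarrow> real" where
  "exc_kernel \<alpha> \<beta> b bw pn Q t n m =
     (LBINT x:{-1<..<1}. exp (- ((Q 1 - Q x) * t)) *
        exc_jacobi \<alpha> \<beta> b bw pn n x * exc_jacobi \<alpha> \<beta> b bw pn m x * exc_weight \<alpha> \<beta> b x)"

definition exc_semigroup ::
  "real \<Rightarrow> real \<Rightarrow> real poly \<Rightarrow> real poly \<Rightarrow> (nat \<Rightarrow> real poly) \<Rightarrow> (real \<Rightarrow> real) \<Rightarrow>
     real \<Rightarrow> (nat \<Rightarrow> complex) \<Rightarrow> nat \<Rightarrow> complex" where
  "exc_semigroup \<alpha> \<beta> b bw pn Q t f n =
     (\<Sum>m. f m * complex_of_real (exc_kernel \<alpha> \<beta> b bw pn Q t n m))"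

text \<open>For square summable \<open>f\<close> and data as above the supremum is finite, since \<open>Q 1 - Q x \<ge> 0\<close> on
  the interval makes every operator of the semigroup a contraction.  Values are embedded into the
  complex numbers so that the operator acts between spaces of complex sequences.\<close>

definition exc_maximal ::
  "real \<Rightarrow> real \<Rightarrow> real poly \<Rightarrow> real poly \<Rightarrow> (nat \<Rightarrow> real poly) \<Rightarrow> (real \<Rightarrow> real) \<Rightarrow>
     (nat \<Rightarrow> complex) \<Rightarrow> nat \<Rightarrow> complex" where
  "exc_maximal \<alpha> \<beta> b bw pn Q f n =
     complex_of_real (SUP t\<in>{0<..}. cmod (exc_semigroup \<alpha> \<beta> b bw pn Q t f n))"

section \<open>Weighted sequence spaces and discrete Muckenhoupt classes\<close>

definition weight_seq :: "(nat \<Rightarrow> real) \<Rightarrow> bool" where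
  "weight_seq \<omega> \<longleftrightarrow> (\<forall>n. \<omega> n > 0)"

definition lp_space :: "real \<Rightarrow> (nat \<Rightarrow> real) \<Rightarrow> (nat \<Rightarrow> complex) set" where
  "lp_space p \<omega> = {f. summable (\<lambda>m. cmod (f m) powr p * \<omega> m)}"

definition lp_norm :: "real \<Rightarrow> (nat \<Rightarrow> real) \<Rightarrow> (nat \<Rightarrow> complex) \<Rightarrow> real" where
  "lp_norm p \<omega> f = (\<Sum>m. cmod (f m) powr p * \<omega> m) powr (1 / p)"

abbreviation l2_space :: "(nat \<Rightarrow> complex) set" where
  "l2_space \<equiv> lp_space 2 (\<lambda>_. 1)"

definition weak_l1_space :: "(nat \<Rightarrow> real) \<Rightarrow> (nat \<Rightarrow> complex) set" where
  "weak_l1_space \<omega> =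
     {f. (\<forall>\<tau>>0. \<omega> summable_on {m. cmod (f m) > \<tau>}) \<and>
         bdd_above ((\<lambda>\<tau>. \<tau> * infsum \<omega> {m. cmod (f m) > \<tau>}) ` {0<..})}"

definition weak_l1_norm :: "(nat \<Rightarrow> real) \<Rightarrow> (nat \<Rightarrow> complex) \<Rightarrow> real" where
  "weak_l1_norm \<omega> f = (SUP \<tau>\<in>{0<..}. \<tau> * infsum \<omega> {m. cmod (f m) > \<tau>})"

definition muckenhoupt :: "real \<Rightarrow> (nat \<Rightarrow> real) \<Rightarrow> bool" where
  "muckenhoupt p \<omega> \<longleftrightarrow> weight_seq \<omega> \<and>
     (\<exists>C. \<forall>m n. m \<le> n \<longrightarrow>
        1 / (real n - real m + 1) powr p * (\<Sum>k=m..n. \<omega> k) *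
          (\<Sum>k=m..n. \<omega> k powr (- (1 / (p - 1)))) powr (p - 1) \<le> C)"

definition muckenhoupt1 :: "(nat \<Rightarrow> real) \<Rightarrow> bool" where
  "muckenhoupt1 \<omega> \<longleftrightarrow> weight_seq \<omega> \<and>
     (\<exists>C. \<forall>m n. m \<le> n \<longrightarrow>
        1 / (real n - real m + 1) * (\<Sum>k=m..n. \<omega> k) *
          Max ((\<lambda>k. inverse (\<omega> k)) ` {m..n}) \<le> C)"

text \<open>Maximal operators are sublinear, not linear, so a norm bound alone does not express the
  continuity of a bounded operator; both the norm bound and the estimate for differences are
  required.  For a linear operator, or a sublinear one with
  \<open>\<bar>S f - S g\<bar> \<le> \<bar>S (f - g)\<bar>\<close> pointwise, the second follows from the first.\<close>

definition bounded_operator ::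
  "(nat \<Rightarrow> complex) set \<Rightarrow> ((nat \<Rightarrow> complex) \<Rightarrow> real) \<Rightarrow>
   (nat \<Rightarrow> complex) set \<Rightarrow> ((nat \<Rightarrow> complex) \<Rightarrow> real) \<Rightarrow>
   ((nat \<Rightarrow> complex) \<Rightarrow> nat \<Rightarrow> complex) \<Rightarrow> bool" where
  "bounded_operator X NX Y NY S \<longleftrightarrow>
     (\<forall>f\<in>X. S f \<in> Y) \<and>
     (\<exists>C. (\<forall>f\<in>X. NY (S f) \<le> C * NX f) \<and>
          (\<forall>f\<in>X. \<forall>g\<in>X. (\<lambda>n. S f n - S g n) \<in> Y \<and>
             NY (\<lambda>n. S f n - S g n) \<le> C * NX (\<lambda>n. f n - g n)))"

definition extends_uniquely ::
  "(nat \<Rightarrow> complex) set \<Rightarrow> ((nat \<Rightarrow> complex) \<Rightarrow> nat \<Rightarrow> complex) \<Rightarrow>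
   (nat \<Rightarrow> complex) set \<Rightarrow> ((nat \<Rightarrow> complex) \<Rightarrow> real) \<Rightarrow>
   (nat \<Rightarrow> complex) set \<Rightarrow> ((nat \<Rightarrow> complex) \<Rightarrow> real) \<Rightarrow> bool" where
  "extends_uniquely D U X NX Y NY \<longleftrightarrow>
     (\<exists>S. bounded_operator X NX Y NY S \<and> (\<forall>f\<in>D. S f = U f) \<and>
          (\<forall>S'. bounded_operator X NX Y NY S' \<and> (\<forall>f\<in>D. S' f = U f) \<longrightarrow>
                (\<forall>f\<in>X. S' f = S f)))"

end

(*
With x = cos theta the functions exc_jacobi n are, up to a weight, eigenfunctions of a Schroedinger
operator on (0, pi), and Q 1 - Q x is comparable with theta^4 near theta = 0.  With
N = max 1 (t^(1/4)) the kernel satisfies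

  |K_t(n, m)| <= C min (1/N, N / (n - m)^2),

an approximate identity at scale N.  Summation by parts then dominates the maximal operator pointwise
by the Hardy-Littlewood maximal function, whose weighted bounds follow from Lerner's trick of
comparing averages with the maximal functions attached to omega and to its dual weight; in dimension
one these are bounded for an arbitrary weight, by the rising sun lemma.

For the kernel estimate the Riccati equation is used to integrate by parts, which expresses K_t through
matrix coefficients of smooth functions with respect to the classical Jacobi polynomials.  Decay in
n - m comes from a double commutator with the Jacobi operator, the gain at the endpoint x = 1 from
Sonin's monotone energy: the potential is repulsive there because alpha > 1/2.  Near x = -1 only
L^2 bounds are needed.
*)
theory Submission
  imports Defs
begin

text \<open>The obstacle is a factor that the normalisation leaves behind. With
  \<open>a = freq n\<close> and \<open>b = freq m\<close>, a \<le> b, the product of the norms is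
  comparable with a b, but it has to balance a term of size b^2 times
  \<open>matrix_coeff (gauss t) n m\<close>; the quotient b/a is unbounded when n is far below m.
  Two mechanisms absorb it. For b < N the smallness of the eigenfunctions near x = 1 gives the gain
  (a/N)(b/N), so both indices must carry such a factor. For b \<ge> N and b > 2a the distance m - n
  is comparable with b, and off-diagonal decay pays. The commutator is double because (eigval n -
  eigval m)^2 yields (n - m)^2; a single one would leave decay 1/|n - m|, which is not summable. The
  scale N = t^(1/4) comes from t (1 - x)^2 = (N^2 (1 - x))^2, the exponent being quadratic in 1 - x
  since b has a simple zero at 1. Maximal functions are taken on {0..L}, where suprema are finite
  maxima, with bounds uniform in L; L tends to infinity only when sequence norms are
  estimated.\<close>

section \<open>Weighted maximal functions on finite intervals\<close>

text \<open>The hypothesis \<open>weak\<close> is a weak type (1,1) inequality in its sharp form: on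
  the level set {F > \<tau>} the mean of f is at least \<tau>. Integrating it against \<tau>^(p-2)
  and absorbing F by Young's inequality gives the constant of Doob's inequality, independent of the
  weight.\<close>

lemma sum_powr_le_of_weak_type:
  fixes F f \<mu> :: "'i \<Rightarrow> real" and p :: real
  assumes "finite I" and p: "1 < p"
    and nonneg: "\<And>i. i \<in> I \<Longrightarrow> 0 \<le> F i" "\<And>i. i \<in> I \<Longrightarrow> 0 \<le> f i" "\<And>i. i \<in> I \<Longrightarrow> 0 \<le> \<mu> i"
    and weak: "\<And>\<tau>. 0 \<le> \<tau> \<Longrightarrow> 0 \<le> (\<Sum>i\<in>I. if \<tau> < F i then (f i - \<tau>) * \<mu> i else 0)"
  shows "(\<Sum>i\<in>I. F i powr p * \<mu> i) \<le> (p / (p - 1)) powr p * (\<Sum>i\<in>I. f i powr p * \<mu> i)"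
proof -
  define B where "B = (\<Sum>i\<in>I. F i)"
  have B: "F i \<le> B" "0 \<le> B" if "i \<in> I" for i
    using assms(1) nonneg(1) that unfolding B_def
    by (auto intro!: member_le_sum sum_nonneg)
  have B0: "0 \<le> B" unfolding B_def by (intro sum_nonneg nonneg)
  have int: "((\<lambda>\<tau>. (if \<tau> < F i then (f i - \<tau>) * \<mu> i else 0) * \<tau> powr (p - 2)) has_integral
      (f i * F i powr (p - 1) / (p - 1) - F i powr p / p) * \<mu> i) {0..B}" if i: "i \<in> I" for i
  proof -
    let ?G = "\<lambda>\<tau>. (f i * \<tau> powr (p - 1) / (p - 1) - \<tau> powr p / p) * \<mu> i"
    \<comment> \<open>For p < 2 the integrand may be singular at 0, but p - 1 > 0 keeps the
      antiderivative continuous there; hence the version of the fundamental theorem with interior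
      derivatives.\<close>
    have "((\<lambda>\<tau>. (f i - \<tau>) * \<mu> i * \<tau> powr (p - 2)) has_integral (?G (F i) - ?G 0)) {0..F i}"
    proof (rule fundamental_theorem_of_calculus_interior)
      show "continuous_on {0..F i} ?G"
        using p by (intro continuous_intros continuous_on_powr') auto
      fix \<tau> assume "\<tau> \<in> {0<..<F i}"
      then have t: "0 < \<tau>" by simp
      have e: "\<tau> powr (p - 1) = \<tau> * \<tau> powr (p - 2)"
        using t powr_add[of \<tau> 1 "p - 2"] by simp
      have "(?G has_real_derivative
          (f i * ((p - 1) * \<tau> powr (p - 1 - 1)) / (p - 1) - (p * \<tau> powr (p - 1)) / p) * \<mu> i) (at \<tau>)"
        using t p by (auto intro!: derivative_eq_intros has_real_derivative_powr)
      moreover have "(f i * ((p - 1) * \<tau> powr (p - 1 - 1)) / (p - 1) - (p * \<tau> powr (p - 1)) / p) * \<mu> i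
          = (f i - \<tau>) * \<mu> i * \<tau> powr (p - 2)"
      proof -
        have "f i * ((p - 1) * \<tau> powr (p - 1 - 1)) / (p - 1) = f i * \<tau> powr (p - 2)" using p by simp
        then show ?thesis using p by (simp add: e algebra_simps)
      qed
      ultimately show "(?G has_vector_derivative (f i - \<tau>) * \<mu> i * \<tau> powr (p - 2)) (at \<tau>)"
        by (simp only: has_real_derivative_iff_has_vector_derivative[symmetric])
    qed (use nonneg(1)[OF i] in simp)
    then have "((\<lambda>\<tau>. if \<tau> \<in> {0..F i} then (f i - \<tau>) * \<mu> i * \<tau> powr (p - 2) else 0) has_integral ?G (F i)) {0..B}"
      using B[OF i] p by (subst has_integral_restrict) auto
    then show ?thesis
      by (rule has_integral_spike[of "{F i}", rotated 2]) auto
  qed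
  have "((\<lambda>\<tau>. \<Sum>i\<in>I. (if \<tau> < F i then (f i - \<tau>) * \<mu> i else 0) * \<tau> powr (p - 2)) has_integral
      (\<Sum>i\<in>I. (f i * F i powr (p - 1) / (p - 1) - F i powr p / p) * \<mu> i)) {0..B}"
    using assms(1) int by (rule has_integral_sum)
  moreover have "0 \<le> (\<Sum>i\<in>I. (if \<tau> < F i then (f i - \<tau>) * \<mu> i else 0) * \<tau> powr (p - 2))"
    if "\<tau> \<in> {0..B}" for \<tau>
    unfolding sum_distrib_right[symmetric] using that weak by (intro mult_nonneg_nonneg) auto
  ultimately have "0 \<le> (\<Sum>i\<in>I. (f i * F i powr (p - 1) / (p - 1) - F i powr p / p) * \<mu> i)"
    by (rule has_integral_nonneg)
  also have "\<dots> \<le> (\<Sum>i\<in>I. ((p / (p - 1)) powr p * (f i powr p * \<mu> i) - F i powr p * \<mu> i) / p\<^sup>2)"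
  proof (rule sum_mono)
    fix i assume i: "i \<in> I"
    define q where "q = p / (p - 1)"
    have q: "q > 1" "1 / p + 1 / q = 1" "(p - 1) * q = p" "q > 0"
      using p by (auto simp: q_def field_simps)
    \<comment> \<open>The factor q in front of f is chosen so that, after division by p, the two F^p
      terms combine to exactly -F^p / p^2.\<close>
    have "q * f i * F i powr (p - 1) \<le> (q * f i) powr p / p + (F i powr (p - 1)) powr q / q"
      using p q nonneg[OF i] by (intro Youngs_inequality) auto
    also have "\<dots> = q powr p * f i powr p / p + F i powr p / q"
      using p q nonneg[OF i] by (simp add: powr_mult powr_powr)
    finally have young: "q * f i * F i powr (p - 1) / p \<le> (q powr p * f i powr p / p + F i powr p / q) / p"
      using p by (intro divide_right_mono) auto
    have "1 / (p - 1) = q / p" "1 / q = 1 - 1 / p"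
      using p by (auto simp: q_def field_simps)
    then have "f i * F i powr (p - 1) / (p - 1) = q * f i * F i powr (p - 1) / p"
      "F i powr p / q = F i powr p * (1 - 1 / p)"
      by (metis (no_types, opaque_lifting) mult.commute mult.left_commute times_divide_eq_right mult.right_neutral)+
    then have "f i * F i powr (p - 1) / (p - 1) \<le> (q powr p * f i powr p / p + F i powr p * (1 - 1 / p)) / p"
      using young by simp
    also have "\<dots> = (q powr p * f i powr p - F i powr p) / p\<^sup>2 + F i powr p / p"
      using p by (simp add: add_divide_distrib diff_divide_distrib right_diff_distrib power2_eq_square)
    finally have "f i * F i powr (p - 1) / (p - 1) - F i powr p / p \<le> (q powr p * f i powr p - F i powr p) / p\<^sup>2"
      by simp
    from mult_right_mono[OF this nonneg(3)[OF i]]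
    show "(f i * F i powr (p - 1) / (p - 1) - F i powr p / p) * \<mu> i
        \<le> ((p / (p - 1)) powr p * (f i powr p * \<mu> i) - F i powr p * \<mu> i) / p\<^sup>2"
      by (simp add: q_def algebra_simps)
  qed
  also have "\<dots> = ((p / (p - 1)) powr p * (\<Sum>i\<in>I. f i powr p * \<mu> i) - (\<Sum>i\<in>I. F i powr p * \<mu> i)) / p\<^sup>2"
    by (simp add: sum_subtractf sum_distrib_left flip: sum_divide_distrib)
  finally show ?thesis
    using p by (simp add: zero_le_divide_iff)
qed

section \<open>One-sided maximal functions and the rising sun lemma\<close>

definition average :: "(nat \<Rightarrow> real) \<Rightarrow> (nat \<Rightarrow> real) \<Rightarrow> nat \<Rightarrow> nat \<Rightarrow> real" where
  "average \<mu> f a b = (\<Sum>k=a..b. f k * \<mu> k) / (\<Sum>k=a..b. \<mu> k)"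

definition left_maximal :: "(nat \<Rightarrow> real) \<Rightarrow> (nat \<Rightarrow> real) \<Rightarrow> nat \<Rightarrow> real" where
  "left_maximal \<mu> f n = Max ((\<lambda>a. average \<mu> f a n) ` {..n})"

definition right_maximal :: "nat \<Rightarrow> (nat \<Rightarrow> real) \<Rightarrow> (nat \<Rightarrow> real) \<Rightarrow> nat \<Rightarrow> real" where
  "right_maximal L \<mu> f n = Max (average \<mu> f n ` {n..L})"

text \<open>Intervals end at or before \<open>L\<close>, which makes the supremum a maximum over
  finitely many averages; the dependence on \<open>L\<close> is monotone and removed by a limit
  later.\<close>

definition maximal :: "nat \<Rightarrow> (nat \<Rightarrow> real) \<Rightarrow> (nat \<Rightarrow> real) \<Rightarrow> nat \<Rightarrow> real" where
  "maximal L \<mu> f n = Max ((\<lambda>(a, b). average \<mu> f a b) ` ({..n} \<times> {n..L}))"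

text \<open>The largest sum of (f - \<tau>) \<mu> over an interval that ends at n, or 0 if no such
  sum is positive, computed by the recursion of a walk reflected at 0. The set where it is positive
  is the shadow in the rising sun lemma.\<close>

fun excess :: "(nat \<Rightarrow> real) \<Rightarrow> (nat \<Rightarrow> real) \<Rightarrow> real \<Rightarrow> nat \<Rightarrow> real" where
  "excess \<mu> f \<tau> 0 = max 0 ((f 0 - \<tau>) * \<mu> 0)"
| "excess \<mu> f \<tau> (Suc n) = max 0 (excess \<mu> f \<tau> n + (f (Suc n) - \<tau>) * \<mu> (Suc n))"

lemma excess_nonneg: "0 \<le> excess \<mu> f \<tau> n"
  by (cases n) auto

lemma sum_le_excess:
  "a \<le> n \<Longrightarrow> (\<Sum>k=a..n. (f k - \<tau>) * \<mu> k) \<le> excess \<mu> f \<tau> n"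
proof (induction n)
  case (Suc n)
  then show ?case
    using excess_nonneg[of \<mu> f \<tau> n] by (cases "a = Suc n") auto
qed auto

lemma excess_pos_imp:
  "0 < excess \<mu> f \<tau> n \<Longrightarrow> \<exists>a\<le>n. excess \<mu> f \<tau> n = (\<Sum>k=a..n. (f k - \<tau>) * \<mu> k)"
proof (induction n)
  case (Suc n)
  show ?case
  proof (cases "0 < excess \<mu> f \<tau> n")
    case True
    then obtain a where "a \<le> n" "excess \<mu> f \<tau> n = (\<Sum>k=a..n. (f k - \<tau>) * \<mu> k)"
      using Suc.IH by blast
    then show ?thesis using Suc.prems by (intro exI[of _ a]) simp
  next
    case False
    then have "excess \<mu> f \<tau> n = 0" using excess_nonneg[of \<mu> f \<tau> n] by simp
    then show ?thesis using Suc.prems by (intro exI[of _ "Suc n"]) simp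
  qed
qed (auto simp: max_def split: if_splits)

lemma average_gt_iff:
  assumes "\<And>k. 0 < \<mu> k" "a \<le> b"
  shows "\<tau> < average \<mu> f a b \<longleftrightarrow> 0 < (\<Sum>k=a..b. (f k - \<tau>) * \<mu> k)"
proof -
  have "0 < (\<Sum>k=a..b. \<mu> k)" using assms by (intro sum_pos) auto
  then show ?thesis
    by (simp add: average_def pos_less_divide_eq left_diff_distrib sum_subtractf sum_distrib_left)
qed

lemma left_maximal_gt_iff:
  assumes "\<And>k. 0 < \<mu> k"
  shows "\<tau> < left_maximal \<mu> f n \<longleftrightarrow> 0 < excess \<mu> f \<tau> n"
proof -
  have "\<tau> < left_maximal \<mu> f n \<longleftrightarrow> (\<exists>a\<le>n. \<tau> < average \<mu> f a n)"
    unfolding left_maximal_def by (subst Max_gr_iff) auto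
  also have "\<dots> \<longleftrightarrow> (\<exists>a\<le>n. 0 < (\<Sum>k=a..n. (f k - \<tau>) * \<mu> k))"
    using average_gt_iff[of \<mu>, OF assms] by blast
  also have "\<dots> \<longleftrightarrow> 0 < excess \<mu> f \<tau> n"
    using sum_le_excess[of _ n f \<tau> \<mu>] excess_pos_imp[of \<mu> f \<tau> n] by fastforce
  finally show ?thesis .
qed

text \<open>As long as \<open>excess\<close> stays positive it changes by exactly the current
  summand, and where it is cut to 0 the index lies outside the level set. Its final value, which is
  nonnegative, is therefore a lower bound for the sum.\<close>

lemma left_maximal_weak_type:
  assumes "\<And>k. 0 < \<mu> k"
  shows "0 \<le> (\<Sum>n\<le>L. if \<tau> < left_maximal \<mu> f n then (f n - \<tau>) * \<mu> n else 0)"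
proof -
  have "excess \<mu> f \<tau> L \<le> (\<Sum>n\<le>L. if \<tau> < left_maximal \<mu> f n then (f n - \<tau>) * \<mu> n else 0)"
    unfolding left_maximal_gt_iff[of \<mu>, OF assms]
  proof (induction L)
    case 0
    show ?case by (cases "0 < (f 0 - \<tau>) * \<mu> 0") auto
  next
    case (Suc L)
    then show ?case
      using excess_nonneg[of \<mu> f \<tau> L] by (cases "0 < excess \<mu> f \<tau> L + (f (Suc L) - \<tau>) * \<mu> (Suc L)") auto
  qed
  then show ?thesis using excess_nonneg[of \<mu> f \<tau> L] by linarith
qed

lemma average_reflect:
  assumes "a \<le> b" "b \<le> L"
  shows "average (\<lambda>k. \<mu> (L - k)) (\<lambda>k. f (L - k)) (L - b) (L - a) = average \<mu> f a b"
proof -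
  have "(\<Sum>k=L-b..L-a. g (L - k)) = (\<Sum>k=a..b. g k)" for g :: "nat \<Rightarrow> real"
    using assms by (intro sum.reindex_bij_witness[of _ "\<lambda>n. L - n" "\<lambda>n. L - n"]) auto
  from this[of \<mu>] this[of "\<lambda>k. f k * \<mu> k"] show ?thesis by (simp add: average_def)
qed

text \<open>The reflection n to L - n exchanges the two sides, so the left-sided inequality carries
  over with the reflected weight.\<close>

lemma right_maximal_reflect:
  assumes "n \<le> L"
  shows "right_maximal L \<mu> f n = left_maximal (\<lambda>k. \<mu> (L - k)) (\<lambda>k. f (L - k)) (L - n)"
proof -
  have "(\<lambda>a. average (\<lambda>k. \<mu> (L - k)) (\<lambda>k. f (L - k)) a (L - n)) ` {..L - n} = average \<mu> f n ` {n..L}"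
  proof (rule set_eqI, rule iffI)
    fix x assume "x \<in> (\<lambda>a. average (\<lambda>k. \<mu> (L - k)) (\<lambda>k. f (L - k)) a (L - n)) ` {..L - n}"
    then obtain a where a: "a \<le> L - n" "x = average (\<lambda>k. \<mu> (L - k)) (\<lambda>k. f (L - k)) a (L - n)" by auto
    then have "x = average \<mu> f n (L - a)"
      using average_reflect[of n "L - a" L \<mu> f] assms by simp
    then show "x \<in> average \<mu> f n ` {n..L}" using a assms by auto
  next
    fix x assume "x \<in> average \<mu> f n ` {n..L}"
    then obtain b where b: "n \<le> b" "b \<le> L" "x = average \<mu> f n b" by auto
    then have "x = average (\<lambda>k. \<mu> (L - k)) (\<lambda>k. f (L - k)) (L - b) (L - n)"
      using average_reflect[of n b L \<mu> f] by simp
    then show "x \<in> (\<lambda>a. average (\<lambda>k. \<mu> (L - k)) (\<lambda>k. f (L - k)) a (L - n)) ` {..L - n}"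
      using b by auto
  qed
  then show ?thesis by (simp add: right_maximal_def left_maximal_def)
qed

lemma right_maximal_weak_type:
  assumes "\<And>k. 0 < \<mu> k"
  shows "0 \<le> (\<Sum>n\<le>L. if \<tau> < right_maximal L \<mu> f n then (f n - \<tau>) * \<mu> n else 0)"
proof -
  have "0 \<le> (\<Sum>n\<le>L. if \<tau> < left_maximal (\<lambda>k. \<mu> (L - k)) (\<lambda>k. f (L - k)) n then (f (L - n) - \<tau>) * \<mu> (L - n) else 0)"
    by (rule left_maximal_weak_type) (simp add: assms)
  also have "\<dots> = (\<Sum>n\<le>L. if \<tau> < left_maximal (\<lambda>k. \<mu> (L - k)) (\<lambda>k. f (L - k)) (L - n) then (f n - \<tau>) * \<mu> n else 0)"
    by (rule sum.reindex_bij_witness[of _ "\<lambda>n. L - n" "\<lambda>n. L - n"]) auto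
  also have "\<dots> = (\<Sum>n\<le>L. if \<tau> < right_maximal L \<mu> f n then (f n - \<tau>) * \<mu> n else 0)"
    by (intro sum.cong) (simp_all add: right_maximal_reflect)
  finally show ?thesis .
qed

lemma average_le_maximal:
  "a \<le> n \<Longrightarrow> n \<le> b \<Longrightarrow> b \<le> L \<Longrightarrow> average \<mu> f a b \<le> maximal L \<mu> f n"
  unfolding maximal_def by (rule Max_ge) auto

lemma maximal_eq_average:
  assumes "n \<le> L"
  obtains a b where "a \<le> n" "n \<le> b" "b \<le> L" "maximal L \<mu> f n = average \<mu> f a b"
proof -
  have "maximal L \<mu> f n \<in> (\<lambda>(a, b). average \<mu> f a b) ` ({..n} \<times> {n..L})"
    unfolding maximal_def using assms by (intro Max_in) auto
  then show ?thesis using that by auto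
qed

lemma average_nonneg:
  assumes "\<And>k. 0 < \<mu> k" "\<And>k. 0 \<le> f k"
  shows "0 \<le> average \<mu> f a b"
  unfolding average_def using assms
  by (intro divide_nonneg_nonneg sum_nonneg mult_nonneg_nonneg) (auto intro: less_imp_le)

lemma maximal_nonneg:
  assumes "\<And>k. 0 < \<mu> k" "\<And>k. 0 \<le> f k" "n \<le> L"
  shows "0 \<le> maximal L \<mu> f n"
proof -
  obtain a b where "maximal L \<mu> f n = average \<mu> f a b"
    using maximal_eq_average[OF assms(3)] .
  then show ?thesis using average_nonneg[of \<mu> f a b, OF assms(1,2)] by simp
qed

lemma left_maximal_nonneg:
  assumes "\<And>k. 0 < \<mu> k" "\<And>k. 0 \<le> f k"
  shows "0 \<le> left_maximal \<mu> f n"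
proof -
  have "average \<mu> f n n \<le> left_maximal \<mu> f n"
    unfolding left_maximal_def by (intro Max_ge) auto
  then show ?thesis using average_nonneg[of \<mu> f n n, OF assms] by linarith
qed

lemma right_maximal_nonneg:
  assumes "\<And>k. 0 < \<mu> k" "\<And>k. 0 \<le> f k" "n \<le> L"
  shows "0 \<le> right_maximal L \<mu> f n"
  using left_maximal_nonneg[of "\<lambda>k. \<mu> (L - k)" "\<lambda>k. f (L - k)" "L - n"] assms
  by (simp add: right_maximal_reflect)

text \<open>The optimal interval is cut at n, with n counted in both pieces; replacing the mass of
  the interval by that of a piece only shrinks the denominator.\<close>

lemma maximal_le_one_sided:
  assumes \<mu>: "\<And>k. 0 < \<mu> k" and f: "\<And>k. 0 \<le> f k" and "n \<le> L"
  shows "maximal L \<mu> f n \<le> left_maximal \<mu> f n + right_maximal L \<mu> f n"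
proof -
  obtain a b where ab: "a \<le> n" "n \<le> b" "b \<le> L" "maximal L \<mu> f n = average \<mu> f a b"
    using maximal_eq_average[OF assms(3)] .
  have split: "(\<Sum>k=a..b. g k) \<le> (\<Sum>k=a..n. g k) + (\<Sum>k=n..b. g k)" if "\<And>k. 0 \<le> g k" for g :: "nat \<Rightarrow> real"
  proof -
    have "(\<Sum>k=a..b. g k) = (\<Sum>k\<in>{a..n} \<union> {n..b}. g k)" using ab by (intro sum.cong) auto
    also have "\<dots> \<le> (\<Sum>k=a..n. g k) + (\<Sum>k=n..b. g k)"
      by (simp add: sum_Un that sum_nonneg)
    finally show ?thesis .
  qed
  have pos: "0 < (\<Sum>k=c..d. \<mu> k)" if "c \<le> d" for c d using that \<mu> by (intro sum_pos) auto
  have nn: "0 \<le> f k * \<mu> k" for k using \<mu> f by (simp add: less_imp_le)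
  have "average \<mu> f a b \<le> ((\<Sum>k=a..n. f k * \<mu> k) + (\<Sum>k=n..b. f k * \<mu> k)) / (\<Sum>k=a..b. \<mu> k)"
    unfolding average_def using pos[of a b] ab by (intro divide_right_mono split nn) auto
  also have "\<dots> = (\<Sum>k=a..n. f k * \<mu> k) / (\<Sum>k=a..b. \<mu> k) + (\<Sum>k=n..b. f k * \<mu> k) / (\<Sum>k=a..b. \<mu> k)"
    by (simp add: add_divide_distrib)
  also have "\<dots> \<le> average \<mu> f a n + average \<mu> f n b"
    unfolding average_def
  proof (intro add_mono divide_left_mono mult_pos_pos sum_nonneg)
    show "(\<Sum>k=a..n. \<mu> k) \<le> (\<Sum>k=a..b. \<mu> k)" "(\<Sum>k=n..b. \<mu> k) \<le> (\<Sum>k=a..b. \<mu> k)"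
      using ab \<mu> by (intro sum_mono2; auto intro: less_imp_le)+
  qed (use pos nn ab in simp_all)
  also have "average \<mu> f a n \<le> left_maximal \<mu> f n"
    unfolding left_maximal_def using ab by (intro Max_ge) auto
  also have "average \<mu> f n b \<le> right_maximal L \<mu> f n"
    unfolding right_maximal_def using ab by (intro Max_ge) auto
  finally show ?thesis using ab by simp
qed

lemma weak_type_sum:
  fixes F f \<mu> :: "nat \<Rightarrow> real"
  assumes "0 \<le> (\<Sum>n\<le>L. if \<tau> < F n then (f n - \<tau>) * \<mu> n else 0)"
    "\<And>k. 0 < \<mu> k" "\<And>k. 0 \<le> f k"
  shows "\<tau> * (\<Sum>n | n \<le> L \<and> \<tau> < F n. \<mu> n) \<le> (\<Sum>n\<le>L. f n * \<mu> n)"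
proof -
  have "(\<Sum>n\<le>L. if \<tau> < F n then (f n - \<tau>) * \<mu> n else 0) = (\<Sum>n | n \<le> L \<and> \<tau> < F n. (f n - \<tau>) * \<mu> n)"
    by (subst sum.inter_filter[symmetric]) auto
  also have "\<dots> = (\<Sum>n | n \<le> L \<and> \<tau> < F n. f n * \<mu> n) - \<tau> * (\<Sum>n | n \<le> L \<and> \<tau> < F n. \<mu> n)"
    by (simp add: left_diff_distrib sum_subtractf sum_distrib_left)
  finally have "\<tau> * (\<Sum>n | n \<le> L \<and> \<tau> < F n. \<mu> n) \<le> (\<Sum>n | n \<le> L \<and> \<tau> < F n. f n * \<mu> n)"
    using assms(1) by linarith
  also have "\<dots> \<le> (\<Sum>n\<le>L. f n * \<mu> n)"
    using assms(2,3) by (intro sum_mono2 mult_nonneg_nonneg) (auto intro: less_imp_le)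
  finally show ?thesis .
qed

text \<open>If the two-sided function exceeds \<tau>, one of the one-sided functions exceeds
  \<tau>/2; each of the two contributes a factor 2.\<close>

lemma maximal_weak_type:
  assumes \<mu>: "\<And>k. 0 < \<mu> k" and f: "\<And>k. 0 \<le> f k" and \<tau>: "0 < \<tau>"
  shows "\<tau> * (\<Sum>n | n \<le> L \<and> \<tau> < maximal L \<mu> f n. \<mu> n) \<le> 4 * (\<Sum>n\<le>L. f n * \<mu> n)"
proof -
  let ?l = "{n. n \<le> L \<and> \<tau> / 2 < left_maximal \<mu> f n}"
  let ?r = "{n. n \<le> L \<and> \<tau> / 2 < right_maximal L \<mu> f n}"
  have "{n. n \<le> L \<and> \<tau> < maximal L \<mu> f n} \<subseteq> ?l \<union> ?r"
  proof clarsimp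
    fix n assume "n \<le> L" "\<tau> < maximal L \<mu> f n" "\<not> \<tau> < right_maximal L \<mu> f n * 2"
    then show "\<tau> < left_maximal \<mu> f n * 2"
      using maximal_le_one_sided[of \<mu> f n L, OF \<mu> f] by simp
  qed
  then have "(\<Sum>n | n \<le> L \<and> \<tau> < maximal L \<mu> f n. \<mu> n) \<le> (\<Sum>n\<in>?l \<union> ?r. \<mu> n)"
    using \<mu> by (intro sum_mono2) (auto intro: less_imp_le)
  also have "\<dots> \<le> (\<Sum>n\<in>?l. \<mu> n) + (\<Sum>n\<in>?r. \<mu> n)"
    using \<mu> by (simp add: sum_Un sum_nonneg less_imp_le)
  finally have "\<tau> * (\<Sum>n | n \<le> L \<and> \<tau> < maximal L \<mu> f n. \<mu> n) \<le> \<tau> * ((\<Sum>n\<in>?l. \<mu> n) + (\<Sum>n\<in>?r. \<mu> n))"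
    using \<tau> by (simp add: mult_left_mono)
  also have "\<dots> = 2 * (\<tau> / 2 * (\<Sum>n\<in>?l. \<mu> n)) + 2 * (\<tau> / 2 * (\<Sum>n\<in>?r. \<mu> n))"
    by (simp add: distrib_left)
  also have "\<dots> \<le> 2 * (\<Sum>n\<le>L. f n * \<mu> n) + 2 * (\<Sum>n\<le>L. f n * \<mu> n)"
    using weak_type_sum[where L = L and \<tau> = "\<tau> / 2" and F = "left_maximal \<mu> f" and f = f and \<mu> = \<mu>, OF left_maximal_weak_type, OF \<mu> \<mu> f]
      weak_type_sum[where L = L and \<tau> = "\<tau> / 2" and F = "right_maximal L \<mu> f" and f = f and \<mu> = \<mu>, OF right_maximal_weak_type, OF \<mu> \<mu> f]
    by linarith
  finally show ?thesis by simp
qed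

lemma powr_add_le:
  assumes "0 \<le> (x::real)" "0 \<le> y" "0 \<le> p"
  shows "(x + y) powr p \<le> 2 powr p * (x powr p + y powr p)"
proof -
  have "(x + y) powr p \<le> (2 * max x y) powr p" using assms by (intro powr_mono2) auto
  also have "\<dots> = 2 powr p * max x y powr p" using assms by (simp add: powr_mult)
  also have "max x y powr p \<le> x powr p + y powr p" by (simp add: max_def)
  finally show ?thesis by simp
qed

text \<open>The constant depends on p alone. Its uniformity in the weight is essential below, where
  the inequality is applied once for \<omega> and once for its dual weight.\<close>

lemma maximal_strong_type:
  assumes \<mu>: "\<And>k. 0 < \<mu> k" and f: "\<And>k. 0 \<le> f k" and p: "1 < p"
  shows "(\<Sum>n\<le>L. maximal L \<mu> f n powr p * \<mu> n)
    \<le> 2 * 2 powr p * (p / (p - 1)) powr p * (\<Sum>n\<le>L. f n powr p * \<mu> n)"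
proof -
  let ?l = "left_maximal \<mu> f" and ?r = "right_maximal L \<mu> f"
  have "(\<Sum>n\<le>L. maximal L \<mu> f n powr p * \<mu> n)
      \<le> (\<Sum>n\<le>L. 2 powr p * (?l n powr p + ?r n powr p) * \<mu> n)"
  proof (intro sum_mono mult_right_mono)
    fix n assume "n \<in> {..L}"
    then have n: "n \<le> L" by simp
    have "maximal L \<mu> f n powr p \<le> (?l n + ?r n) powr p"
      using p maximal_nonneg[of \<mu> f n L, OF \<mu> f n] maximal_le_one_sided[of \<mu> f n L, OF \<mu> f n]
      by (intro powr_mono2) auto
    also have "\<dots> \<le> 2 powr p * (?l n powr p + ?r n powr p)"
      using p left_maximal_nonneg[of \<mu> f n, OF \<mu> f] right_maximal_nonneg[of \<mu> f n L, OF \<mu> f n]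
      by (intro powr_add_le) auto
    finally show "maximal L \<mu> f n powr p \<le> 2 powr p * (?l n powr p + ?r n powr p)" .
  qed (use \<mu> in \<open>simp add: less_imp_le\<close>)
  also have "\<dots> = 2 powr p * ((\<Sum>n\<le>L. ?l n powr p * \<mu> n) + (\<Sum>n\<le>L. ?r n powr p * \<mu> n))"
    by (simp add: sum_distrib_left sum.distrib distrib_left distrib_right mult.assoc)
  also have "\<dots> \<le> 2 powr p * ((p / (p - 1)) powr p * (\<Sum>n\<le>L. f n powr p * \<mu> n)
      + (p / (p - 1)) powr p * (\<Sum>n\<le>L. f n powr p * \<mu> n))"
    using \<mu> f p
    by (intro mult_left_mono add_mono sum_powr_le_of_weak_type left_maximal_weak_type
        right_maximal_weak_type left_maximal_nonneg right_maximal_nonneg) (auto intro: less_imp_le)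
  finally show ?thesis by (simp add: algebra_simps)
qed

section \<open>Muckenhoupt weights\<close>

text \<open>With \<sigma> = \<omega>^(-1/(p-1)) and q = p/(p-1), the pointwise inequality is (M
  f)^(p-1) \<le> C M_\<omega>(M_\<sigma>(f/\<sigma>)^(p-1) / \<omega>). Taking the L^q(\<omega>)
  norm and then the L^p(\<sigma>) norm only involves maximal functions with respect to their own
  weight, and the remaining powers of the weights recombine to the norm of f in
  L^p(\<omega>).\<close>

lemma muckenhoupt_maximal_strong_type:
  assumes p: "1 < p" and "muckenhoupt p \<omega>"
  obtains C where "0 \<le> C" "\<And>f L. (\<And>k. 0 \<le> f k) \<Longrightarrow>
    (\<Sum>n\<le>L. maximal L (\<lambda>_. 1) f n powr p * \<omega> n) \<le> C * (\<Sum>n\<le>L. f n powr p * \<omega> n)"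
proof -
  have \<omega>: "0 < \<omega> k" for k using assms(2) by (auto simp: muckenhoupt_def weight_seq_def)
  define \<sigma> where "\<sigma> k = \<omega> k powr (- (1 / (p - 1)))" for k
  have \<sigma>: "0 < \<sigma> k" for k using \<omega>[of k] by (simp add: \<sigma>_def)
  obtain C where C: "\<And>m n. m \<le> n \<Longrightarrow> 1 / (real n - real m + 1) powr p * (\<Sum>k=m..n. \<omega> k) *
      (\<Sum>k=m..n. \<sigma> k) powr (p - 1) \<le> C"
    using assms(2) unfolding muckenhoupt_def \<sigma>_def by blast
  have C0: "0 \<le> C"
    using C[of 0 0] \<omega>[of 0] by (simp add: order_trans[rotated])
  define q where "q = p / (p - 1)"
  have q: "1 < q" "(p - 1) * q = p" "1 - q = - (1 / (p - 1))"
    using p by (auto simp: q_def field_simps)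
  define D where "D = (\<lambda>r::real. 2 * 2 powr r * (r / (r - 1)) powr r)"
  show ?thesis
  proof (rule that[of "C powr q * D q * D p"])
    show "0 \<le> C powr q * D q * D p" by (simp add: D_def)
    fix f :: "nat \<Rightarrow> real" and L assume f: "\<And>k. 0 \<le> f k"
    define h where "h k = f k / \<sigma> k" for k
    have h: "0 \<le> h k" for k using f[of k] \<sigma>[of k] by (simp add: h_def)
    define H where "H = maximal L \<sigma> h"
    have H: "0 \<le> H k" if "k \<le> L" for k unfolding H_def by (rule maximal_nonneg[OF \<sigma> h that])
    define G where "G k = H k powr (p - 1) / \<omega> k" for k
    have G: "0 \<le> G k" for k using \<omega>[of k] by (simp add: G_def)
    have key: "maximal L (\<lambda>_. 1) f n powr p \<le> C powr q * maximal L \<omega> G n powr q" if n: "n \<le> L" for n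
    proof -
      obtain a b where ab: "a \<le> n" "n \<le> b" "b \<le> L" and A: "maximal L (\<lambda>_. 1) f n = average (\<lambda>_. 1) f a b"
        using maximal_eq_average[OF n] .
      define I where "I = real b - real a + 1"
      have I: "0 < I" "(\<Sum>k=a..b. 1::real) = I" using ab by (auto simp: I_def)
      define S where "S = (\<Sum>k=a..b. \<sigma> k)"
      define V where "V = (\<Sum>k=a..b. \<omega> k)"
      have S: "0 < S" and V: "0 < V" unfolding S_def V_def using ab \<sigma> \<omega> by (auto intro!: sum_pos)
      define E where "E = average \<sigma> h a b"
      have E: "0 \<le> E" unfolding E_def by (rule average_nonneg[OF \<sigma> h])
      have "(\<Sum>k=a..b. h k * \<sigma> k) = (\<Sum>k=a..b. f k)"
        using \<sigma> by (intro sum.cong) (auto simp: h_def less_imp_neq[THEN not_sym])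
      \<comment> \<open>The plain mean of f is the \<sigma>-mean of f/\<sigma> times S/I, and the
        A_p condition bounds (S/I)^(p-1) by C I/V.\<close>
      then have "maximal L (\<lambda>_. 1) f n = S / I * E"
        using S I by (simp add: A E_def average_def S_def)
      then have "maximal L (\<lambda>_. 1) f n powr (p - 1) = (S / I) powr (p - 1) * E powr (p - 1)"
        using S I E by (simp add: powr_mult powr_divide)
      also have "(S / I) powr (p - 1) \<le> C * I / V"
      proof -
        have "I powr p = I * I powr (p - 1)" using I powr_add[of I 1 "p - 1"] by simp
        moreover have "1 / I powr p * V * S powr (p - 1) \<le> C"
          using C[of a b] ab by (simp add: I_def V_def S_def)
        ultimately show ?thesis
          using I V S by (simp add: powr_divide field_simps)
      qed
      also have "C * I / V * E powr (p - 1) = C * (I * E powr (p - 1) / V)" by simp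
      also have "I * E powr (p - 1) = (\<Sum>k=a..b. E powr (p - 1))" using I by simp
      \<comment> \<open>Every point k of the interval sees the same interval in its own maximal
        function, so E \<le> H k; this turns the constant E into an \<omega>-average of
        \<open>G\<close>.\<close>
      also have "\<dots> \<le> (\<Sum>k=a..b. G k * \<omega> k)"
      proof (rule sum_mono)
        fix k assume k: "k \<in> {a..b}"
        have "E \<le> H k" unfolding E_def H_def using k ab by (intro average_le_maximal) auto
        then have "E powr (p - 1) \<le> H k powr (p - 1)" using E p by (intro powr_mono2) auto
        then show "E powr (p - 1) \<le> G k * \<omega> k" using \<omega>[of k] by (simp add: G_def)
      qed
      also have "(\<Sum>k=a..b. G k * \<omega> k) / V \<le> maximal L \<omega> G n"
        using average_le_maximal[OF ab, of \<omega> G] by (simp add: average_def V_def)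
      finally have *: "maximal L (\<lambda>_. 1) f n powr (p - 1) \<le> C * maximal L \<omega> G n"
        using C0 V E by (simp add: divide_right_mono mult_left_mono mult_right_mono)
      have "maximal L (\<lambda>_. 1) f n powr p = (maximal L (\<lambda>_. 1) f n powr (p - 1)) powr q"
        by (simp add: powr_powr q)
      also have "\<dots> \<le> (C * maximal L \<omega> G n) powr q"
        using * q by (intro powr_mono2) auto
      also have "\<dots> = C powr q * maximal L \<omega> G n powr q"
        using C0 maximal_nonneg[of \<omega> G n L, OF \<omega> G n] by (simp add: powr_mult)
      finally show ?thesis .
    qed
    have "(\<Sum>n\<le>L. maximal L (\<lambda>_. 1) f n powr p * \<omega> n) \<le> (\<Sum>n\<le>L. C powr q * maximal L \<omega> G n powr q * \<omega> n)"
      using key \<omega> by (intro sum_mono mult_right_mono) (auto intro: less_imp_le)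
    also have "\<dots> = C powr q * (\<Sum>n\<le>L. maximal L \<omega> G n powr q * \<omega> n)"
      by (simp add: sum_distrib_left mult.assoc)
    also have "(\<Sum>n\<le>L. maximal L \<omega> G n powr q * \<omega> n) \<le> D q * (\<Sum>n\<le>L. G n powr q * \<omega> n)"
      unfolding D_def by (rule maximal_strong_type[of \<omega> G q, OF \<omega> G q(1)])
    \<comment> \<open>Duality of exponents: (p - 1) q = p and 1 - q = -1/(p - 1), so \<omega>^(1-q)
      is the dual weight. The same computation in the other direction gives \<sigma>^(1-p) =
      \<omega> below.\<close>
    also have "(\<Sum>n\<le>L. G n powr q * \<omega> n) = (\<Sum>n\<le>L. H n powr p * \<sigma> n)"
    proof (rule sum.cong[OF refl])
      fix n assume "n \<in> {..L}"
      have "G n powr q * \<omega> n = H n powr p * (\<omega> n powr (- q) * \<omega> n powr 1)"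
        using \<omega>[of n] by (simp add: G_def powr_divide powr_powr q powr_minus_divide)
      also have "\<omega> n powr (- q) * \<omega> n powr 1 = \<sigma> n"
        unfolding powr_add[symmetric] \<sigma>_def using q(3) by simp
      finally show "G n powr q * \<omega> n = H n powr p * \<sigma> n" .
    qed
    also have "\<dots> \<le> D p * (\<Sum>n\<le>L. h n powr p * \<sigma> n)"
      unfolding D_def H_def by (rule maximal_strong_type[of \<sigma> h p, OF \<sigma> h p])
    also have "(\<Sum>n\<le>L. h n powr p * \<sigma> n) = (\<Sum>n\<le>L. f n powr p * \<omega> n)"
    proof (rule sum.cong[OF refl])
      fix n assume "n \<in> {..L}"
      have "h n powr p * \<sigma> n = f n powr p * (\<sigma> n powr (- p) * \<sigma> n powr 1)"
        using \<sigma>[of n] f[of n] by (simp add: h_def powr_divide powr_minus_divide)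
      also have "\<sigma> n powr (- p) * \<sigma> n powr 1 = \<omega> n"
      proof -
        have "- (1 / (p - 1)) * (- p + 1) = 1" using p by (simp add: field_simps)
        then show ?thesis
          unfolding powr_add[symmetric] unfolding \<sigma>_def powr_powr using \<omega>[of n] by simp
      qed
      finally show "h n powr p * \<sigma> n = f n powr p * \<omega> n" .
    qed
    finally show "(\<Sum>n\<le>L. maximal L (\<lambda>_. 1) f n powr p * \<omega> n)
        \<le> C powr q * D q * D p * (\<Sum>n\<le>L. f n powr p * \<omega> n)"
      by (simp add: mult.assoc mult_left_mono D_def)
  qed
qed

text \<open>The A_1 condition bounds the largest value of 1/\<omega> on an interval by C times its
  length over its \<omega>-mass, so plain averages are at most C times \<omega>-averages, and the
  weak type inequality for arbitrary weights applies.\<close>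

lemma muckenhoupt1_maximal_weak_type:
  assumes "muckenhoupt1 \<omega>"
  obtains C where "0 \<le> C" "\<And>f L \<tau>. (\<And>k. 0 \<le> f k) \<Longrightarrow> 0 < \<tau> \<Longrightarrow>
    \<tau> * (\<Sum>n | n \<le> L \<and> \<tau> < maximal L (\<lambda>_. 1) f n. \<omega> n) \<le> C * (\<Sum>n\<le>L. f n * \<omega> n)"
proof -
  have \<omega>: "0 < \<omega> k" for k using assms by (auto simp: muckenhoupt1_def weight_seq_def)
  obtain C where C: "\<And>m n. m \<le> n \<Longrightarrow> 1 / (real n - real m + 1) * (\<Sum>k=m..n. \<omega> k) *
      Max ((\<lambda>k. inverse (\<omega> k)) ` {m..n}) \<le> C"
    using assms unfolding muckenhoupt1_def by blast
  have C0: "0 < C" using C[of 0 0] \<omega>[of 0] by simp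
  show ?thesis
  proof (rule that[of "4 * C"])
    show "0 \<le> 4 * C" using C0 by simp
    fix f :: "nat \<Rightarrow> real" and L and \<tau> :: real
    assume f: "\<And>k. 0 \<le> f k" and \<tau>: "0 < \<tau>"
    have key: "maximal L (\<lambda>_. 1) f n \<le> C * maximal L \<omega> f n" if n: "n \<le> L" for n
    proof -
      obtain a b where ab: "a \<le> n" "n \<le> b" "b \<le> L" and A: "maximal L (\<lambda>_. 1) f n = average (\<lambda>_. 1) f a b"
        using maximal_eq_average[OF n] .
      define I where "I = real b - real a + 1"
      have I: "0 < I" "(\<Sum>k=a..b. 1::real) = I" using ab by (auto simp: I_def)
      define V where "V = (\<Sum>k=a..b. \<omega> k)"
      have V: "0 < V" unfolding V_def using ab \<omega> by (auto intro!: sum_pos)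
      define X where "X = Max ((\<lambda>k. inverse (\<omega> k)) ` {a..b})"
      have "(\<Sum>k=a..b. f k) \<le> (\<Sum>k=a..b. f k * \<omega> k * X)"
      proof (rule sum_mono)
        fix k assume "k \<in> {a..b}"
        then have "inverse (\<omega> k) \<le> X" unfolding X_def by (intro Max_ge) auto
        then have "f k * \<omega> k * inverse (\<omega> k) \<le> f k * \<omega> k * X"
          using f[of k] \<omega>[of k] by (intro mult_left_mono mult_nonneg_nonneg) (auto intro: less_imp_le)
        moreover have "f k * \<omega> k * inverse (\<omega> k) = f k" using \<omega>[of k] by simp
        ultimately show "f k \<le> f k * \<omega> k * X" by simp
      qed
      also have "\<dots> = (\<Sum>k=a..b. f k * \<omega> k) * X" by (simp add: sum_distrib_right)
      finally have "maximal L (\<lambda>_. 1) f n \<le> (\<Sum>k=a..b. f k * \<omega> k) * (X / I)"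
        using I by (simp add: A average_def divide_right_mono)
      also have "\<dots> \<le> (\<Sum>k=a..b. f k * \<omega> k) * (C / V)"
      proof (intro mult_left_mono sum_nonneg mult_nonneg_nonneg)
        have "1 / I * V * X \<le> C" using C[of a b] ab by (simp add: I_def V_def X_def)
        then show "X / I \<le> C / V" using V I by (simp add: field_simps)
      qed (use f \<omega> in \<open>auto intro: less_imp_le\<close>)
      also have "\<dots> = C * average \<omega> f a b" by (simp add: average_def V_def)
      also have "\<dots> \<le> C * maximal L \<omega> f n"
        using average_le_maximal[OF ab, of \<omega> f] C0 by simp
      finally show ?thesis .
    qed
    have "(\<Sum>n | n \<le> L \<and> \<tau> < maximal L (\<lambda>_. 1) f n. \<omega> n) \<le> (\<Sum>n | n \<le> L \<and> \<tau> / C < maximal L \<omega> f n. \<omega> n)"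
    proof (rule sum_mono2)
      show "{n. n \<le> L \<and> \<tau> < maximal L (\<lambda>_. 1) f n} \<subseteq> {n. n \<le> L \<and> \<tau> / C < maximal L \<omega> f n}"
        using key C0 by (auto simp: divide_less_eq mult.commute intro: less_le_trans)
    qed (use \<omega> in \<open>auto intro: less_imp_le\<close>)
    then have "\<tau> * (\<Sum>n | n \<le> L \<and> \<tau> < maximal L (\<lambda>_. 1) f n. \<omega> n)
        \<le> C * (\<tau> / C * (\<Sum>n | n \<le> L \<and> \<tau> / C < maximal L \<omega> f n. \<omega> n))"
      using C0 \<tau> by simp
    also have "\<dots> \<le> C * (4 * (\<Sum>n\<le>L. f n * \<omega> n))"
      using C0 \<tau> by (intro mult_left_mono maximal_weak_type \<omega> f) auto
    finally show "\<tau> * (\<Sum>n | n \<le> L \<and> \<tau> < maximal L (\<lambda>_. 1) f n. \<omega> n) \<le> 4 * C * (\<Sum>n\<le>L. f n * \<omega> n)"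
      by simp
  qed
qed

section \<open>From kernel bounds to the maximal function\<close>

text \<open>The number of integers j with |j| \<le> r is 2r + 1, so the left side is what Abel
  summation produces from a radial profile, and the right side is the sum of \<phi>(|j|) over |j|
  \<le> L + 1.\<close>

lemma sum_by_parts_dist:
  fixes \<phi> :: "nat \<Rightarrow> real"
  shows "(\<Sum>r\<le>L. (\<phi> r - \<phi> (Suc r)) * (2 * real r + 1)) + \<phi> (Suc L) * (2 * real L + 3)
    = \<phi> 0 + 2 * (\<Sum>r=1..Suc L. \<phi> r)"
  by (induction L) (simp_all add: algebra_simps)

text \<open>The two bounds are merged into one radially decreasing majorant. Such a profile is a
  positive combination of indicators of intervals around n, and the sum of \<open>F\<close> over
  each interval is at most its length times the maximal function.\<close>

lemma sum_kernel_le_maximal: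
  fixes N C :: real
  assumes N: "1 \<le> N" and F: "\<And>m. 0 \<le> F m"
    and k: "\<And>m. k m \<le> C / N" "\<And>m. k m * (real n - real m)\<^sup>2 \<le> C * N"
    and C: "0 \<le> C" and n: "n \<le> L"
  shows "(\<Sum>m\<le>L. F m * k m) \<le> 16 * C * maximal L (\<lambda>_. 1) F n"
proof -
  \<comment> \<open>Comparable with N/(N + j)^2, but written as a difference so that its sum
    telescopes to at most 1. The constant 16 is 8 from the comparison with the kernel times 2 for
    the two sides of n.\<close>
  define \<phi> where "\<phi> j = N / (N + real j) - N / (N + real j + 1)" for j
  have \<phi>_eq: "\<phi> j = N / ((N + real j) * (N + real j + 1))" for j
    using N by (simp add: \<phi>_def field_simps)
  have \<phi>_decr: "\<phi> (Suc j) \<le> \<phi> j" for j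
    unfolding \<phi>_eq using N by (intro divide_left_mono mult_mono mult_pos_pos) auto
  have \<phi>_nonneg: "0 \<le> \<phi> j" for j unfolding \<phi>_eq using N by simp
  define d where "d m = nat \<bar>int n - int m\<bar>" for m
  have d: "real (d m) = \<bar>real n - real m\<bar>" for m by (simp add: d_def)
  have dL: "d m \<le> L" if "m \<le> L" for m using that n by (auto simp: d_def)
  define A where "A = maximal L (\<lambda>_. 1) F n"
  have A: "0 \<le> A" unfolding A_def by (rule maximal_nonneg) (use F n in auto)
  define S where "S r = (\<Sum>m\<le>L. if d m \<le> r then F m else 0)" for r
  have S: "S r \<le> (2 * real r + 1) * A" for r
  proof -
    have "S r = (\<Sum>m | m \<le> L \<and> d m \<le> r. F m)"
      unfolding S_def by (subst sum.inter_filter[symmetric]) auto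
    \<comment> \<open>Truncated subtraction gives the correct left end 0 when r > n.\<close>
    also have "{m. m \<le> L \<and> d m \<le> r} = {n - r..min L (n + r)}" by (auto simp: d_def)
    also have "(\<Sum>m=n - r..min L (n + r). F m) = real (card {n - r..min L (n + r)}) * average (\<lambda>_. 1) F (n - r) (min L (n + r))"
      using n by (simp add: average_def)
    also have "\<dots> \<le> (2 * real r + 1) * A"
      unfolding A_def using n F by (intro mult_mono average_le_maximal average_nonneg) (auto simp: min_def)
    finally show ?thesis .
  qed
  have k_le: "k m \<le> 8 * C * \<phi> (d m)" for m
  proof -
    define x where "x = real (d m)"
    have x: "0 \<le> x" "(real n - real m)\<^sup>2 = x\<^sup>2" by (auto simp: x_def d)
    have "k m * N\<^sup>2 \<le> C / N * N\<^sup>2" using k(1) by (intro mult_right_mono) auto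
    also have "\<dots> = C * N" using N by (simp add: power2_eq_square)
    finally have "k m * (N\<^sup>2 + x\<^sup>2) \<le> 2 * C * N"
      using k(2)[of m] x by (simp add: distrib_left)
    then have "k m \<le> 2 * C * N / (N\<^sup>2 + x\<^sup>2)" using N by (simp add: pos_le_divide_eq sum_power2_gt_zero_iff)
    also have "\<dots> \<le> 2 * C * N / ((N + x) * (N + x + 1) / 4)"
    proof (rule divide_left_mono)
      have "(N + x) * (N + x + 1) \<le> (N + x) * (2 * (N + x))" using N x by (intro mult_left_mono) auto
      also have "\<dots> \<le> 4 * (N\<^sup>2 + x\<^sup>2)"
        using zero_le_power2[of "N - x"] by (simp add: power2_eq_square algebra_simps)
      finally show "(N + x) * (N + x + 1) / 4 \<le> N\<^sup>2 + x\<^sup>2" by simp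
    qed (use N C x in \<open>auto intro!: mult_pos_pos add_pos_nonneg\<close>)
    also have "\<dots> = 8 * C * \<phi> (d m)" by (simp add: \<phi>_eq x_def)
    finally show ?thesis .
  qed
  have \<phi>_abel: "\<phi> (d m) = (\<Sum>r\<le>L. if d m \<le> r then \<phi> r - \<phi> (Suc r) else 0) + \<phi> (Suc L)" if "m \<le> L" for m
  proof -
    have "(\<Sum>r\<le>L. if d m \<le> r then \<phi> r - \<phi> (Suc r) else 0) = (\<Sum>r=d m..L. \<phi> r - \<phi> (Suc r))"
      by (rule sum.mono_neutral_cong_right) auto
    also have "\<dots> = - (\<Sum>r=d m..L. \<phi> (Suc r) - \<phi> r)" by (simp add: sum_subtractf)
    also have "\<dots> = \<phi> (d m) - \<phi> (Suc L)" using dL[OF that] by (subst sum_Suc_diff) auto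
    finally show ?thesis by simp
  qed
  have "(\<Sum>m\<le>L. F m * k m) \<le> (\<Sum>m\<le>L. F m * (8 * C * \<phi> (d m)))"
    by (intro sum_mono mult_left_mono k_le F)
  also have "\<dots> = 8 * C * (\<Sum>m\<le>L. F m * \<phi> (d m))" by (simp add: sum_distrib_left algebra_simps)
  also have "(\<Sum>m\<le>L. F m * \<phi> (d m))
      = (\<Sum>m\<le>L. \<Sum>r\<le>L. (\<phi> r - \<phi> (Suc r)) * (if d m \<le> r then F m else 0)) + \<phi> (Suc L) * (\<Sum>m\<le>L. F m)"
    unfolding sum_distrib_left sum.distrib[symmetric]
  proof (rule sum.cong[OF refl])
    fix m assume "m \<in> {..L}"
    then have "F m * \<phi> (d m) = F m * (\<Sum>r\<le>L. if d m \<le> r then \<phi> r - \<phi> (Suc r) else 0) + \<phi> (Suc L) * F m"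
      using \<phi>_abel[of m] by (simp add: algebra_simps)
    also have "F m * (\<Sum>r\<le>L. if d m \<le> r then \<phi> r - \<phi> (Suc r) else 0)
        = (\<Sum>r\<le>L. (\<phi> r - \<phi> (Suc r)) * (if d m \<le> r then F m else 0))"
      unfolding sum_distrib_left by (intro sum.cong) auto
    finally show "F m * \<phi> (d m)
        = (\<Sum>r\<le>L. (\<phi> r - \<phi> (Suc r)) * (if d m \<le> r then F m else 0)) + \<phi> (Suc L) * F m" .
  qed
  also have "(\<Sum>m\<le>L. \<Sum>r\<le>L. (\<phi> r - \<phi> (Suc r)) * (if d m \<le> r then F m else 0)) = (\<Sum>r\<le>L. (\<phi> r - \<phi> (Suc r)) * S r)"
    unfolding S_def sum_distrib_left by (rule sum.swap)
  also have "(\<Sum>m\<le>L. F m) = S L" unfolding S_def using dL by (intro sum.cong) auto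
  also have "(\<Sum>r\<le>L. (\<phi> r - \<phi> (Suc r)) * S r) + \<phi> (Suc L) * S L
      \<le> (\<Sum>r\<le>L. (\<phi> r - \<phi> (Suc r)) * ((2 * real r + 1) * A)) + \<phi> (Suc L) * ((2 * real L + 3) * A)"
  proof (intro add_mono sum_mono mult_left_mono S)
    have "S L \<le> (2 * real L + 1) * A" by (rule S)
    also have "\<dots> \<le> (2 * real L + 3) * A" using A by (intro mult_right_mono) auto
    finally show "S L \<le> (2 * real L + 3) * A" .
  qed (use \<phi>_decr \<phi>_nonneg in auto)
  also have "\<dots> = ((\<Sum>r\<le>L. (\<phi> r - \<phi> (Suc r)) * (2 * real r + 1)) + \<phi> (Suc L) * (2 * real L + 3)) * A"
    by (simp add: sum_distrib_right distrib_right mult.assoc)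
  also have "\<dots> = (\<phi> 0 + 2 * (\<Sum>r=1..Suc L. \<phi> r)) * A" unfolding sum_by_parts_dist ..
  also have "\<dots> \<le> 2 * A"
  proof (intro mult_right_mono A)
    have "\<phi> 0 + (\<Sum>r=1..Suc L. \<phi> r) = (\<Sum>r=0..Suc L. \<phi> r)"
      by (subst sum.atLeast_Suc_atMost[of 0]) auto
    also have "\<dots> = - (\<Sum>r=0..Suc L. N / (N + real (Suc r)) - N / (N + real r))"
      unfolding sum_negf[symmetric] by (intro sum.cong) (auto simp: \<phi>_def algebra_simps)
    also have "\<dots> = N / (N + 0) - N / (N + real (Suc (Suc L)))"
      by (subst sum_Suc_diff[of 0 "Suc L" "\<lambda>r. N / (N + real r)"]) auto
    also have "\<dots> \<le> 1" using N by simp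
    finally show "\<phi> 0 + 2 * (\<Sum>r=1..Suc L. \<phi> r) \<le> 2" using \<phi>_nonneg[of 0] by linarith
  qed
  finally show ?thesis using C by (simp add: A_def mult_left_mono)
qed

section \<open>Weighted sequence spaces\<close>

lemma summable_lp_diff:
  assumes p: "1 \<le> p" and \<omega>: "\<And>k. 0 < \<omega> k" and f: "f \<in> lp_space p \<omega>" and g: "g \<in> lp_space p \<omega>"
  shows "(\<lambda>n. f n - g n) \<in> lp_space p \<omega>"
proof -
  have "summable (\<lambda>m. 2 powr p * (cmod (f m) powr p * \<omega> m + cmod (g m) powr p * \<omega> m))"
    using f g by (intro summable_mult summable_add) (auto simp: lp_space_def)
  then have "summable (\<lambda>m. cmod (f m - g m) powr p * \<omega> m)"
  proof (rule summable_comparison_test'[where N = 0])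
    fix m :: nat
    have "cmod (f m - g m) powr p \<le> (cmod (f m) + cmod (g m)) powr p"
      using p by (intro powr_mono2 norm_triangle_ineq4) auto
    also have "\<dots> \<le> 2 powr p * (cmod (f m) powr p + cmod (g m) powr p)"
      using p by (intro powr_add_le) auto
    finally have "cmod (f m - g m) powr p * \<omega> m \<le> 2 powr p * (cmod (f m) powr p + cmod (g m) powr p) * \<omega> m"
      using \<omega>[of m] by (intro mult_right_mono) auto
    then show "norm (cmod (f m - g m) powr p * \<omega> m) \<le> 2 powr p * (cmod (f m) powr p * \<omega> m + cmod (g m) powr p * \<omega> m)"
      using \<omega>[of m] by (simp add: algebra_simps)
  qed
  then show ?thesis by (simp add: lp_space_def)
qed

lemma lp_norm_nonneg [simp]: "0 \<le> lp_norm p \<omega> f"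
  by (simp add: lp_norm_def)

lemma lp_norm_powr:
  assumes p: "0 < p" and \<omega>: "\<And>k. 0 < \<omega> k" and f: "f \<in> lp_space p \<omega>"
  shows "lp_norm p \<omega> f powr p = (\<Sum>m. cmod (f m) powr p * \<omega> m)"
proof -
  have "0 \<le> (\<Sum>m. cmod (f m) powr p * \<omega> m)"
    using f \<omega> by (intro suminf_nonneg) (auto simp: lp_space_def less_imp_le)
  then show ?thesis using p by (simp add: lp_norm_def powr_powr)
qed

lemma sum_le_lp_norm_powr:
  assumes p: "0 < p" and \<omega>: "\<And>k. 0 < \<omega> k" and f: "f \<in> lp_space p \<omega>" and "finite A"
  shows "(\<Sum>n\<in>A. cmod (f n) powr p * \<omega> n) \<le> lp_norm p \<omega> f powr p"
  unfolding lp_norm_powr[of p \<omega>, OF p \<omega> f] using assms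
  by (intro sum_le_suminf) (auto simp: lp_space_def less_imp_le)

lemma lp_space_boundI:
  assumes p: "0 < p" and \<omega>: "\<And>k. 0 < \<omega> k" and B: "0 \<le> B"
    and le: "\<And>L. (\<Sum>n\<le>L. cmod (f n) powr p * \<omega> n) \<le> B powr p"
  shows "f \<in> lp_space p \<omega>" "lp_norm p \<omega> f \<le> B"
proof -
  have nn: "0 \<le> cmod (f n) powr p * \<omega> n" for n using \<omega>[of n] by simp
  have le': "(\<Sum>n<L. cmod (f n) powr p * \<omega> n) \<le> B powr p" for L
    using sum_mono2[of "{..L}" "{..<L}" "\<lambda>n. cmod (f n) powr p * \<omega> n"] nn le[of L] by force
  have s: "summable (\<lambda>n. cmod (f n) powr p * \<omega> n)"
    by (rule summableI_nonneg_bounded[OF nn le'])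
  then show "f \<in> lp_space p \<omega>" by (simp add: lp_space_def)
  have "(\<Sum>n. cmod (f n) powr p * \<omega> n) \<le> B powr p"
    by (rule suminf_le_const[OF s le'])
  then have "(\<Sum>n. cmod (f n) powr p * \<omega> n) powr (1 / p) \<le> (B powr p) powr (1 / p)"
    using p s nn by (intro powr_mono2 suminf_nonneg) auto
  then show "lp_norm p \<omega> f \<le> B" using p B by (simp add: lp_norm_def powr_powr)
qed

lemma lp_norm_pointwise:
  assumes p: "0 < p" and \<omega>: "\<And>k. 0 < \<omega> k" and f: "f \<in> lp_space p \<omega>"
  shows "cmod (f n) * \<omega> n powr (1 / p) \<le> lp_norm p \<omega> f"
proof -
  have "cmod (f n) powr p * \<omega> n \<le> lp_norm p \<omega> f powr p"
    using sum_le_lp_norm_powr[of p \<omega> f "{n}", OF p \<omega> f] by simp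
  then have "(cmod (f n) powr p * \<omega> n) powr (1 / p) \<le> (lp_norm p \<omega> f powr p) powr (1 / p)"
    using p \<omega>[of n] by (intro powr_mono2) auto
  then show ?thesis using p \<omega>[of n] by (simp add: powr_mult powr_powr)
qed

definition truncate_seq :: "nat \<Rightarrow> (nat \<Rightarrow> complex) \<Rightarrow> nat \<Rightarrow> complex" where
  "truncate_seq k f n = (if n < k then f n else 0)"

lemma truncate_seq_lp: "truncate_seq k f \<in> lp_space p \<omega>"
proof -
  have "summable (\<lambda>m. cmod (truncate_seq k f m) powr p * \<omega> m)"
    by (rule summable_finite[of "{..<k}"]) (auto simp: truncate_seq_def)
  then show ?thesis by (simp add: lp_space_def)
qed

lemma truncate_seq_tendsto:
  assumes p: "0 < p" and \<omega>: "\<And>k. 0 < \<omega> k" and f: "f \<in> lp_space p \<omega>"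
  shows "(\<lambda>k. lp_norm p \<omega> (\<lambda>n. f n - truncate_seq k f n)) \<longlonglongrightarrow> 0"
proof -
  let ?a = "\<lambda>n. cmod (f n) powr p * \<omega> n"
  have s: "summable ?a" using f by (simp add: lp_space_def)
  have eq: "(\<Sum>n. cmod (f n - truncate_seq k f n) powr p * \<omega> n) = suminf ?a - (\<Sum>n<k. ?a n)" for k
  proof -
    have "(\<lambda>n. if n < k then ?a n else 0) sums (\<Sum>n<k. ?a n)"
      using sums_If_finite_set[of "{..<k}" ?a] by simp
    from sums_diff[OF summable_sums[OF s] this]
    have "(\<lambda>n. ?a n - (if n < k then ?a n else 0)) sums (suminf ?a - (\<Sum>n<k. ?a n))" .
    moreover have "(\<lambda>n. ?a n - (if n < k then ?a n else 0)) = (\<lambda>n. cmod (f n - truncate_seq k f n) powr p * \<omega> n)"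
      by (auto simp: truncate_seq_def fun_eq_iff)
    ultimately show ?thesis by (simp add: sums_iff)
  qed
  have "(\<lambda>k. suminf ?a - (\<Sum>n<k. ?a n)) \<longlonglongrightarrow> suminf ?a - suminf ?a"
    by (intro tendsto_diff tendsto_const summable_LIMSEQ s)
  then have "(\<lambda>k. suminf ?a - (\<Sum>n<k. ?a n)) \<longlonglongrightarrow> 0" by simp
  moreover have "0 \<le> suminf ?a - (\<Sum>n<k. ?a n)" for k
  proof -
    have "(\<Sum>n<k. ?a n) \<le> suminf ?a"
      using \<omega> by (intro sum_le_suminf s mult_nonneg_nonneg) (auto intro: less_imp_le)
    then show ?thesis by linarith
  qed
  ultimately have "(\<lambda>k. (suminf ?a - (\<Sum>n<k. ?a n)) powr (1 / p)) \<longlonglongrightarrow> 0 powr (1 / p)"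
    using p by (intro tendsto_powr' tendsto_const disjI2 conjI always_eventually allI) auto
  then show ?thesis by (simp add: lp_norm_def eq)
qed

text \<open>The level set {|f| > \<tau>} contains n for every \<tau> below |f n|, but not for \<tau>
  = |f n|; hence the approximation from below. The estimate makes evaluation at n continuous, as the
  uniqueness of extensions demands.\<close>

lemma weak_l1_pointwise:
  assumes \<omega>: "\<And>k. 0 < \<omega> k" and f: "f \<in> weak_l1_space \<omega>"
  shows "cmod (f n) * \<omega> n \<le> weak_l1_norm \<omega> f"
proof -
  have le: "\<tau> * \<omega> n \<le> weak_l1_norm \<omega> f" if \<tau>: "0 < \<tau>" "\<tau> < cmod (f n)" for \<tau>
  proof -
    have "sum \<omega> {n} \<le> infsum \<omega> {m. cmod (f m) > \<tau>}"
      using f \<tau> \<omega> by (intro finite_sum_le_infsum) (auto simp: weak_l1_space_def less_imp_le)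
    then have "\<tau> * \<omega> n \<le> \<tau> * infsum \<omega> {m. cmod (f m) > \<tau>}" using \<tau> by simp
    also have "\<dots> \<le> weak_l1_norm \<omega> f"
      unfolding weak_l1_norm_def using f \<tau> by (intro cSUP_upper) (auto simp: weak_l1_space_def)
    finally show ?thesis .
  qed
  show ?thesis
  proof (cases "cmod (f n) = 0")
    case True
    have "0 \<le> 1 * infsum \<omega> {m. cmod (f m) > 1}" using \<omega> by (simp add: infsum_nonneg less_imp_le)
    also have "\<dots> \<le> weak_l1_norm \<omega> f"
      unfolding weak_l1_norm_def using f by (intro cSUP_upper) (auto simp: weak_l1_space_def)
    finally show ?thesis using True by simp
  next
    case False
    have "cmod (f n) \<le> weak_l1_norm \<omega> f / \<omega> n"
    proof (rule dense_le_bounded[of 0])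
      show "0 < cmod (f n)" using False by simp
      fix \<tau> assume "0 < \<tau>" "\<tau> < cmod (f n)"
      then show "\<tau> \<le> weak_l1_norm \<omega> f / \<omega> n" using le \<omega>[of n] by (simp add: pos_le_divide_eq)
    qed
    then show ?thesis using \<omega>[of n] by (simp add: pos_le_divide_eq)
  qed
qed

lemma weak_l1_boundI:
  assumes \<omega>: "\<And>k. 0 < \<omega> k"
    and le: "\<And>\<tau> L. 0 < \<tau> \<Longrightarrow> \<tau> * (\<Sum>n | n \<le> L \<and> \<tau> < cmod (f n). \<omega> n) \<le> B"
  shows "f \<in> weak_l1_space \<omega>" "weak_l1_norm \<omega> f \<le> B"
proof -
  have fin: "sum \<omega> F \<le> B / \<tau>" if "finite F" "F \<subseteq> {n. \<tau> < cmod (f n)}" "0 < \<tau>" for F \<tau>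
  proof -
    obtain L where "F \<subseteq> {..L}" using finite_nat_iff_bounded_le[of F] \<open>finite F\<close> by auto
    then have "sum \<omega> F \<le> (\<Sum>n | n \<le> L \<and> \<tau> < cmod (f n). \<omega> n)"
      using that \<omega> by (intro sum_mono2) (auto intro: less_imp_le)
    also have "\<dots> \<le> B / \<tau>" using le[OF \<open>0 < \<tau>\<close>, of L] \<open>0 < \<tau>\<close> by (simp add: pos_le_divide_eq mult.commute)
    finally show ?thesis .
  qed
  have s: "\<omega> summable_on {n. \<tau> < cmod (f n)}" if "0 < \<tau>" for \<tau>
  proof (rule nonneg_bdd_above_summable_on)
    show "bdd_above (sum \<omega> ` {F. F \<subseteq> {n. \<tau> < cmod (f n)} \<and> finite F})"
      using fin that by (intro bdd_aboveI2[of _ _ "B / \<tau>"]) auto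
  qed (use \<omega> in \<open>auto intro: less_imp_le\<close>)
  have le': "\<tau> * infsum \<omega> {n. \<tau> < cmod (f n)} \<le> B" if "0 < \<tau>" for \<tau>
  proof -
    have "infsum \<omega> {n. \<tau> < cmod (f n)} \<le> B / \<tau>"
      using fin that by (intro infsum_le_finite_sums[OF s]) auto
    then show ?thesis using that by (simp add: pos_le_divide_eq mult.commute)
  qed
  show "f \<in> weak_l1_space \<omega>"
    unfolding weak_l1_space_def using s le' by (auto intro!: bdd_aboveI2[of _ _ B])
  show "weak_l1_norm \<omega> f \<le> B" unfolding weak_l1_norm_def using le' by (intro cSUP_least) auto
qed

lemma weak_l1_solid:
  assumes \<omega>: "\<And>k. 0 < \<omega> k" and f: "f \<in> weak_l1_space \<omega>" and le: "\<And>n. cmod (g n) \<le> cmod (f n)"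
  shows "g \<in> weak_l1_space \<omega>" "weak_l1_norm \<omega> g \<le> weak_l1_norm \<omega> f"
proof -
  have "\<tau> * (\<Sum>n | n \<le> L \<and> \<tau> < cmod (g n). \<omega> n) \<le> weak_l1_norm \<omega> f" if \<tau>: "0 < \<tau>" for \<tau> L
  proof -
    have "(\<Sum>n | n \<le> L \<and> \<tau> < cmod (g n). \<omega> n) \<le> infsum \<omega> {m. cmod (f m) > \<tau>}"
      using f \<tau> \<omega> le by (intro finite_sum_le_infsum) (auto simp: weak_l1_space_def less_imp_le intro: less_le_trans)
    then have "\<tau> * (\<Sum>n | n \<le> L \<and> \<tau> < cmod (g n). \<omega> n) \<le> \<tau> * infsum \<omega> {m. cmod (f m) > \<tau>}" using \<tau> by simp
    also have "\<dots> \<le> weak_l1_norm \<omega> f"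
      unfolding weak_l1_norm_def using f \<tau> by (intro cSUP_upper) (auto simp: weak_l1_space_def)
    finally show ?thesis .
  qed
  then show "g \<in> weak_l1_space \<omega>" "weak_l1_norm \<omega> g \<le> weak_l1_norm \<omega> f"
    using weak_l1_boundI[of \<omega> g, OF \<omega>] by auto
qed

lemma lp_solid:
  assumes p: "0 < p" and \<omega>: "\<And>k. 0 < \<omega> k" and f: "f \<in> lp_space p \<omega>" and le: "\<And>n. cmod (g n) \<le> cmod (f n)"
  shows "g \<in> lp_space p \<omega>" "lp_norm p \<omega> g \<le> lp_norm p \<omega> f"
proof -
  have "(\<Sum>n\<le>L. cmod (g n) powr p * \<omega> n) \<le> lp_norm p \<omega> f powr p" for L
  proof -
    have "(\<Sum>n\<le>L. cmod (g n) powr p * \<omega> n) \<le> (\<Sum>n\<le>L. cmod (f n) powr p * \<omega> n)"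
      using p \<omega> le by (intro sum_mono mult_right_mono powr_mono2) (auto intro: less_imp_le)
    also have "\<dots> \<le> lp_norm p \<omega> f powr p" by (rule sum_le_lp_norm_powr[of p \<omega> f, OF p \<omega> f]) simp
    finally show ?thesis .
  qed
  then show "g \<in> lp_space p \<omega>" "lp_norm p \<omega> g \<le> lp_norm p \<omega> f"
    using lp_space_boundI[of p \<omega> "lp_norm p \<omega> f" g, OF p \<omega>] by auto
qed

text \<open>The operator is already given by its formula on all of \<open>X\<close>, so existence
  amounts to its bound, and the estimate for differences follows from sublinearity and solidity of
  \<open>Y\<close>. For uniqueness two candidates are compared along approximants in
  \<open>D\<close>, and the limit is taken in each coordinate; this works in the same way for a norm
  and for the quasi-norm of weak l^1.\<close>

lemma extends_uniquelyI:
  assumes bound: "\<And>f. f \<in> X \<Longrightarrow> S f \<in> Y \<and> NY (S f) \<le> C * NX f"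
    and sub: "\<And>f g n. f \<in> X \<Longrightarrow> g \<in> X \<Longrightarrow> cmod (S f n - S g n) \<le> cmod (S (\<lambda>n. f n - g n) n)"
    and diff: "\<And>f g. f \<in> X \<Longrightarrow> g \<in> X \<Longrightarrow> (\<lambda>n. f n - g n) \<in> X"
    and solid: "\<And>h h'. h \<in> Y \<Longrightarrow> (\<And>n. cmod (h' n) \<le> cmod (h n)) \<Longrightarrow> h' \<in> Y \<and> NY h' \<le> NY h"
    and pointwise: "\<And>h n. h \<in> Y \<Longrightarrow> cmod (h n) * c n \<le> NY h" and c: "\<And>n. 0 < c n"
    and DX: "D \<subseteq> X" and a_mem: "\<And>f k. f \<in> X \<Longrightarrow> a f k \<in> D"
    and a_lim: "\<And>f. f \<in> X \<Longrightarrow> (\<lambda>k. NX (\<lambda>n. f n - a f k n)) \<longlonglongrightarrow> 0"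
  shows "extends_uniquely D S X NX Y NY"
proof -
  have bd: "bounded_operator X NX Y NY S"
    unfolding bounded_operator_def
  proof (intro conjI exI[of _ C] ballI)
    fix f assume "f \<in> X"
    from bound[OF this] show "S f \<in> Y" "NY (S f) \<le> C * NX f" by simp_all
  next
    fix f g assume fg: "f \<in> X" "g \<in> X"
    have "S (\<lambda>n. f n - g n) \<in> Y" "NY (S (\<lambda>n. f n - g n)) \<le> C * NX (\<lambda>n. f n - g n)"
      using bound[OF diff[OF fg]] by auto
    moreover have "(\<lambda>n. S f n - S g n) \<in> Y \<and> NY (\<lambda>n. S f n - S g n) \<le> NY (S (\<lambda>n. f n - g n))"
      by (rule solid[OF \<open>S (\<lambda>n. f n - g n) \<in> Y\<close>]) (rule sub[OF fg])
    ultimately show "(\<lambda>n. S f n - S g n) \<in> Y" "NY (\<lambda>n. S f n - S g n) \<le> C * NX (\<lambda>n. f n - g n)"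
      by simp_all
  qed
  have lim: "(\<lambda>k. T (a f k) n) \<longlonglongrightarrow> T f n" if T: "bounded_operator X NX Y NY T" and f: "f \<in> X" for T f n
  proof -
    obtain B where B: "\<And>f g. f \<in> X \<Longrightarrow> g \<in> X \<Longrightarrow> (\<lambda>n. T f n - T g n) \<in> Y \<and>
             NY (\<lambda>n. T f n - T g n) \<le> B * NX (\<lambda>n. f n - g n)"
      using T unfolding bounded_operator_def by blast
    have "c n \<noteq> 0" using c[of n] by simp
    then have "(\<lambda>k. B * NX (\<lambda>n. f n - a f k n) / c n) \<longlonglongrightarrow> B * 0 / c n"
      by (intro tendsto_divide tendsto_mult tendsto_const a_lim f)
    then have lim0: "(\<lambda>k. B * NX (\<lambda>n. f n - a f k n) / c n) \<longlonglongrightarrow> 0" by simp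
    have le: "norm (T f n - T (a f k) n) \<le> B * NX (\<lambda>n. f n - a f k n) / c n" for k
    proof -
      have "a f k \<in> X" using a_mem[OF f] DX by auto
      then have "cmod (T f n - T (a f k) n) * c n \<le> B * NX (\<lambda>n. f n - a f k n)"
        using B[of f "a f k", OF f] pointwise[of "\<lambda>n. T f n - T (a f k) n" n] by linarith
      then show ?thesis using c[of n] by (simp add: pos_le_divide_eq)
    qed
    have "(\<lambda>k. T f n - T (a f k) n) \<longlonglongrightarrow> 0"
      by (rule Lim_null_comparison[OF _ lim0]) (simp add: le)
    from tendsto_diff[OF tendsto_const[of "T f n"] this] show ?thesis by simp
  qed
  show ?thesis
    unfolding extends_uniquely_def
  proof (intro exI[of _ S] conjI bd ballI allI impI)
    fix T f assume T: "bounded_operator X NX Y NY T \<and> (\<forall>f\<in>D. T f = S f)" and f: "f \<in> X"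
    show "T f = S f"
    proof
      fix n
      have "(\<lambda>k. S (a f k) n) \<longlonglongrightarrow> T f n" using lim[of T f n] T f a_mem[OF f] by simp
      then show "T f n = S f n" using lim[OF bd f] LIMSEQ_unique by blast
    qed
  qed simp
qed

section \<open>Maximal operators of approximate identities\<close>

lemma maximal_mono:
  assumes "n \<le> L" "L \<le> L'"
  shows "maximal L \<mu> f n \<le> maximal L' \<mu> f n"
proof -
  obtain a b where "a \<le> n" "n \<le> b" "b \<le> L" "maximal L \<mu> f n = average \<mu> f a b"
    using maximal_eq_average[OF assms(1)] .
  then show ?thesis using average_le_maximal[of a n b L' \<mu> f] assms by simp
qed

text \<open>The scale \<open>N\<close> may depend on t arbitrarily. Only \<open>C\<close> is uniform
  in t, and this is what survives in the supremum over t.\<close>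

locale kernel_family =
  fixes K :: "real \<Rightarrow> nat \<Rightarrow> nat \<Rightarrow> real" and C :: real
  assumes C: "0 < C"
    and kernel: "\<And>t. 0 < t \<Longrightarrow> \<exists>N\<ge>1. \<forall>n m. \<bar>K t n m\<bar> \<le> C / N \<and> \<bar>K t n m\<bar> * (real n - real m)\<^sup>2 \<le> C * N"
begin

definition maximal_op :: "(nat \<Rightarrow> complex) \<Rightarrow> nat \<Rightarrow> complex" where
  "maximal_op f n = complex_of_real (SUP t\<in>{0<..}. cmod (\<Sum>m. f m * complex_of_real (K t n m)))"

definition M :: "nat \<Rightarrow> (nat \<Rightarrow> complex) \<Rightarrow> nat \<Rightarrow> real" where
  "M L f n = maximal L (\<lambda>_. 1) (\<lambda>m. cmod (f m)) n"

lemma M_nonneg: "n \<le> L \<Longrightarrow> 0 \<le> M L f n"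
  unfolding M_def by (rule maximal_nonneg) auto

lemma M_mono: "n \<le> L \<Longrightarrow> L \<le> L' \<Longrightarrow> M L f n \<le> M L' f n"
  unfolding M_def by (rule maximal_mono)

lemma partial_sum_le:
  assumes "0 < t" "n \<le> L"
  shows "(\<Sum>m\<le>L. cmod (f m) * \<bar>K t n m\<bar>) \<le> 16 * C * M L f n"
proof -
  obtain N where N: "1 \<le> N" "\<And>n m. \<bar>K t n m\<bar> \<le> C / N \<and> \<bar>K t n m\<bar> * (real n - real m)\<^sup>2 \<le> C * N"
    using kernel[OF assms(1)] by blast
  show ?thesis
    unfolding M_def
    by (rule sum_kernel_le_maximal[of N _ _ C]) (use N C assms(2) in \<open>auto intro: less_imp_le\<close>)
qed

lemma norm_sum_le:
  assumes t: "0 < t" and b: "\<And>L. n \<le> L \<Longrightarrow> M L f n \<le> b"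
  shows "summable (\<lambda>m. f m * complex_of_real (K t n m))"
    and "cmod (\<Sum>m. f m * complex_of_real (K t n m)) \<le> 16 * C * b"
proof -
  have le: "(\<Sum>m<L. norm (f m * complex_of_real (K t n m))) \<le> 16 * C * b" for L
  proof -
    have "(\<Sum>m<L. norm (f m * complex_of_real (K t n m))) = (\<Sum>m<L. cmod (f m) * \<bar>K t n m\<bar>)"
      by (simp add: norm_mult)
    also have "\<dots> \<le> (\<Sum>m\<le>max n L. cmod (f m) * \<bar>K t n m\<bar>)"
      by (rule sum_mono2) auto
    also have "\<dots> \<le> 16 * C * M (max n L) f n" by (rule partial_sum_le) (use t in auto)
    also have "\<dots> \<le> 16 * C * b" using C b by (intro mult_left_mono) auto
    finally show ?thesis .
  qed
  have s: "summable (\<lambda>m. norm (f m * complex_of_real (K t n m)))"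
    by (rule summableI_nonneg_bounded[OF norm_ge_zero le])
  then show "summable (\<lambda>m. f m * complex_of_real (K t n m))" by (rule summable_norm_cancel)
  have "cmod (\<Sum>m. f m * complex_of_real (K t n m)) \<le> (\<Sum>m. norm (f m * complex_of_real (K t n m)))"
    by (rule summable_norm[OF s])
  also have "\<dots> \<le> 16 * C * b" by (rule suminf_le_const[OF s le])
  finally show "cmod (\<Sum>m. f m * complex_of_real (K t n m)) \<le> 16 * C * b" .
qed

lemma maximal_op_le:
  assumes b: "\<And>L. n \<le> L \<Longrightarrow> M L f n \<le> b"
  shows "bdd_above ((\<lambda>t. cmod (\<Sum>m. f m * complex_of_real (K t n m))) ` {0<..})"
    and "cmod (maximal_op f n) \<le> 16 * C * b"
    and "cmod (maximal_op f n) = (SUP t\<in>{0<..}. cmod (\<Sum>m. f m * complex_of_real (K t n m)))"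
proof -
  let ?g = "\<lambda>t. cmod (\<Sum>m. f m * complex_of_real (K t n m))"
  have le: "?g t \<le> 16 * C * b" if "t \<in> {0<..}" for t
    using norm_sum_le(2)[of t n f b] that b by auto
  show bdd: "bdd_above (?g ` {0<..})" using le by (intro bdd_aboveI2) auto
  \<comment> \<open>The supremum dominates its value at t = 1 and is therefore nonnegative, so the
    modulus of its complex embedding is the supremum itself.\<close>
  have "0 \<le> ?g 1" by simp
  also have "?g 1 \<le> (SUP t\<in>{0<..}. ?g t)" by (rule cSUP_upper[OF _ bdd]) auto
  finally show eq: "cmod (maximal_op f n) = (SUP t\<in>{0<..}. ?g t)"
    by (simp add: maximal_op_def)
  have "(SUP t\<in>{0<..}. ?g t) \<le> 16 * C * b" by (rule cSUP_least) (use le in auto)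
  then show "cmod (maximal_op f n) \<le> 16 * C * b" unfolding eq .
qed

text \<open>A supremum of moduli of linear functionals is sublinear. The bounds on \<open>M\<close>
  provide the summability that splits the series and the finiteness of the three suprema.\<close>

lemma maximal_op_diff_le:
  assumes f: "\<And>L. n \<le> L \<Longrightarrow> M L f n \<le> b" and g: "\<And>L. n \<le> L \<Longrightarrow> M L g n \<le> b'"
    and d: "\<And>L. n \<le> L \<Longrightarrow> M L (\<lambda>n. f n - g n) n \<le> b''"
  shows "cmod (maximal_op f n - maximal_op g n) \<le> cmod (maximal_op (\<lambda>n. f n - g n) n)"
proof -
  define \<Phi> where "\<Phi> h t = (\<Sum>m. h m * complex_of_real (K t n m))" for h t
  define s where "s h = (SUP t\<in>{0<..}. cmod (\<Phi> h t))" for h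
  let ?d = "\<lambda>n. f n - g n"
  have up: "cmod (\<Phi> f t) \<le> s f" "cmod (\<Phi> g t) \<le> s g" "cmod (\<Phi> ?d t) \<le> s ?d" if "0 < t" for t
    unfolding s_def \<Phi>_def using that
    by (auto intro!: cSUP_upper maximal_op_le(1) f g d)
  have diff: "\<Phi> ?d t = \<Phi> f t - \<Phi> g t" if "0 < t" for t
  proof -
    have "summable (\<lambda>m. f m * complex_of_real (K t n m))" "summable (\<lambda>m. g m * complex_of_real (K t n m))"
      using norm_sum_le(1)[of t n f b, OF that f] norm_sum_le(1)[of t n g b', OF that g] by auto
    from suminf_diff[OF this] show ?thesis by (simp add: \<Phi>_def left_diff_distrib)
  qed
  have "s f \<le> s g + s ?d"
    unfolding s_def[of f]
  proof (rule cSUP_least)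
    fix t :: real assume "t \<in> {0<..}"
    then show "cmod (\<Phi> f t) \<le> s g + s ?d"
      using up[of t] diff[of t] norm_triangle_ineq2[of "\<Phi> f t" "\<Phi> g t"] by simp
  qed simp
  moreover have "s g \<le> s f + s ?d"
    unfolding s_def[of g]
  proof (rule cSUP_least)
    fix t :: real assume "t \<in> {0<..}"
    then show "cmod (\<Phi> g t) \<le> s f + s ?d"
      using up[of t] diff[of t] norm_triangle_ineq2[of "\<Phi> g t" "\<Phi> f t"] by (simp add: norm_minus_commute)
  qed simp
  moreover have "cmod (maximal_op f n - maximal_op g n) = \<bar>s f - s g\<bar>"
    unfolding maximal_op_def s_def \<Phi>_def of_real_diff[symmetric] norm_of_real ..
  moreover have "cmod (maximal_op ?d n) = s ?d"
    using maximal_op_le(3)[of n ?d b'', OF d] by (simp add: s_def \<Phi>_def)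
  ultimately show ?thesis by linarith
qed

text \<open>The truncated maximal functions increase with the truncation, and the indices L + j keep
  every n \<le> L inside it, so one sequence serves all these n at once.\<close>

lemma maximal_op_limit:
  assumes bdd: "\<And>n. n \<le> L \<Longrightarrow> \<exists>c. \<forall>L'\<ge>n. M L' f n \<le> c"
  obtains b where "\<And>n. n \<le> L \<Longrightarrow> (\<lambda>j. M (L + j) f n) \<longlonglongrightarrow> b n"
    "\<And>n. n \<le> L \<Longrightarrow> 0 \<le> b n" "\<And>n. n \<le> L \<Longrightarrow> cmod (maximal_op f n) \<le> 16 * C * b n"
proof
  define b where "b n = (SUP j. M (L + j) f n)" for n
  have bd: "bdd_above (range (\<lambda>j. M (L + j) f n))" if n: "n \<le> L" for n
  proof -
    obtain c where "\<forall>L'\<ge>n. M L' f n \<le> c" using bdd[OF n] by blast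
    then show ?thesis using n by (intro bdd_aboveI2[of _ _ c]) auto
  qed
  show "(\<lambda>j. M (L + j) f n) \<longlonglongrightarrow> b n" if n: "n \<le> L" for n
    unfolding b_def using n by (intro LIMSEQ_incseq_SUP bd) (auto simp: incseq_def intro!: M_mono)
  have up: "M (L + j) f n \<le> b n" if "n \<le> L" for n j
    unfolding b_def by (rule cSUP_upper[OF _ bd[OF that]]) simp
  show "0 \<le> b n" if n: "n \<le> L" for n
    using up[OF n, of 0] M_nonneg[of n L f] n by simp
  show "cmod (maximal_op f n) \<le> 16 * C * b n" if n: "n \<le> L" for n
  proof (rule maximal_op_le(2))
    fix L' assume "n \<le> L'"
    then have "M L' f n \<le> M (L + L') f n" by (intro M_mono) auto
    also have "\<dots> \<le> b n" by (rule up[OF n])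
    finally show "M L' f n \<le> b n" .
  qed
qed

text \<open>A sum over n \<le> L of the functions truncated at L + j is enlarged to n \<le> L + j,
  where the finite inequality holds; then j tends to infinity with L fixed, and only afterwards is L
  arbitrary.\<close>

theorem strong_type:
  assumes p: "1 < p" and A: "muckenhoupt p \<omega>"
  shows "(\<exists>C. \<forall>f \<in> l2_space \<inter> lp_space p \<omega>.
           maximal_op f \<in> lp_space p \<omega> \<and> lp_norm p \<omega> (maximal_op f) \<le> C * lp_norm p \<omega> f) \<and>
        extends_uniquely (l2_space \<inter> lp_space p \<omega>) maximal_op
          (lp_space p \<omega>) (lp_norm p \<omega>) (lp_space p \<omega>) (lp_norm p \<omega>)"
proof -
  have \<omega>: "0 < \<omega> k" for k using A by (auto simp: muckenhoupt_def weight_seq_def)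
  have p0: "0 < p" "1 \<le> p" using p by auto
  obtain D where D: "0 \<le> D" "\<And>f L. (\<And>k. 0 \<le> f k) \<Longrightarrow>
      (\<Sum>n\<le>L. maximal L (\<lambda>_. 1) f n powr p * \<omega> n) \<le> D * (\<Sum>n\<le>L. f n powr p * \<omega> n)"
    using muckenhoupt_maximal_strong_type[OF p A] by blast
  have sumM: "(\<Sum>n\<le>L. M L f n powr p * \<omega> n) \<le> D * lp_norm p \<omega> f powr p" if f: "f \<in> lp_space p \<omega>" for f L
  proof -
    have "(\<Sum>n\<le>L. M L f n powr p * \<omega> n) \<le> D * (\<Sum>n\<le>L. cmod (f n) powr p * \<omega> n)"
      unfolding M_def by (rule D(2)) simp
    also have "\<dots> \<le> D * lp_norm p \<omega> f powr p"
      by (intro mult_left_mono sum_le_lp_norm_powr \<omega> f D(1) p0(1)) simp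
    finally show ?thesis .
  qed
  have bdd: "\<exists>c. \<forall>L\<ge>n. M L f n \<le> c" if f: "f \<in> lp_space p \<omega>" for f n
  proof (intro exI allI impI)
    fix L assume L: "n \<le> L"
    have "M L f n powr p * \<omega> n \<le> (\<Sum>n\<le>L. M L f n powr p * \<omega> n)"
      using \<omega> L by (intro member_le_sum mult_nonneg_nonneg) (auto intro: less_imp_le)
    also have "\<dots> \<le> D * lp_norm p \<omega> f powr p" by (rule sumM[OF f])
    finally have "M L f n powr p \<le> D * lp_norm p \<omega> f powr p / \<omega> n"
      using \<omega>[of n] by (simp add: pos_le_divide_eq)
    then have "(M L f n powr p) powr (1 / p) \<le> (D * lp_norm p \<omega> f powr p / \<omega> n) powr (1 / p)"
      using p by (intro powr_mono2) auto
    then show "M L f n \<le> (D * lp_norm p \<omega> f powr p / \<omega> n) powr (1 / p)"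
      using p M_nonneg[OF L] by (simp add: powr_powr)
  qed
  define C' where "C' = 16 * C * D powr (1 / p)"
  have bound: "maximal_op f \<in> lp_space p \<omega> \<and> lp_norm p \<omega> (maximal_op f) \<le> C' * lp_norm p \<omega> f"
    if f: "f \<in> lp_space p \<omega>" for f
  proof -
    have "(\<Sum>n\<le>L. cmod (maximal_op f n) powr p * \<omega> n) \<le> (C' * lp_norm p \<omega> f) powr p" for L
    proof -
      obtain b where b: "\<And>n. n \<le> L \<Longrightarrow> (\<lambda>j. M (L + j) f n) \<longlonglongrightarrow> b n"
        "\<And>n. n \<le> L \<Longrightarrow> 0 \<le> b n" "\<And>n. n \<le> L \<Longrightarrow> cmod (maximal_op f n) \<le> 16 * C * b n"
        using maximal_op_limit[of L f] bdd[OF f] by blast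
      have "(\<lambda>j. \<Sum>n\<le>L. M (L + j) f n powr p * \<omega> n) \<longlonglongrightarrow> (\<Sum>n\<le>L. b n powr p * \<omega> n)"
      proof (intro tendsto_sum tendsto_mult tendsto_const)
        fix n assume n: "n \<in> {..L}"
        have "\<forall>\<^sub>F j in sequentially. 0 \<le> M (L + j) f n"
          using n by (intro always_eventually allI M_nonneg) auto
        then show "(\<lambda>j. M (L + j) f n powr p) \<longlonglongrightarrow> b n powr p"
          using n p0 b(1)[of n] by (intro tendsto_powr'[OF _ tendsto_const]) auto
      qed
      moreover have "(\<Sum>n\<le>L. M (L + j) f n powr p * \<omega> n) \<le> D * lp_norm p \<omega> f powr p" for j
      proof -
        have "(\<Sum>n\<le>L. M (L + j) f n powr p * \<omega> n) \<le> (\<Sum>n\<le>L + j. M (L + j) f n powr p * \<omega> n)"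
          using \<omega> by (intro sum_mono2 mult_nonneg_nonneg) (auto intro: less_imp_le)
        also have "\<dots> \<le> D * lp_norm p \<omega> f powr p" by (rule sumM[OF f])
        finally show ?thesis .
      qed
      ultimately have le: "(\<Sum>n\<le>L. b n powr p * \<omega> n) \<le> D * lp_norm p \<omega> f powr p"
        by (intro LIMSEQ_le_const2) auto
      have "(\<Sum>n\<le>L. cmod (maximal_op f n) powr p * \<omega> n) \<le> (\<Sum>n\<le>L. (16 * C * b n) powr p * \<omega> n)"
        using p b(3) \<omega> by (intro sum_mono mult_right_mono powr_mono2) (auto intro: less_imp_le)
      also have "\<dots> = (\<Sum>n\<le>L. (16 * C) powr p * (b n powr p * \<omega> n))"
        using b(2) C by (intro sum.cong) (auto simp: powr_mult)
      also have "\<dots> = (16 * C) powr p * (\<Sum>n\<le>L. b n powr p * \<omega> n)" by (simp add: sum_distrib_left)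
      also have "\<dots> \<le> (16 * C) powr p * (D * lp_norm p \<omega> f powr p)" using le by (intro mult_left_mono) auto
      also have "\<dots> = (C' * lp_norm p \<omega> f) powr p"
        using C D(1) p by (simp add: C'_def powr_mult powr_powr)
      finally show ?thesis .
    qed
    moreover have "0 \<le> C' * lp_norm p \<omega> f" using C by (simp add: C'_def)
    ultimately show ?thesis using lp_space_boundI[of p \<omega>, OF p0(1) \<omega>] by blast
  qed
  have "extends_uniquely (l2_space \<inter> lp_space p \<omega>) maximal_op
          (lp_space p \<omega>) (lp_norm p \<omega>) (lp_space p \<omega>) (lp_norm p \<omega>)"
  proof (rule extends_uniquelyI[where C = C' and c = "\<lambda>n. \<omega> n powr (1 / p)" and a = "\<lambda>f k. truncate_seq k f"])
    fix f g n assume fg: "f \<in> lp_space p \<omega>" "g \<in> lp_space p \<omega>"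
    show diff: "(\<lambda>n. f n - g n) \<in> lp_space p \<omega>" by (rule summable_lp_diff[of p \<omega>, OF p0(2) \<omega> fg])
    obtain c1 c2 c3 where "\<forall>L\<ge>n. M L f n \<le> c1" "\<forall>L\<ge>n. M L g n \<le> c2" "\<forall>L\<ge>n. M L (\<lambda>n. f n - g n) n \<le> c3"
      using bdd[OF fg(1), of n] bdd[OF fg(2), of n] bdd[OF diff, of n] by blast
    then show "cmod (maximal_op f n - maximal_op g n) \<le> cmod (maximal_op (\<lambda>n. f n - g n) n)"
      by (intro maximal_op_diff_le[of n f c1 g c2 c3]) auto
  next
    fix h h' assume "h \<in> lp_space p \<omega>" "\<And>n. cmod (h' n) \<le> cmod (h n)"
    from lp_solid[of p \<omega> h h', OF p0(1) \<omega> this]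
    show "h' \<in> lp_space p \<omega> \<and> lp_norm p \<omega> h' \<le> lp_norm p \<omega> h" by simp
  next
    fix f assume f: "f \<in> lp_space p \<omega>"
    show "(\<lambda>k. lp_norm p \<omega> (\<lambda>n. f n - truncate_seq k f n)) \<longlonglongrightarrow> 0"
      by (rule truncate_seq_tendsto[of p \<omega> f, OF p0(1) \<omega> f])
  qed (use bound lp_norm_pointwise[of p \<omega>, OF p0(1) \<omega>] \<omega>[THEN less_imp_neq, THEN not_sym] in \<open>simp_all add: truncate_seq_lp\<close>)
  then show ?thesis using bound by blast
qed

theorem weak_type:
  assumes A: "muckenhoupt1 \<omega>"
  shows "(\<exists>C. \<forall>f \<in> l2_space \<inter> lp_space 1 \<omega>.
           maximal_op f \<in> weak_l1_space \<omega> \<and> weak_l1_norm \<omega> (maximal_op f) \<le> C * lp_norm 1 \<omega> f) \<and>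
        extends_uniquely (l2_space \<inter> lp_space 1 \<omega>) maximal_op
          (lp_space 1 \<omega>) (lp_norm 1 \<omega>) (weak_l1_space \<omega>) (weak_l1_norm \<omega>)"
proof -
  have \<omega>: "0 < \<omega> k" for k using A by (auto simp: muckenhoupt1_def weight_seq_def)
  have p0: "0 < (1::real)" "1 \<le> (1::real)" by auto
  obtain D where D: "0 \<le> D" "\<And>f L \<tau>. (\<And>k. 0 \<le> f k) \<Longrightarrow> 0 < \<tau> \<Longrightarrow>
      \<tau> * (\<Sum>n | n \<le> L \<and> \<tau> < maximal L (\<lambda>_. 1) f n. \<omega> n) \<le> D * (\<Sum>n\<le>L. f n * \<omega> n)"
    using muckenhoupt1_maximal_weak_type[OF A] by blast
  have sumM: "\<tau> * (\<Sum>n | n \<le> L \<and> \<tau> < M L f n. \<omega> n) \<le> D * lp_norm 1 \<omega> f"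
    if f: "f \<in> lp_space 1 \<omega>" and \<tau>: "0 < \<tau>" for f L \<tau>
  proof -
    have "\<tau> * (\<Sum>n | n \<le> L \<and> \<tau> < M L f n. \<omega> n) \<le> D * (\<Sum>n\<le>L. cmod (f n) * \<omega> n)"
      unfolding M_def by (rule D(2)) (use \<tau> in auto)
    also have "\<dots> \<le> D * lp_norm 1 \<omega> f"
      using sum_le_lp_norm_powr[of 1 \<omega> f "{..L}", OF p0(1) \<omega> f] D(1) by (intro mult_left_mono) auto
    finally show ?thesis .
  qed
  have bdd: "\<exists>c. \<forall>L\<ge>n. M L f n \<le> c" if f: "f \<in> lp_space 1 \<omega>" for f n
  proof (intro exI allI impI)
    fix L assume L: "n \<le> L"
    \<comment> \<open>With a weak type bound a single value is controlled through the level sets at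
      all heights strictly below it.\<close>
    show "M L f n \<le> D * lp_norm 1 \<omega> f / \<omega> n"
    proof (rule ccontr)
      assume "\<not> M L f n \<le> D * lp_norm 1 \<omega> f / \<omega> n"
      then obtain \<tau> where \<tau>: "D * lp_norm 1 \<omega> f / \<omega> n < \<tau>" "\<tau> < M L f n" by (meson dense not_le)
      have "0 \<le> D * lp_norm 1 \<omega> f / \<omega> n" using D \<omega>[of n] by simp
      then have \<tau>0: "0 < \<tau>" using \<tau> by linarith
      have "\<omega> n \<le> (\<Sum>n | n \<le> L \<and> \<tau> < M L f n. \<omega> n)"
        using \<omega> L \<tau> by (intro member_le_sum) (auto intro: less_imp_le)
      then have "\<tau> * \<omega> n \<le> \<tau> * (\<Sum>n | n \<le> L \<and> \<tau> < M L f n. \<omega> n)" using \<tau>0 by simp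
      also have "\<dots> \<le> D * lp_norm 1 \<omega> f" by (rule sumM[OF f \<tau>0])
      finally show False using \<tau>(1) \<omega>[of n] by (simp add: pos_divide_less_eq)
    qed
  qed
  define C' where "C' = 16 * C * D"
  have bound: "maximal_op f \<in> weak_l1_space \<omega> \<and> weak_l1_norm \<omega> (maximal_op f) \<le> C' * lp_norm 1 \<omega> f"
    if f: "f \<in> lp_space 1 \<omega>" for f
  proof -
    have "\<tau> * (\<Sum>n | n \<le> L \<and> \<tau> < cmod (maximal_op f n). \<omega> n) \<le> C' * lp_norm 1 \<omega> f"
      if \<tau>: "0 < \<tau>" for \<tau> L
    proof -
      obtain b where b: "\<And>n. n \<le> L \<Longrightarrow> (\<lambda>j. M (L + j) f n) \<longlonglongrightarrow> b n"
        "\<And>n. n \<le> L \<Longrightarrow> 0 \<le> b n" "\<And>n. n \<le> L \<Longrightarrow> cmod (maximal_op f n) \<le> 16 * C * b n"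
        using maximal_op_limit[of L f] bdd[OF f] by blast
      define \<tau>' where "\<tau>' = \<tau> / (16 * C)"
      have \<tau>': "0 < \<tau>'" "\<tau> = 16 * C * \<tau>'" using \<tau> C by (auto simp: \<tau>'_def)
      \<comment> \<open>The set is finite and the limit at each of its points is strictly above
        \<tau>', so a single j makes all truncated functions exceed \<tau>' there. The level set of
        the limit thus lies in that of one truncation.\<close>
      let ?A = "{n. n \<le> L \<and> \<tau>' < b n}"
      have "\<forall>\<^sub>F j in sequentially. \<forall>n\<in>?A. \<tau>' < M (L + j) f n"
      proof (rule eventually_ball_finite)
        show "\<forall>n\<in>?A. \<forall>\<^sub>F j in sequentially. \<tau>' < M (L + j) f n"
        proof
          fix n assume "n \<in> ?A"
          then have "n \<le> L" "\<tau>' < b n" by auto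
          then show "\<forall>\<^sub>F j in sequentially. \<tau>' < M (L + j) f n" using order_tendstoD(1)[OF b(1)] by blast
        qed
      qed simp
      then obtain j where j: "\<forall>n\<in>?A. \<tau>' < M (L + j) f n"
        unfolding eventually_sequentially by blast
      have "{n. n \<le> L \<and> \<tau> < cmod (maximal_op f n)} \<subseteq> {n. n \<le> L + j \<and> \<tau>' < M (L + j) f n}"
      proof clarify
        fix n assume n: "n \<le> L" "\<tau> < cmod (maximal_op f n)"
        then have "16 * C * \<tau>' < 16 * C * b n" using b(3)[of n] \<tau>' by linarith
        then have "\<tau>' < b n" using C by simp
        then show "n \<le> L + j \<and> \<tau>' < M (L + j) f n" using n j by auto
      qed
      then have "(\<Sum>n | n \<le> L \<and> \<tau> < cmod (maximal_op f n). \<omega> n) \<le> (\<Sum>n | n \<le> L + j \<and> \<tau>' < M (L + j) f n. \<omega> n)"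
        using \<omega> by (intro sum_mono2) (auto intro: less_imp_le)
      then have "\<tau> * (\<Sum>n | n \<le> L \<and> \<tau> < cmod (maximal_op f n). \<omega> n)
          \<le> 16 * C * (\<tau>' * (\<Sum>n | n \<le> L + j \<and> \<tau>' < M (L + j) f n. \<omega> n))"
        using \<tau>' C by simp
      also have "\<dots> \<le> 16 * C * (D * lp_norm 1 \<omega> f)"
        using C by (intro mult_left_mono sumM[OF f \<tau>'(1)]) auto
      finally show ?thesis by (simp add: C'_def)
    qed
    then show ?thesis using weak_l1_boundI[of \<omega> "maximal_op f", OF \<omega>] by blast
  qed
  have "extends_uniquely (l2_space \<inter> lp_space 1 \<omega>) maximal_op
          (lp_space 1 \<omega>) (lp_norm 1 \<omega>) (weak_l1_space \<omega>) (weak_l1_norm \<omega>)"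
  proof (rule extends_uniquelyI[where C = C' and c = \<omega> and a = "\<lambda>f k. truncate_seq k f"])
    fix f g n assume fg: "f \<in> lp_space 1 \<omega>" "g \<in> lp_space 1 \<omega>"
    show diff: "(\<lambda>n. f n - g n) \<in> lp_space 1 \<omega>" by (rule summable_lp_diff[of 1 \<omega>, OF p0(2) \<omega> fg])
    obtain c1 c2 c3 where "\<forall>L\<ge>n. M L f n \<le> c1" "\<forall>L\<ge>n. M L g n \<le> c2" "\<forall>L\<ge>n. M L (\<lambda>n. f n - g n) n \<le> c3"
      using bdd[OF fg(1), of n] bdd[OF fg(2), of n] bdd[OF diff, of n] by blast
    then show "cmod (maximal_op f n - maximal_op g n) \<le> cmod (maximal_op (\<lambda>n. f n - g n) n)"
      by (intro maximal_op_diff_le[of n f c1 g c2 c3]) auto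
  next
    fix h h' assume "h \<in> weak_l1_space \<omega>" "\<And>n. cmod (h' n) \<le> cmod (h n)"
    from weak_l1_solid[of \<omega> h h', OF \<omega> this]
    show "h' \<in> weak_l1_space \<omega> \<and> weak_l1_norm \<omega> h' \<le> weak_l1_norm \<omega> h" by simp
  next
    fix f assume f: "f \<in> lp_space 1 \<omega>"
    show "(\<lambda>k. lp_norm 1 \<omega> (\<lambda>n. f n - truncate_seq k f n)) \<longlonglongrightarrow> 0"
      by (rule truncate_seq_tendsto[of 1 \<omega> f, OF p0(1) \<omega> f])
  qed (use bound weak_l1_pointwise[of \<omega>, OF \<omega>] \<omega> in \<open>simp_all add: truncate_seq_lp\<close>)
  then show ?thesis using bound by blast
qed

end

section \<open>Jacobi polynomials\<close>

lemma poly_basis: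
  fixes e :: "nat \<Rightarrow> real poly"
  assumes "\<And>k. degree (e k) = k" "\<And>k. lead_coeff (e k) \<noteq> 0" "degree s \<le> n"
  obtains c where "s = (\<Sum>k\<le>n. smult (c k) (e k))"
proof -
  have "\<exists>c. s = (\<Sum>k\<le>n. smult (c k) (e k))" using assms(3)
  proof (induction n arbitrary: s)
    case 0
    have "s = smult (coeff s 0 / coeff (e 0) 0) (e 0)"
      using 0 assms(1)[of 0] assms(2)[of 0] by (auto elim!: degree_eq_zeroE)
    then show ?case by (intro exI[of _ "\<lambda>_. coeff s 0 / coeff (e 0) 0"]) simp
  next
    case (Suc n)
    define a where "a = coeff s (Suc n) / coeff (e (Suc n)) (Suc n)"
    have lc: "coeff (e (Suc n)) (Suc n) \<noteq> 0" using assms(1)[of "Suc n"] assms(2)[of "Suc n"] by simp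
    have "degree (s - smult a (e (Suc n))) \<le> n"
    proof (rule degree_le, intro allI impI)
      fix i assume "n < i"
      then consider "i = Suc n" | "Suc n < i" by linarith
      then show "coeff (s - smult a (e (Suc n))) i = 0"
        using lc Suc.prems assms(1)[of "Suc n"] by cases (auto simp: a_def coeff_eq_0)
    qed
    from Suc.IH[OF this] obtain c where c: "s - smult a (e (Suc n)) = (\<Sum>k\<le>n. smult (c k) (e k))" by blast
    have "s = (\<Sum>k\<le>Suc n. smult ((c(Suc n := a)) k) (e k))"
      using c by (simp add: diff_eq_eq)
    then show ?case by blast
  qed
  then show ?thesis using that by blast
qed

locale jacobi =
  fixes \<alpha> \<beta> :: real and pn :: "nat \<Rightarrow> real poly"
  assumes \<alpha>: "3 / 2 < \<alpha>" and \<beta>: "- 1 / 2 \<le> \<beta>" and ortho: "orthonormal_jacobi \<alpha> \<beta> pn"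
begin

definition jm :: "real measure" where
  "jm = density lborel (\<lambda>x. ennreal (indicator {-1<..<1} x * jacobi_weight \<alpha> \<beta> x))"

definition eigval :: "nat \<Rightarrow> real" where
  "eigval n = real n * (real n + \<alpha> + \<beta> + 1)"

lemma jacobi_weight_measurable [measurable]: "jacobi_weight \<alpha> \<beta> \<in> borel_measurable borel"
  unfolding jacobi_weight_def by measurable

lemma jacobi_weight_nonneg: "0 \<le> jacobi_weight \<alpha> \<beta> x"
  by (simp add: jacobi_weight_def)

lemma sets_jm [measurable_cong, simp]: "sets jm = sets borel" and space_jm [simp]: "space jm = UNIV"
  by (simp_all add: jm_def)

lemma jm_integrable_iff:
  fixes h :: "real \<Rightarrow> real"
  assumes "h \<in> borel_measurable borel"
  shows "integrable jm h \<longleftrightarrow> set_integrable lborel {-1<..<1} (\<lambda>x. h x * jacobi_weight \<alpha> \<beta> x)"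
  unfolding jm_def set_integrable_def using assms
  by (subst integrable_density) (auto simp: jacobi_weight_nonneg algebra_simps)

lemma jm_integral_eq:
  fixes h :: "real \<Rightarrow> real"
  assumes "h \<in> borel_measurable borel"
  shows "integral\<^sup>L jm h = (LBINT x:{-1<..<1}. h x * jacobi_weight \<alpha> \<beta> x)"
  unfolding jm_def set_lebesgue_integral_def using assms
  by (subst integral_density) (auto simp: jacobi_weight_nonneg algebra_simps)

lemma AE_jm: "AE x in jm. x \<in> {-1<..<1}"
  unfolding jm_def by (subst AE_density) (auto simp: indicator_def intro!: AE_I2)

lemma degree_pn [simp]: "degree (pn n) = n"
  using ortho by (auto simp: orthonormal_jacobi_def)

lemma lead_coeff_pn: "0 < coeff (pn n) n"
  using ortho degree_pn[of n] unfolding orthonormal_jacobi_def by metis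

lemma poly_measurable [measurable]: "poly (r :: real poly) \<in> borel_measurable borel"
  by (intro borel_measurable_continuous_onI continuous_intros)

lemma pn_orthonormal:
  "integrable jm (\<lambda>x. poly (pn n) x * poly (pn m) x)"
  "(\<integral>x. poly (pn n) x * poly (pn m) x \<partial>jm) = (if n = m then 1 else 0)"
  using ortho unfolding orthonormal_jacobi_def orthonormal_wrt_def
  by (auto simp: jm_integrable_iff jm_integral_eq)

text \<open>Finiteness is read off from the normalisation of the nonzero constant
  \<open>pn 0\<close>, in place of an evaluation of the beta integral.\<close>

lemma finite_measure_jm: "finite_measure jm"
proof -
  define c where "c = coeff (pn 0) 0"
  have c: "pn 0 = [:c:]" "0 < c"
    using lead_coeff_pn[of 0] degree_0_id[of "pn 0"] by (auto simp: c_def)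
  have "integrable jm (\<lambda>x. 1 / c\<^sup>2 * (poly (pn 0) x * poly (pn 0) x))"
    using pn_orthonormal(1)[of 0 0] by (intro integrable_mult_right)
  then have "integrable jm (\<lambda>x. 1 :: real)" using c by (simp add: power2_eq_square)
  then have "emeasure jm (space jm) < \<infinity>" using integrable_indicator_iff[of jm UNIV] by (simp add: indicator_def)
  then show ?thesis by (intro finite_measureI) auto
qed

lemma integrable_continuous:
  fixes h :: "real \<Rightarrow> real"
  assumes "continuous_on UNIV h"
  shows "integrable jm h"
proof -
  interpret finite_measure jm by (rule finite_measure_jm)
  have "bounded (h ` {-1..1})"
    using assms by (intro compact_imp_bounded compact_continuous_image continuous_on_subset[OF assms]) auto
  then obtain B where B: "\<And>x. x \<in> {-1..1} \<Longrightarrow> norm (h x) \<le> B" unfolding bounded_iff by blast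
  show ?thesis
  proof (rule integrable_const_bound[where B = B])
    show "AE x in jm. norm (h x) \<le> B" using AE_jm by eventually_elim (use B in auto)
    show "h \<in> borel_measurable jm"
      unfolding measurable_cong_sets[OF sets_jm refl] by (rule borel_measurable_continuous_onI[OF assms])
  qed
qed

lemma jm_integral_mono:
  assumes "integrable jm f" "integrable jm g" "\<And>x. x \<in> {-1<..<1} \<Longrightarrow> f x \<le> (g x :: real)"
  shows "integral\<^sup>L jm f \<le> integral\<^sup>L jm g"
  using assms(1,2)
proof (rule integral_mono_AE)
  show "AE x in jm. f x \<le> g x" using AE_jm by eventually_elim (use assms in auto)
qed

text \<open>Pearson's equation: if \<rho> is the Jacobi weight, then (p \<rho>)' = q \<rho>, so the
  integrand times \<rho> is the derivative of p \<rho> F, and p \<rho> = (1 - x)^(\<alpha>+1) (1 +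
  x)^(\<beta>+1) vanishes at both ends.\<close>

lemma jacobi_integration_by_parts:
  fixes F F' :: "real \<Rightarrow> real"
  assumes F: "\<And>x. (F has_real_derivative F' x) (at x)" and "continuous_on UNIV F'"
  shows "(\<integral>x. jacobi_q \<alpha> \<beta> x * F x + jacobi_p x * F' x \<partial>jm) = 0"
proof -
  define G where "G x = (1 - x) powr (\<alpha> + 1) * (1 + x) powr (\<beta> + 1) * F x" for x
  define h where "h x = jacobi_q \<alpha> \<beta> x * F x + jacobi_p x * F' x" for x
  have contF: "continuous_on UNIV F"
    by (meson DERIV_isCont F continuous_at_imp_continuous_on)
  have cont: "continuous_on UNIV h"
    unfolding h_def jacobi_q_def jacobi_p_def by (intro continuous_intros contF assms(2))
  have "((\<lambda>x. h x * jacobi_weight \<alpha> \<beta> x) has_integral (G 1 - G (-1))) {-1..1}"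
  proof (rule fundamental_theorem_of_calculus_interior)
    show "continuous_on {-1..1} G"
      unfolding G_def using \<alpha> \<beta>
      by (intro continuous_intros continuous_on_powr' continuous_on_subset[OF contF]) auto
    fix x :: real assume x: "x \<in> {-1<..<1}"
    have e: "(1 - x) powr (\<alpha> + 1) = (1 - x) powr \<alpha> * (1 - x)" "(1 + x) powr (\<beta> + 1) = (1 + x) powr \<beta> * (1 + x)"
      using x by (auto simp: powr_add)
    have "(G has_real_derivative
        ((- (\<alpha> + 1) * (1 - x) powr \<alpha>) * (1 + x) powr (\<beta> + 1) + (1 - x) powr (\<alpha> + 1) * ((\<beta> + 1) * (1 + x) powr \<beta>)) * F x
         + (1 - x) powr (\<alpha> + 1) * (1 + x) powr (\<beta> + 1) * F' x) (at x)"
      unfolding G_def using x by (auto intro!: derivative_eq_intros F simp: algebra_simps)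
    also have "((- (\<alpha> + 1) * (1 - x) powr \<alpha>) * (1 + x) powr (\<beta> + 1) + (1 - x) powr (\<alpha> + 1) * ((\<beta> + 1) * (1 + x) powr \<beta>)) * F x
         + (1 - x) powr (\<alpha> + 1) * (1 + x) powr (\<beta> + 1) * F' x = h x * jacobi_weight \<alpha> \<beta> x"
      unfolding e h_def jacobi_q_def jacobi_p_def jacobi_weight_def by (simp add: algebra_simps power2_eq_square)
    finally show "(G has_vector_derivative h x * jacobi_weight \<alpha> \<beta> x) (at x)"
      by (simp only: has_real_derivative_iff_has_vector_derivative[symmetric])
  qed simp
  moreover have "G 1 - G (-1) = 0" by (simp add: G_def)
  ultimately have h0: "((\<lambda>x. h x * jacobi_weight \<alpha> \<beta> x) has_integral 0) {-1<..<1}"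
    by (simp add: has_integral_Icc_iff_Ioo)
  have "integral\<^sup>L jm h = integral {-1<..<1} (\<lambda>x. h x * jacobi_weight \<alpha> \<beta> x)"
    using integrable_continuous[OF cont] borel_measurable_continuous_onI[OF cont]
    by (subst jm_integral_eq) (auto simp: jm_integrable_iff set_borel_integral_eq_integral(2))
  also have "\<dots> = 0" by (rule integral_unique[OF h0])
  finally have "integral\<^sup>L jm h = 0" .
  then show ?thesis by (simp add: h_def[abs_def])
qed

text \<open>Green's formula, obtained from the integration by parts with the Wronskian f' g - f g'
  in place of F.\<close>

lemma jacobi_T_symmetric:
  fixes f f' f'' g g' g'' :: "real \<Rightarrow> real"
  assumes "\<And>x. (f has_real_derivative f' x) (at x)" "\<And>x. (f' has_real_derivative f'' x) (at x)"
    and "\<And>x. (g has_real_derivative g' x) (at x)" "\<And>x. (g' has_real_derivative g'' x) (at x)"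
    and cont: "continuous_on UNIV f''" "continuous_on UNIV g''"
  shows "(\<integral>x. (jacobi_p x * f'' x + jacobi_q \<alpha> \<beta> x * f' x) * g x \<partial>jm)
       = (\<integral>x. f x * (jacobi_p x * g'' x + jacobi_q \<alpha> \<beta> x * g' x) \<partial>jm)"
proof -
  have c: "continuous_on UNIV f" "continuous_on UNIV f'" "continuous_on UNIV g" "continuous_on UNIV g'"
    by (meson DERIV_isCont assms continuous_at_imp_continuous_on)+
  have "(\<integral>x. jacobi_q \<alpha> \<beta> x * (f' x * g x - f x * g' x) + jacobi_p x * (f'' x * g x - f x * g'' x) \<partial>jm) = 0"
  proof (rule jacobi_integration_by_parts)
    fix x show "((\<lambda>x. f' x * g x - f x * g' x) has_real_derivative f'' x * g x - f x * g'' x) (at x)"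
      by (rule derivative_eq_intros assms refl)+ simp
  qed (intro continuous_intros c cont)
  also have "(\<lambda>x. jacobi_q \<alpha> \<beta> x * (f' x * g x - f x * g' x) + jacobi_p x * (f'' x * g x - f x * g'' x))
     = (\<lambda>x. (jacobi_p x * f'' x + jacobi_q \<alpha> \<beta> x * f' x) * g x - f x * (jacobi_p x * g'' x + jacobi_q \<alpha> \<beta> x * g' x))"
    by (auto simp: algebra_simps)
  finally show ?thesis
    by (subst (asm) Bochner_Integration.integral_diff)
      (auto intro!: integrable_continuous continuous_intros c cont simp: jacobi_p_def jacobi_q_def)
qed

definition Tpoly :: "real poly \<Rightarrow> real poly" where
  "Tpoly y = [:1, 0, -1:] * pderiv (pderiv y) + [:\<beta> - \<alpha>, - (\<alpha> + \<beta> + 2):] * pderiv y"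

lemma poly_Tpoly: "poly (Tpoly y) x = jacobi_p x * poly (pderiv (pderiv y)) x + jacobi_q \<alpha> \<beta> x * poly (pderiv y) x"
  by (simp add: Tpoly_def jacobi_p_def jacobi_q_def power2_eq_square algebra_simps)

lemma coeff_Tpoly:
  "coeff (Tpoly y) n = real ((n + 1) * (n + 2)) * coeff y (n + 2) + (\<beta> - \<alpha>) * real (n + 1) * coeff y (n + 1) - eigval n * coeff y n"
proof -
  have 1: "coeff (pCons 0 (pderiv y)) n = real n * coeff y n"
    by (cases n) (simp_all add: coeff_pderiv)
  have 2: "coeff (pCons 0 (pCons 0 (pderiv (pderiv y)))) n = real n * (real n - 1) * coeff y n"
    by (cases n; cases "n - 1") (simp_all add: coeff_pderiv coeff_pCons split: nat.splits)
  have T: "Tpoly y = pderiv (pderiv y) - pCons 0 (pCons 0 (pderiv (pderiv y)))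
      + smult (\<beta> - \<alpha>) (pderiv y) - smult (\<alpha> + \<beta> + 2) (pCons 0 (pderiv y))"
    by (rule poly_eqI) (simp add: Tpoly_def coeff_pCons algebra_simps split: nat.splits)
  have "coeff (Tpoly y) n = coeff (pderiv (pderiv y)) n - real n * (real n - 1) * coeff y n
      + (\<beta> - \<alpha>) * coeff (pderiv y) n - (\<alpha> + \<beta> + 2) * (real n * coeff y n)"
    unfolding T coeff_add coeff_diff coeff_smult 1 2 ..
  then show ?thesis by (simp add: coeff_pderiv eigval_def algebra_simps)
qed

lemma degree_Tpoly: "degree (Tpoly y) \<le> degree y"
  by (rule degree_le) (auto simp: coeff_Tpoly coeff_eq_0)

lemma pn_expansion:
  assumes "degree s \<le> n"
  shows "\<exists>c. s = (\<Sum>k\<le>n. smult (c k) (pn k)) \<and> (\<forall>m. (\<integral>x. poly s x * poly (pn m) x \<partial>jm) = (if m \<le> n then c m else 0))"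
proof -
  have "lead_coeff (pn k) \<noteq> 0" for k using lead_coeff_pn[of k] degree_pn[of k] by simp
  then obtain c where c: "s = (\<Sum>k\<le>n. smult (c k) (pn k))"
    by (rule poly_basis[of pn s n, OF degree_pn _ assms])
  have "(\<integral>x. poly s x * poly (pn m) x \<partial>jm) = (if m \<le> n then c m else 0)" for m
  proof -
    have "(\<integral>x. poly s x * poly (pn m) x \<partial>jm) = (\<integral>x. (\<Sum>k\<le>n. c k * (poly (pn k) x * poly (pn m) x)) \<partial>jm)"
      by (simp add: c poly_sum sum_distrib_right mult.assoc)
    also have "\<dots> = (\<Sum>k\<le>n. c k * (\<integral>x. poly (pn k) x * poly (pn m) x \<partial>jm))"
      by (simp add: Bochner_Integration.integral_sum pn_orthonormal(1))
    also have "\<dots> = (\<Sum>k\<le>n. if k = m then c k else 0)"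
      by (intro sum.cong) (auto simp: pn_orthonormal(2))
    finally show ?thesis by simp
  qed
  with c show ?thesis by (intro exI[of _ c] conjI allI)
qed

text \<open>The operator does not raise degrees and is symmetric, so the image of p_n is orthogonal
  to each p_k with k < n. The remaining multiple of p_n is determined by comparing leading
  coefficients.\<close>

lemma Tpoly_pn: "Tpoly (pn n) = smult (- eigval n) (pn n)"
proof -
  obtain c where c: "Tpoly (pn n) = (\<Sum>k\<le>n. smult (c k) (pn k)) \<and>
    (\<forall>m. (\<integral>x. poly (Tpoly (pn n)) x * poly (pn m) x \<partial>jm) = (if m \<le> n then c m else 0))"
    using pn_expansion[OF degree_Tpoly[of "pn n", unfolded degree_pn]] by (rule exE)
  have "c k = 0" if k: "k < n" for k
  proof -
    obtain d where d: "Tpoly (pn k) = (\<Sum>k\<le>k. smult (d k) (pn k)) \<and>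
      (\<forall>m. (\<integral>x. poly (Tpoly (pn k)) x * poly (pn m) x \<partial>jm) = (if m \<le> k then d m else 0))"
      using pn_expansion[OF degree_Tpoly[of "pn k", unfolded degree_pn]] by (rule exE)
    have "c k = (\<integral>x. poly (Tpoly (pn n)) x * poly (pn k) x \<partial>jm)"
      using conjunct2[OF c, THEN spec, of k] k by simp
    also have "\<dots> = (\<integral>x. poly (pn n) x * poly (Tpoly (pn k)) x \<partial>jm)"
      unfolding poly_Tpoly
      by (rule jacobi_T_symmetric[OF poly_DERIV poly_DERIV poly_DERIV poly_DERIV]) (intro continuous_intros)+
    also have "\<dots> = (\<integral>x. poly (Tpoly (pn k)) x * poly (pn n) x \<partial>jm)" by (simp only: mult.commute)
    also have "\<dots> = 0" using conjunct2[OF d, THEN spec, of n] k by simp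
    finally show ?thesis .
  qed
  then have T: "Tpoly (pn n) = smult (c n) (pn n)"
  proof -
    have "(\<Sum>k\<le>n. smult (c k) (pn k)) = (\<Sum>k\<le>n. if k = n then smult (c n) (pn n) else 0)"
      using \<open>\<And>k. k < n \<Longrightarrow> c k = 0\<close> by (intro sum.cong) auto
    then show ?thesis using conjunct1[OF c] by simp
  qed
  have "c n * coeff (pn n) n = coeff (Tpoly (pn n)) n" by (simp add: T)
  also have "\<dots> = - eigval n * coeff (pn n) n" by (simp add: coeff_Tpoly coeff_eq_0)
  finally have "c n = - eigval n" using lead_coeff_pn[of n] mult_right_cancel[of "coeff (pn n) n" "c n" "- eigval n"] by simp
  then show ?thesis using T by simp
qed

lemma pn_ode:
  "jacobi_p x * poly (pderiv (pderiv (pn n))) x + jacobi_q \<alpha> \<beta> x * poly (pderiv (pn n)) x = - eigval n * poly (pn n) x"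
  using arg_cong[OF Tpoly_pn[of n], of "\<lambda>r. poly r x"] by (simp add: poly_Tpoly)

text \<open>The Dirichlet form of an eigenfunction: integration by parts with F = y y', followed by
  the differential equation.\<close>

lemma pn_deriv_norm: "(\<integral>x. jacobi_p x * (poly (pderiv (pn n)) x)\<^sup>2 \<partial>jm) = eigval n"
proof -
  let ?y = "poly (pn n)" and ?y1 = "poly (pderiv (pn n))" and ?y2 = "poly (pderiv (pderiv (pn n)))"
  have "(\<integral>x. jacobi_q \<alpha> \<beta> x * (?y x * ?y1 x) + jacobi_p x * (?y1 x * ?y1 x + ?y x * ?y2 x) \<partial>jm) = 0"
  proof (rule jacobi_integration_by_parts)
    fix x show "((\<lambda>x. ?y x * ?y1 x) has_real_derivative ?y1 x * ?y1 x + ?y x * ?y2 x) (at x)"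
      by (rule DERIV_cong[OF DERIV_mult[OF poly_DERIV poly_DERIV]]) simp
  qed (intro continuous_intros)
  also have "(\<lambda>x. jacobi_q \<alpha> \<beta> x * (?y x * ?y1 x) + jacobi_p x * (?y1 x * ?y1 x + ?y x * ?y2 x))
     = (\<lambda>x. jacobi_p x * (?y1 x)\<^sup>2 - eigval n * (?y x * ?y x))"
  proof
    fix x
    have "jacobi_q \<alpha> \<beta> x * (?y x * ?y1 x) + jacobi_p x * (?y1 x * ?y1 x + ?y x * ?y2 x)
      = jacobi_p x * (?y1 x)\<^sup>2 + ?y x * (jacobi_p x * ?y2 x + jacobi_q \<alpha> \<beta> x * ?y1 x)"
      by (simp add: algebra_simps power2_eq_square)
    then show "jacobi_q \<alpha> \<beta> x * (?y x * ?y1 x) + jacobi_p x * (?y1 x * ?y1 x + ?y x * ?y2 x)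
      = jacobi_p x * (?y1 x)\<^sup>2 - eigval n * (?y x * ?y x)"
      unfolding pn_ode by simp
  qed
  also have "(\<integral>x. jacobi_p x * (?y1 x)\<^sup>2 - eigval n * (?y x * ?y x) \<partial>jm)
     = (\<integral>x. jacobi_p x * (?y1 x)\<^sup>2 \<partial>jm) - (\<integral>x. eigval n * (?y x * ?y x) \<partial>jm)"
    unfolding jacobi_p_def by (intro Bochner_Integration.integral_diff integrable_continuous continuous_intros)
  finally have "(\<integral>x. jacobi_p x * (?y1 x)\<^sup>2 \<partial>jm) - eigval n * (\<integral>x. ?y x * ?y x \<partial>jm) = 0" by simp
  then show ?thesis by (simp add: pn_orthonormal(2))
qed

end

section \<open>Pointwise bounds by a Sonin energy\<close>

text \<open>For r = sqrt(1 - x^2) and x = cos \<theta> the two first-order equations say that u, as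
  a function of \<theta>, solves u'' = Z u, with v equal to -u'. The condition on \<open>Z'\<close>
  says that the potential increases towards x = 1, and \<open>lim\<close> selects the solution that
  is recessive there.\<close>

locale sonin =
  fixes u v r Z Z' :: "real \<Rightarrow> real" and x0 :: real
  assumes r: "\<And>x. x0 \<le> x \<Longrightarrow> x < 1 \<Longrightarrow> 0 < r x"
    and u: "\<And>x. x0 \<le> x \<Longrightarrow> x < 1 \<Longrightarrow> (u has_real_derivative v x / r x) (at x)"
    and v: "\<And>x. x0 \<le> x \<Longrightarrow> x < 1 \<Longrightarrow> (v has_real_derivative Z x * u x / r x) (at x)"
    and Z: "\<And>x. x0 \<le> x \<Longrightarrow> x < 1 \<Longrightarrow> (Z has_real_derivative Z' x) (at x)"
    and Z': "\<And>x. x0 \<le> x \<Longrightarrow> x < 1 \<Longrightarrow> 0 \<le> Z' x"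
    and lim: "((\<lambda>x. u x * v x) \<longlongrightarrow> 0) (at_left 1)"
begin

lemma Z_mono: "x0 \<le> z \<Longrightarrow> z \<le> x \<Longrightarrow> x < 1 \<Longrightarrow> Z z \<le> Z x"
  by (rule DERIV_nonneg_imp_nondecreasing[of z x Z], assumption) (meson Z Z' order.trans order.strict_trans1)

text \<open>The mixed terms in u v cancel and the derivative of the energy is -Z' u^2.\<close>

lemma energy_antimono:
  assumes "x0 \<le> z" "z \<le> x" "x < 1"
  shows "(v x)\<^sup>2 - Z x * (u x)\<^sup>2 \<le> (v z)\<^sup>2 - Z z * (u z)\<^sup>2"
proof (rule DERIV_nonpos_imp_nonincreasing[OF assms(2)])
  fix y assume "z \<le> y" "y \<le> x"
  then have y: "x0 \<le> y" "y < 1" using assms by auto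
  have "((\<lambda>x. (v x)\<^sup>2 - Z x * (u x)\<^sup>2) has_real_derivative
      2 * v y * (Z y * u y / r y) - (Z' y * (u y)\<^sup>2 + Z y * (2 * u y * (v y / r y)))) (at y)"
    by (auto intro!: derivative_eq_intros u v Z y)
  also have "2 * v y * (Z y * u y / r y) - (Z' y * (u y)\<^sup>2 + Z y * (2 * u y * (v y / r y))) = - (Z' y * (u y)\<^sup>2)"
    by (simp add: algebra_simps)
  finally show "\<exists>d. ((\<lambda>x. (v x)\<^sup>2 - Z x * (u x)\<^sup>2) has_real_derivative d) (at y) \<and> d \<le> 0"
    using Z'[OF y] by (intro exI[of _ "- (Z' y * (u y)\<^sup>2)"]) auto
qed

text \<open>Past the turning point the derivative of u v is (v^2 + Z u^2)/r \<ge> 0, and u v tends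
  to 0 at the endpoint, so it approaches 0 from below.\<close>

lemma product_nonpos:
  assumes "x0 \<le> x" "x < 1" "0 \<le> Z x"
  shows "u x * v x \<le> 0"
proof (rule tendsto_lowerbound[OF lim])
  have mono: "u x * v x \<le> u y * v y" if "x \<le> y" "y < 1" for y
  proof (rule DERIV_nonneg_imp_nondecreasing[OF that(1)])
    fix w assume "x \<le> w" "w \<le> y"
    then have w: "x0 \<le> w" "w < 1" and Zw: "0 \<le> Z w"
      using assms that Z_mono[of x w] by auto
    have "((\<lambda>x. u x * v x) has_real_derivative v w / r w * v w + u w * (Z w * u w / r w)) (at w)"
      by (auto intro!: derivative_eq_intros u v w)
    moreover have "v w / r w * v w + u w * (Z w * u w / r w) = ((v w)\<^sup>2 + Z w * (u w)\<^sup>2) / r w"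
      by (simp add: add_divide_distrib power2_eq_square mult_ac)
    moreover have "0 \<le> ((v w)\<^sup>2 + Z w * (u w)\<^sup>2) / r w" using r[OF w] Zw by simp
    ultimately show "\<exists>d. ((\<lambda>x. u x * v x) has_real_derivative d) (at w) \<and> 0 \<le> d" by metis
  qed
  show "\<forall>\<^sub>F y in at_left 1. u x * v x \<le> u y * v y"
    using eventually_at_left_real[OF assms(2)] by eventually_elim (use mono in auto)
qed simp

lemma velocity_antimono:
  assumes "x0 \<le> z" "z \<le> x" "x < 1" "0 \<le> Z z"
  shows "(v x)\<^sup>2 \<le> (v z)\<^sup>2"
proof (rule DERIV_nonpos_imp_nonincreasing[OF assms(2)])
  fix y assume "z \<le> y" "y \<le> x"
  then have y: "x0 \<le> y" "y < 1" and Zy: "0 \<le> Z y" using assms Z_mono[of z y] by auto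
  have "((\<lambda>x. (v x)\<^sup>2) has_real_derivative 2 * v y * (Z y * u y / r y)) (at y)"
    by (auto intro!: derivative_eq_intros v y)
  also have "2 * v y * (Z y * u y / r y) = 2 * Z y / r y * (u y * v y)" by simp
  finally have "((\<lambda>x. (v x)\<^sup>2) has_real_derivative 2 * Z y / r y * (u y * v y)) (at y)" .
  moreover have "2 * Z y / r y * (u y * v y) \<le> 0"
    by (rule mult_nonneg_nonpos[OF _ product_nonpos[OF y Zy]]) (use r[OF y] Zy in simp)
  ultimately show "\<exists>d. ((\<lambda>x. (v x)\<^sup>2) has_real_derivative d) (at y) \<and> d \<le> 0" by blast
qed

text \<open>Where Z \<le> 0 the energy dominates v^2; where Z \<ge> 0 the sign of u v makes v^2
  itself decrease. The two regimes are glued at a zero of Z, where the energy equals v^2.\<close>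

lemma velocity_le:
  assumes "x0 \<le> z" "z \<le> x" "x < 1"
  shows "(v x)\<^sup>2 \<le> (v z)\<^sup>2 + max 0 (- Z z) * (u z)\<^sup>2"
proof (cases "0 \<le> Z z")
  case True
  then show ?thesis using velocity_antimono[OF assms] by (simp add: max_def)
next
  case Zz: False
  then have rhs: "(v z)\<^sup>2 + max 0 (- Z z) * (u z)\<^sup>2 = (v z)\<^sup>2 - Z z * (u z)\<^sup>2" by (simp add: max_def)
  show ?thesis
  proof (cases "Z x \<le> 0")
    case True
    then have "Z x * (u x)\<^sup>2 \<le> 0" by (simp add: mult_le_0_iff)
    then show ?thesis using energy_antimono[OF assms] rhs by linarith
  next
    case False
    have "continuous_on {z..x} Z"
      using assms by (intro continuous_at_imp_continuous_on ballI DERIV_isCont[OF Z]) auto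
    then obtain y where y: "z \<le> y" "y \<le> x" "Z y = 0"
      using IVT'[of Z z 0 x] Zz False assms by auto
    then have "(v x)\<^sup>2 \<le> (v y)\<^sup>2" using assms by (intro velocity_antimono) auto
    also have "\<dots> = (v y)\<^sup>2 - Z y * (u y)\<^sup>2" using y by simp
    also have "\<dots> \<le> (v z)\<^sup>2 - Z z * (u z)\<^sup>2" using y assms by (intro energy_antimono) auto
    finally show ?thesis using rhs by simp
  qed
qed

end

section \<open>Liouville normal form of the Jacobi equation\<close>

context jacobi
begin

text \<open>The square is the Jacobi weight times sqrt(1 - x^2), so that multiplication by it maps
  L^2 of the weight to L^2(d \<theta>) under x = cos \<theta>.\<close>

definition amp :: "real \<Rightarrow> real" where
  "amp x = (1 - x) powr (\<alpha> / 2 + 1 / 4) * (1 + x) powr (\<beta> / 2 + 1 / 4)"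

text \<open>This is p times the logarithmic derivative of \<open>amp\<close>.\<close>

definition kap :: "real \<Rightarrow> real" where
  "kap x = ((\<beta> - \<alpha>) - (\<alpha> + \<beta> + 1) * x) / 2"

text \<open>Near x = 1 it behaves like (\<alpha>^2 - 1/4)/(1 - x^2), the centrifugal term of the
  Bessel equation.\<close>

definition pot :: "real \<Rightarrow> real" where
  "pot x = ((kap x)\<^sup>2 + x * kap x) / jacobi_p x - (\<alpha> + \<beta> + 1) / 2"

definition pot_num :: "real \<Rightarrow> real" where
  "pot_num x = (2 * kap x * (- (\<alpha> + \<beta> + 1) / 2) + kap x + x * (- (\<alpha> + \<beta> + 1) / 2)) * jacobi_p x + 2 * x * ((kap x)\<^sup>2 + x * kap x)"

definition uu :: "nat \<Rightarrow> real \<Rightarrow> real" where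
  "uu n x = poly (pn n) x * amp x"

definition vv :: "nat \<Rightarrow> real \<Rightarrow> real" where
  "vv n x = amp x * (sqrt (jacobi_p x) * poly (pderiv (pn n)) x + kap x * poly (pn n) x / sqrt (jacobi_p x))"

lemma jacobi_p_eq: "jacobi_p x = (1 - x) * (1 + x)"
  by (simp add: jacobi_p_def power2_eq_square algebra_simps)

lemma jacobi_p_pos: "x \<in> {-1<..<1} \<Longrightarrow> 0 < jacobi_p x"
  unfolding jacobi_p_eq by (intro mult_pos_pos) auto

lemma powr_minus_one: "0 < (y::real) \<Longrightarrow> y powr (a - 1) = y powr a / y"
  by (simp add: powr_diff)

lemma powr_square_eq: "0 < (y::real) \<Longrightarrow> (y powr (a / 2 + 1 / 4))\<^sup>2 = y powr a * sqrt y"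
  by (simp add: power2_eq_square powr_add[symmetric] powr_half_sqrt[symmetric])

lemma DERIV_jacobi_p: "(jacobi_p has_real_derivative - 2 * x) (at x)"
  unfolding jacobi_p_def[abs_def] by (auto intro!: derivative_eq_intros)

lemma DERIV_kap: "(kap has_real_derivative - (\<alpha> + \<beta> + 1) / 2) (at x)"
  unfolding kap_def[abs_def] by (auto intro!: derivative_eq_intros)

lemma DERIV_amp:
  assumes "x \<in> {-1<..<1}"
  shows "(amp has_real_derivative amp x * kap x / jacobi_p x) (at x)"
proof -
  let ?a = "\<alpha> / 2 + 1 / 4" and ?c = "\<beta> / 2 + 1 / 4"
  have e: "(1 - x) powr (?a - 1) = (1 - x) powr ?a / (1 - x)" "(1 + x) powr (?c - 1) = (1 + x) powr ?c / (1 + x)"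
    using assms powr_minus_one[of "1 - x" ?a] powr_minus_one[of "1 + x" ?c] by auto
  have "(amp has_real_derivative - (?a * (1 - x) powr (?a - 1)) * (1 + x) powr ?c + (1 - x) powr ?a * (?c * (1 + x) powr (?c - 1))) (at x)"
    unfolding amp_def[abs_def] using assms by (auto intro!: derivative_eq_intros)
  also have "- (?a * (1 - x) powr (?a - 1)) * (1 + x) powr ?c + (1 - x) powr ?a * (?c * (1 + x) powr (?c - 1))
     = amp x * (- ?a / (1 - x) + ?c / (1 + x))"
  proof -
    have gen: "- (a * (A / d)) * B + A * (c * (B / e)) = A * B * (- a / d + c / e)" for a A B c d e :: real
      by (simp add: algebra_simps)
    show ?thesis unfolding e amp_def by (rule gen)
  qed
  also have "- ?a / (1 - x) + ?c / (1 + x) = kap x / jacobi_p x"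
    using assms by (simp add: jacobi_p_eq kap_def divide_simps) (simp add: algebra_simps)
  finally show ?thesis by simp
qed

lemma DERIV_pot:
  assumes "x \<in> {-1<..<1}"
  shows "(pot has_real_derivative pot_num x / (jacobi_p x)\<^sup>2) (at x)"
proof -
  have "jacobi_p x \<noteq> 0" using jacobi_p_pos[OF assms] by simp
  then have "(pot has_real_derivative ((2 * kap x * (- (\<alpha> + \<beta> + 1) / 2) + (kap x + x * (- (\<alpha> + \<beta> + 1) / 2))) * jacobi_p x
      - ((kap x)\<^sup>2 + x * kap x) * (- 2 * x)) / (jacobi_p x * jacobi_p x)) (at x)"
    unfolding pot_def[abs_def]
    by (auto intro!: derivative_eq_intros DERIV_kap DERIV_jacobi_p)
  then show ?thesis by (simp add: pot_num_def power2_eq_square algebra_simps)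
qed

lemma DERIV_uu:
  assumes "x \<in> {-1<..<1}"
  shows "(uu n has_real_derivative vv n x / sqrt (jacobi_p x)) (at x)"
proof -
  have p: "0 < jacobi_p x" by (rule jacobi_p_pos[OF assms])
  have "(uu n has_real_derivative poly (pderiv (pn n)) x * amp x + poly (pn n) x * (amp x * kap x / jacobi_p x)) (at x)"
    unfolding uu_def[abs_def] by (auto intro!: derivative_eq_intros poly_DERIV DERIV_amp assms)
  also have "poly (pderiv (pn n)) x * amp x + poly (pn n) x * (amp x * kap x / jacobi_p x) = vv n x / sqrt (jacobi_p x)"
    using p unfolding vv_def by (simp add: field_simps)
  finally show ?thesis .
qed

text \<open>The choice of \<open>amp\<close> makes 2 kap - x equal to q, so the terms with
  derivatives of p_n form the Jacobi operator and are replaced by -eigval n p_n; no first-order term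
  is left.\<close>

lemma DERIV_vv:
  assumes x: "x \<in> {-1<..<1}"
  shows "(vv n has_real_derivative (pot x - eigval n) * uu n x / sqrt (jacobi_p x)) (at x)"
proof -
  define R where "R = sqrt (jacobi_p x)"
  have R: "0 < R" "jacobi_p x = R\<^sup>2" using jacobi_p_pos[OF x] by (auto simp: R_def)
  let ?y = "poly (pn n) x" and ?y1 = "poly (pderiv (pn n)) x" and ?y2 = "poly (pderiv (pderiv (pn n))) x"
  define S where "S = (\<lambda>x. sqrt (jacobi_p x))"
  have S: "S x = R" "vv n = (\<lambda>x. amp x * (S x * poly (pderiv (pn n)) x + kap x * poly (pn n) x / S x))"
    by (auto simp: S_def R_def vv_def[abs_def])
  have dS: "(S has_real_derivative - x / R) (at x)"
  proof -
    have "((\<lambda>x. sqrt (jacobi_p x)) has_real_derivative (- 2 * x) * (inverse (sqrt (jacobi_p x)) / 2)) (at x)"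
      using jacobi_p_pos[OF x] by (auto intro!: derivative_eq_intros DERIV_jacobi_p)
    then show ?thesis by (simp add: R_def S_def field_simps)
  qed
  have "(vv n has_real_derivative
     amp x * kap x / jacobi_p x * (R * ?y1 + kap x * ?y / R)
     + amp x * ((- x / R) * ?y1 + R * ?y2 + (((- (\<alpha> + \<beta> + 1) / 2) * ?y + kap x * ?y1) * R - kap x * ?y * (- x / R)) / (R * R))) (at x)"
    unfolding S(2) using R(1)
    by (auto intro!: derivative_eq_intros poly_DERIV DERIV_amp DERIV_kap dS x simp: S(1))
  also have "amp x * kap x / jacobi_p x * (R * ?y1 + kap x * ?y / R)
     + amp x * ((- x / R) * ?y1 + R * ?y2 + (((- (\<alpha> + \<beta> + 1) / 2) * ?y + kap x * ?y1) * R - kap x * ?y * (- x / R)) / (R * R))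
     = amp x / R * ((R\<^sup>2 * ?y2 + (2 * kap x - x) * ?y1) + (((kap x)\<^sup>2 + x * kap x) / R\<^sup>2 - (\<alpha> + \<beta> + 1) / 2) * ?y)"
    unfolding R(2) using R(1) by (simp add: field_simps power2_eq_square)
  also have "R\<^sup>2 * ?y2 + (2 * kap x - x) * ?y1 = - eigval n * ?y"
  proof -
    have "2 * kap x = (\<beta> - \<alpha>) - (\<alpha> + \<beta> + 1) * x" by (simp add: kap_def)
    then have "2 * kap x - x = jacobi_q \<alpha> \<beta> x" by (simp add: jacobi_q_def algebra_simps)
    then show ?thesis using pn_ode[of x n] unfolding R(2) by simp
  qed
  also have "((kap x)\<^sup>2 + x * kap x) / R\<^sup>2 - (\<alpha> + \<beta> + 1) / 2 = pot x" by (simp add: pot_def R(2))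
  also have "amp x / R * (- eigval n * ?y + pot x * ?y) = (pot x - eigval n) * uu n x / sqrt (jacobi_p x)"
    unfolding uu_def R_def by (simp add: algebra_simps diff_divide_distrib)
  finally show ?thesis .
qed

lemma amp_square: "x \<in> {-1<..<1} \<Longrightarrow> (amp x)\<^sup>2 = jacobi_weight \<alpha> \<beta> x * sqrt (jacobi_p x)"
  unfolding amp_def jacobi_weight_def jacobi_p_eq real_sqrt_mult power_mult_distrib
  by (simp only: powr_square_eq greaterThanLessThan_iff) (simp add: powr_square_eq)

text \<open>The square roots cancel in the product, which becomes the Jacobi weight times a
  polynomial; its limit at x = 1 can then be read off.\<close>

lemma uu_vv_eq:
  assumes "x \<in> {-1<..<1}"
  shows "uu n x * vv n x = jacobi_weight \<alpha> \<beta> x * (poly (pn n) x * (jacobi_p x * poly (pderiv (pn n)) x + kap x * poly (pn n) x))"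
proof -
  define R where "R = sqrt (jacobi_p x)"
  have R: "0 < R" "jacobi_p x = R\<^sup>2" using jacobi_p_pos[OF assms] by (auto simp: R_def)
  have "uu n x * vv n x = (amp x)\<^sup>2 * (poly (pn n) x * (R * poly (pderiv (pn n)) x + kap x * poly (pn n) x / R))"
    unfolding uu_def vv_def R_def[symmetric] by (simp add: power2_eq_square)
  also have "(amp x)\<^sup>2 = jacobi_weight \<alpha> \<beta> x * R" using amp_square[OF assms] by (simp add: R_def)
  also have "jacobi_weight \<alpha> \<beta> x * R * (poly (pn n) x * (R * poly (pderiv (pn n)) x + kap x * poly (pn n) x / R))
    = jacobi_weight \<alpha> \<beta> x * (poly (pn n) x * (R * (R * poly (pderiv (pn n)) x + kap x * poly (pn n) x / R)))"
    by simp
  also have "R * (R * poly (pderiv (pn n)) x + kap x * poly (pn n) x / R) = R\<^sup>2 * poly (pderiv (pn n)) x + kap x * poly (pn n) x"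
    using R(1) by (simp add: distrib_left power2_eq_square)
  finally show ?thesis unfolding R(2) .
qed

lemma tendsto_at_left_1I:
  fixes h :: "real \<Rightarrow> real"
  assumes "continuous_on {0..1} h" "h 1 = 0"
  shows "(h \<longlongrightarrow> 0) (at_left 1)"
proof -
  have "(h \<longlongrightarrow> h 1) (at 1 within {0..1})" using assms(1) by (auto simp: continuous_on_def)
  then show ?thesis using assms(2) by (simp add: at_within_Icc_at_left)
qed

lemma uu_tendsto: "(uu n \<longlongrightarrow> 0) (at_left 1)"
  unfolding uu_def[abs_def] amp_def using \<alpha>
  by (intro tendsto_at_left_1I continuous_intros continuous_on_powr') auto

lemma uu_vv_tendsto: "((\<lambda>x. uu n x * vv n x) \<longlongrightarrow> 0) (at_left 1)"
proof -
  have "((\<lambda>x. jacobi_weight \<alpha> \<beta> x * (poly (pn n) x * (jacobi_p x * poly (pderiv (pn n)) x + kap x * poly (pn n) x))) \<longlongrightarrow> 0) (at_left 1)"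
    unfolding jacobi_weight_def jacobi_p_def kap_def using \<alpha>
    by (intro tendsto_at_left_1I continuous_intros continuous_on_powr') auto
  moreover have "\<forall>\<^sub>F x in at_left 1. jacobi_weight \<alpha> \<beta> x * (poly (pn n) x * (jacobi_p x * poly (pderiv (pn n)) x + kap x * poly (pn n) x)) = uu n x * vv n x"
  proof -
    have "\<forall>\<^sub>F x in at_left (1::real). x \<in> {-1<..<1}" by (rule eventually_at_left_real) simp
    then show ?thesis by eventually_elim (simp add: uu_vv_eq)
  qed
  ultimately show ?thesis by (rule Lim_transform_eventually)
qed

text \<open>The value at x = 1 is 2 (\<alpha>^2 - 1/4) > 0, and continuity keeps the sign in a
  neighbourhood. This fixes how far from the endpoint the energy method reaches.\<close>

lemma pot_num_pos: "\<exists>x0. 0 \<le> x0 \<and> x0 < 1 \<and> (\<forall>x\<in>{x0..1}. 0 < pot_num x)"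
proof -
  have "isCont pot_num 1"
    unfolding pot_num_def[abs_def] kap_def jacobi_p_def by (intro continuous_intros) auto
  moreover have "pot_num 1 = 2 * (\<alpha>\<^sup>2 - 1 / 4)"
    by (simp add: pot_num_def kap_def jacobi_p_def power2_eq_square field_simps)
  moreover have "0 < \<alpha>\<^sup>2 - 1 / 4"
  proof -
    have "(3 / 2)\<^sup>2 < \<alpha>\<^sup>2" using \<alpha> by (intro power_strict_mono) auto
    then show ?thesis by (simp add: power2_eq_square)
  qed
  ultimately have pos1: "0 < pot_num 1" and "(pot_num \<longlongrightarrow> pot_num 1) (at 1)"
    by (simp_all only: isCont_def mult_pos_pos zero_less_numeral)
  then have "\<forall>\<^sub>F x in at 1. 0 < pot_num x" by (intro order_tendstoD(1))
  then obtain d where d: "0 < d" "\<And>x. x \<noteq> 1 \<Longrightarrow> dist x 1 < d \<Longrightarrow> 0 < pot_num x"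
    unfolding eventually_at by blast
  define x0 where "x0 = max 0 (1 - d / 2)"
  have "0 < pot_num x" if "x \<in> {x0..1}" for x
    using d(1) that pos1 by (cases "x = 1") (auto simp: x0_def dist_real_def intro!: d(2))
  then show ?thesis using d(1) by (intro exI[of _ x0]) (auto simp: x0_def)
qed

end

lemma nonpos_if_deriv_nonneg_tendsto_0:
  fixes g g' :: "real \<Rightarrow> real"
  assumes "x < 1" and "\<And>y. x \<le> y \<Longrightarrow> y < 1 \<Longrightarrow> (g has_real_derivative g' y) (at y)"
    and "\<And>y. x \<le> y \<Longrightarrow> y < 1 \<Longrightarrow> 0 \<le> g' y" and lim: "(g \<longlongrightarrow> 0) (at_left 1)"
  shows "g x \<le> 0"
proof (rule tendsto_lowerbound[OF lim])
  have mono: "g x \<le> g y" if "x \<le> y" "y < 1" for y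
    by (rule DERIV_nonneg_imp_nondecreasing[OF that(1)])
      (meson assms(2,3) that(2) order.trans order.strict_trans1)
  show "\<forall>\<^sub>F y in at_left 1. g x \<le> g y"
    using eventually_at_left_real[OF assms(1)] by (rule eventually_mono) (simp add: mono)
qed simp

context jacobi
begin

lemma eigval_nonneg: "0 \<le> eigval n"
  unfolding eigval_def using \<alpha> \<beta> by (intro mult_nonneg_nonneg) auto

text \<open>Replaces a bound at every starting point z of [x0, x1] by its average, which is
  controlled by a global integral.\<close>

lemma average_le_jm:
  assumes "-1 < x0" "x0 \<le> x1" "x1 < 1" and G: "continuous_on UNIV G" "\<And>z. 0 \<le> G z"
    and c: "\<And>z. z \<in> {x0..x1} \<Longrightarrow> c \<le> jacobi_weight \<alpha> \<beta> z * G z"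
  shows "c * (x1 - x0) \<le> integral\<^sup>L jm G"
proof -
  have Gm: "G \<in> borel_measurable borel" by (rule borel_measurable_continuous_onI[OF G(1)])
  have "c * (x1 - x0) = (LINT z|lborel. indicator {x0..x1} z *\<^sub>R c)" using assms by simp
  also have "\<dots> \<le> (LINT z|lborel. indicator {-1<..<1} z *\<^sub>R (G z * jacobi_weight \<alpha> \<beta> z))"
  proof (rule integral_mono)
    show "integrable lborel (\<lambda>z. indicator {x0..x1} z *\<^sub>R c)"
      using assms(2) by (intro integrable_scaleR_left integrable_real_indicator) (auto simp: emeasure_lborel_Icc)
    show "integrable lborel (\<lambda>z. indicator {-1<..<1} z *\<^sub>R (G z * jacobi_weight \<alpha> \<beta> z))"
      using integrable_continuous[OF G(1)] by (simp only: jm_integrable_iff[OF Gm] set_integrable_def)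
    fix z :: real
    show "indicator {x0..x1} z *\<^sub>R c \<le> indicator {-1<..<1} z *\<^sub>R (G z * jacobi_weight \<alpha> \<beta> z)"
      using assms(1-3) c[of z] G(2)[of z] jacobi_weight_nonneg[of z]
      by (auto simp: indicator_def mult.commute)
  qed
  also have "\<dots> = integral\<^sup>L jm G"
    by (simp only: jm_integral_eq[OF Gm] set_lebesgue_integral_def)
  finally show ?thesis .
qed

lemma sqrt_jacobi_p_le_1: "sqrt (jacobi_p x) \<le> 1"
  by (simp add: jacobi_p_def)

lemma vv_square_le:
  assumes "x \<in> {-1<..<1}"
  shows "(vv n x)\<^sup>2 \<le> (amp x)\<^sup>2 * (2 * (jacobi_p x * (poly (pderiv (pn n)) x)\<^sup>2) + 2 * ((kap x)\<^sup>2 / jacobi_p x) * (poly (pn n) x)\<^sup>2)"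
proof -
  have p: "0 < jacobi_p x" by (rule jacobi_p_pos[OF assms])
  have "(A + B)\<^sup>2 \<le> 2 * A\<^sup>2 + 2 * B\<^sup>2" for A B :: real
    using zero_le_power2[of "A - B"] unfolding power2_sum power2_diff by linarith
  note this[of "sqrt (jacobi_p x) * poly (pderiv (pn n)) x" "kap x * poly (pn n) x / sqrt (jacobi_p x)"]
  then have "(sqrt (jacobi_p x) * poly (pderiv (pn n)) x + kap x * poly (pn n) x / sqrt (jacobi_p x))\<^sup>2
    \<le> 2 * (jacobi_p x * (poly (pderiv (pn n)) x)\<^sup>2) + 2 * ((kap x)\<^sup>2 / jacobi_p x) * (poly (pn n) x)\<^sup>2"
    using p by (simp add: power_mult_distrib power_divide)
  then show ?thesis unfolding vv_def power_mult_distrib by (intro mult_left_mono) auto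
qed

text \<open>No single point is known where the initial data are small. Averaging the starting point
  over [x0, x1] bounds them by the norms of p_n and sqrt(p) p_n', hence by a multiple of eigval n +
  1. The three estimates are those of sqrt(\<theta>) times a Bessel function of \<theta> freq n and
  its derivative.\<close>

lemma sonin_bounds:
  "\<exists>x1 C. 0 \<le> x1 \<and> x1 < 1 \<and> 0 < C \<and> (\<forall>n. \<forall>x\<in>{x1..<1}. (uu n x)\<^sup>2 \<le> C \<and>
     (uu n x)\<^sup>2 \<le> C * (eigval n + 1) * (1 - x) \<and> (vv n x)\<^sup>2 \<le> C * (eigval n + 1))"
proof -
  obtain x0 where x0: "0 \<le> x0" "x0 < 1" "\<And>x. x \<in> {x0..1} \<Longrightarrow> 0 < pot_num x"
    using pot_num_pos by blast
  define x1 where "x1 = (x0 + 1) / 2"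
  have x1: "x0 < x1" "x1 < 1" "0 \<le> x1" using x0 by (auto simp: x1_def)
  have ivl: "x \<in> {-1<..<1}" if "x0 \<le> x" "x < 1" for x using that x0 by auto
  have sonin: "sonin (uu n) (vv n) (\<lambda>x. sqrt (jacobi_p x)) (\<lambda>x. pot x - eigval n) (\<lambda>x. pot_num x / (jacobi_p x)\<^sup>2) x0" for n
  proof
    fix x assume x: "x0 \<le> x" "x < 1"
    show "0 < sqrt (jacobi_p x)" using jacobi_p_pos[OF ivl[OF x]] by simp
    show "(uu n has_real_derivative vv n x / sqrt (jacobi_p x)) (at x)" by (rule DERIV_uu[OF ivl[OF x]])
    show "(vv n has_real_derivative (pot x - eigval n) * uu n x / sqrt (jacobi_p x)) (at x)"
      by (rule DERIV_vv[OF ivl[OF x]])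
    show "((\<lambda>x. pot x - eigval n) has_real_derivative pot_num x / (jacobi_p x)\<^sup>2) (at x)"
      using DERIV_diff[OF DERIV_pot[OF ivl[OF x]] DERIV_const[of "eigval n"]] by simp
    show "0 \<le> pot_num x / (jacobi_p x)\<^sup>2" using x0(3)[of x] x by (auto intro!: divide_nonneg_nonneg less_imp_le)
  qed (rule uu_vv_tendsto)
  have nz: "jacobi_p z \<noteq> 0" if "z \<in> {x0..x1}" for z using jacobi_p_pos[of z] that x0 x1 by auto
  have "continuous_on {x0..x1} (\<lambda>z. \<bar>pot z\<bar> + (kap z)\<^sup>2 / jacobi_p z)"
    unfolding pot_def kap_def using nz by (auto intro!: continuous_intros simp: jacobi_p_def)
  then have "bounded ((\<lambda>z. \<bar>pot z\<bar> + (kap z)\<^sup>2 / jacobi_p z) ` {x0..x1})"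
    by (intro compact_imp_bounded compact_continuous_image) auto
  then obtain B where "\<forall>y\<in>(\<lambda>z. \<bar>pot z\<bar> + (kap z)\<^sup>2 / jacobi_p z) ` {x0..x1}. norm y \<le> B"
    unfolding bounded_iff by blast
  then have B: "\<bar>pot z\<bar> + (kap z)\<^sup>2 / jacobi_p z \<le> B" if "z \<in> {x0..x1}" for z
    using that by (force simp: abs_le_iff)
  have B': "\<bar>pot z\<bar> \<le> B" "(kap z)\<^sup>2 / jacobi_p z \<le> B" if "z \<in> {x0..x1}" for z
  proof -
    have "0 \<le> (kap z)\<^sup>2 / jacobi_p z" using jacobi_p_pos[of z] that x0 x1 by auto
    then show "\<bar>pot z\<bar> \<le> B" "(kap z)\<^sup>2 / jacobi_p z \<le> B" using B[OF that] by linarith+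
  qed
  have B0: "0 \<le> B" using B'(1)[of x0] x1 by (auto intro: order_trans[OF abs_ge_zero])
  \<comment> \<open>The left side is the bound from \<open>velocity_le\<close>, and taking max 0
    makes it dominate the energy at z as well, so one average serves both purposes.\<close>
  have avg_gen: "(vv n z)\<^sup>2 + max 0 (- (pot z - eigval n)) * (uu n z)\<^sup>2
      \<le> jacobi_weight \<alpha> \<beta> z * (2 * (jacobi_p z * (poly (pderiv (pn n)) z)\<^sup>2) + (eigval n + 3 * B) * (poly (pn n) z)\<^sup>2)"
    if z: "z \<in> {x0..x1}" for n z
  proof -
    let ?y = "poly (pn n) z" and ?y1 = "poly (pderiv (pn n)) z"
    have zi: "z \<in> {-1<..<1}" using z x0 x1 by auto
    have "(vv n z)\<^sup>2 \<le> (amp z)\<^sup>2 * (2 * (jacobi_p z * ?y1\<^sup>2) + 2 * ((kap z)\<^sup>2 / jacobi_p z) * ?y\<^sup>2)"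
      by (rule vv_square_le[OF zi])
    also have "\<dots> \<le> (amp z)\<^sup>2 * (2 * (jacobi_p z * ?y1\<^sup>2) + 2 * B * ?y\<^sup>2)"
      using B'(2)[OF z] by (intro mult_left_mono add_left_mono mult_right_mono) auto
    finally have 1: "(vv n z)\<^sup>2 \<le> (amp z)\<^sup>2 * (2 * (jacobi_p z * ?y1\<^sup>2) + 2 * B * ?y\<^sup>2)" .
    have "max 0 (- (pot z - eigval n)) * (uu n z)\<^sup>2 \<le> (eigval n + B) * (uu n z)\<^sup>2"
      using B'(1)[OF z] eigval_nonneg[of n] B0 by (intro mult_right_mono) auto
    also have "\<dots> = (amp z)\<^sup>2 * ((eigval n + B) * ?y\<^sup>2)" by (simp add: uu_def power_mult_distrib)
    finally have "(vv n z)\<^sup>2 + max 0 (- (pot z - eigval n)) * (uu n z)\<^sup>2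
       \<le> (amp z)\<^sup>2 * (2 * (jacobi_p z * ?y1\<^sup>2) + (eigval n + 3 * B) * ?y\<^sup>2)"
      using 1 by (simp add: algebra_simps)
    also have "(amp z)\<^sup>2 \<le> jacobi_weight \<alpha> \<beta> z"
      unfolding amp_square[OF zi] using jacobi_weight_nonneg sqrt_jacobi_p_le_1 by (intro mult_left_le) auto
    finally show ?thesis
      using jacobi_p_pos[OF zi] eigval_nonneg[of n] B0 by (simp add: mult_right_mono)
  qed
  define C1 where "C1 = (3 + 3 * B) / (x1 - x0)"
  have C1: "0 < C1" using x1 B0 by (simp add: C1_def)
  have avg: "c \<le> C1 * (eigval n + 1)"
    if "\<And>z. z \<in> {x0..x1} \<Longrightarrow> c \<le> (vv n z)\<^sup>2 + max 0 (- (pot z - eigval n)) * (uu n z)\<^sup>2" for c n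
  proof -
    define G where "G z = 2 * (\<bar>jacobi_p z\<bar> * (poly (pderiv (pn n)) z)\<^sup>2) + (eigval n + 3 * B) * (poly (pn n) z)\<^sup>2" for z
    have cont: "continuous_on UNIV G" unfolding G_def jacobi_p_def by (intro continuous_intros)
    have "c * (x1 - x0) \<le> integral\<^sup>L jm G"
    proof (rule average_le_jm[OF _ _ x1(2) cont])
      fix z assume z: "z \<in> {x0..x1}"
      then have "0 < jacobi_p z" using x0 x1 by (intro jacobi_p_pos) auto
      then show "c \<le> jacobi_weight \<alpha> \<beta> z * G z"
        using that[OF z] avg_gen[OF z, of n] by (simp add: G_def)
    qed (use x0 x1 B0 eigval_nonneg in \<open>auto simp: G_def\<close>)
    also have "integral\<^sup>L jm G = (\<integral>z. 2 * (jacobi_p z * (poly (pderiv (pn n)) z)\<^sup>2) + (eigval n + 3 * B) * (poly (pn n) z * poly (pn n) z) \<partial>jm)"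
    proof (rule integral_cong_AE)
      show "AE z in jm. G z = 2 * (jacobi_p z * (poly (pderiv (pn n)) z)\<^sup>2) + (eigval n + 3 * B) * (poly (pn n) z * poly (pn n) z)"
        using AE_jm
      proof eventually_elim
        case (elim z)
        then show ?case using jacobi_p_pos[of z] by (simp add: G_def power2_eq_square)
      qed
    qed (auto intro!: borel_measurable_continuous_onI cont continuous_intros simp: jacobi_p_def measurable_cong_sets[OF sets_jm refl])
    also have "\<dots> = 2 * (\<integral>z. jacobi_p z * (poly (pderiv (pn n)) z)\<^sup>2 \<partial>jm) + (eigval n + 3 * B) * (\<integral>z. poly (pn n) z * poly (pn n) z \<partial>jm)"
      by (subst Bochner_Integration.integral_add)
        (auto simp: jacobi_p_def intro!: integrable_continuous continuous_intros)
    also have "\<dots> = 3 * eigval n + 3 * B" by (simp add: pn_orthonormal(2) pn_deriv_norm)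
    also have "\<dots> \<le> (3 + 3 * B) * (eigval n + 1)"
      using B0 eigval_nonneg[of n] by (simp add: algebra_simps)
    finally show ?thesis using x1 by (simp add: C1_def pos_le_divide_eq)
  qed
  have vv: "(vv n x)\<^sup>2 \<le> C1 * (eigval n + 1)" if "x1 \<le> x" "x < 1" for n x
  proof (rule avg)
    fix z assume "z \<in> {x0..x1}"
    then show "(vv n x)\<^sup>2 \<le> (vv n z)\<^sup>2 + max 0 (- (pot z - eigval n)) * (uu n z)\<^sup>2"
      using sonin.velocity_le[OF sonin[of n], of z x] that by simp
  qed
  have energy: "(vv n x)\<^sup>2 - (pot x - eigval n) * (uu n x)\<^sup>2 \<le> C1 * (eigval n + 1)" if "x1 \<le> x" "x < 1" for n x
  proof (rule avg)
    fix z assume "z \<in> {x0..x1}"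
    then have "(vv n x)\<^sup>2 - (pot x - eigval n) * (uu n x)\<^sup>2 \<le> (vv n z)\<^sup>2 - (pot z - eigval n) * (uu n z)\<^sup>2"
      using sonin.energy_antimono[OF sonin[of n], of z x] that by simp
    also have "\<dots> = (vv n z)\<^sup>2 + (- (pot z - eigval n)) * (uu n z)\<^sup>2" by (simp add: left_diff_distrib)
    also have "\<dots> \<le> (vv n z)\<^sup>2 + max 0 (- (pot z - eigval n)) * (uu n z)\<^sup>2"
      by (intro add_left_mono mult_right_mono) auto
    finally show "(vv n x)\<^sup>2 - (pot x - eigval n) * (uu n x)\<^sup>2 \<le> (vv n z)\<^sup>2 + max 0 (- (pot z - eigval n)) * (uu n z)\<^sup>2" .
  qed
  \<comment> \<open>The bound |u'| \<le> d / sqrt(1 - y) is integrated from the endpoint, where u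
    vanishes, in the form of a monotone comparison function; the signs s = 1 and s = -1 give the two
    halves of the absolute value.\<close>
  have uu: "(uu n x)\<^sup>2 \<le> 4 * (C1 * (eigval n + 1)) * (1 - x)" if x: "x1 \<le> x" "x < 1" for n x
  proof -
    define d where "d = sqrt (C1 * (eigval n + 1))"
    have d: "0 \<le> d" "d\<^sup>2 = C1 * (eigval n + 1)" using C1 eigval_nonneg[of n] by (auto simp: d_def)
    have le: "s * uu n x - 2 * d * sqrt (1 - x) \<le> 0" if s: "\<bar>s\<bar> = 1" for s
    proof (rule nonpos_if_deriv_nonneg_tendsto_0[OF x(2)])
      fix y assume y: "x \<le> y" "y < 1"
      then have yi: "y \<in> {-1<..<1}" using x x1 by auto
      show "((\<lambda>y. s * uu n y - 2 * d * sqrt (1 - y)) has_real_derivative s * (vv n y / sqrt (jacobi_p y)) + d / sqrt (1 - y)) (at y)"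
        using y by (auto intro!: derivative_eq_intros DERIV_uu yi simp: field_simps)
      have "\<bar>s * (vv n y / sqrt (jacobi_p y))\<bar> = \<bar>vv n y\<bar> / sqrt (jacobi_p y)"
        using s jacobi_p_pos[OF yi] by (simp add: abs_mult)
      also have "\<dots> \<le> d / sqrt (1 - y)"
      proof (rule frac_le)
        show "\<bar>vv n y\<bar> \<le> d" using vv[of y n] y x d by (intro abs_le_square_iff[THEN iffD2, of "vv n y" d, simplified abs_of_nonneg[OF d(1)]]) auto
        show "sqrt (1 - y) \<le> sqrt (jacobi_p y)"
          using y x x1 by (auto simp: jacobi_p_eq mult_le_cancel_left1)
      qed (use y d in auto)
      finally have "\<bar>s * (vv n y / sqrt (jacobi_p y))\<bar> \<le> d / sqrt (1 - y)" .
      then show "0 \<le> s * (vv n y / sqrt (jacobi_p y)) + d / sqrt (1 - y)" unfolding abs_le_iff by simp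
    next
      have "((\<lambda>y. s * uu n y - 2 * d * sqrt (1 - y)) \<longlongrightarrow> s * 0 - 2 * d * sqrt (1 - 1)) (at_left 1)"
        by (intro tendsto_intros uu_tendsto)
      then show "((\<lambda>y. s * uu n y - 2 * d * sqrt (1 - y)) \<longlongrightarrow> 0) (at_left 1)" by simp
    qed
    have "\<bar>uu n x\<bar> \<le> 2 * d * sqrt (1 - x)" using le[of 1] le[of "-1"] by (simp add: abs_le_iff)
    then have "\<bar>uu n x\<bar>\<^sup>2 \<le> (2 * d * sqrt (1 - x))\<^sup>2" by (intro power_mono) auto
    then show ?thesis using d x by (simp add: power_mult_distrib)
  qed
  have "bounded ((\<lambda>z. \<bar>(kap z)\<^sup>2 + z * kap z\<bar>) ` {0..1})"
    unfolding kap_def by (intro compact_imp_bounded compact_continuous_image continuous_intros) auto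
  then obtain K where "\<forall>y\<in>(\<lambda>z. \<bar>(kap z)\<^sup>2 + z * kap z\<bar>) ` {0..1}. norm y \<le> K"
    unfolding bounded_iff by blast
  then have K: "\<bar>(kap z)\<^sup>2 + z * kap z\<bar> \<le> K" if "z \<in> {0..1}" for z using that by force
  have K0: "0 \<le> K" using order_trans[OF abs_ge_zero K[of 0]] by simp
  define C2 where "C2 = K + 1"
  have pot_le: "(pot x + 1) * (1 - x) \<le> C2" if x: "x1 \<le> x" "x < 1" for x
  proof -
    have xi: "x \<in> {-1<..<1}" using x x1 by auto
    have "((kap x)\<^sup>2 + x * kap x) / jacobi_p x \<le> K / (1 - x)"
      using K[of x] x x1 jacobi_p_pos[OF xi] by (intro frac_le) (auto simp: jacobi_p_eq mult_le_cancel_left1 K0)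
    then have "((kap x)\<^sup>2 + x * kap x) / jacobi_p x * (1 - x) \<le> K" using x by (simp add: pos_le_divide_eq)
    moreover have "(1 - (\<alpha> + \<beta> + 1) / 2) * (1 - x) \<le> 1 * 1"
      using x x1 \<alpha> \<beta> by (intro mult_mono) auto
    ultimately show ?thesis unfolding pot_def C2_def by (simp add: algebra_simps)
  qed
  \<comment> \<open>In the oscillatory region, where eigval n - pot x is at least half of eigval n +
    1, the energy controls u^2. Elsewhere (eigval n + 1)(1 - x) is bounded, and the estimate from
    the endpoint suffices.\<close>
  have uu': "(uu n x)\<^sup>2 \<le> 2 * C1 + 8 * C1 * C2" if x: "x1 \<le> x" "x < 1" for n x
  proof (cases "(eigval n + 1) / 2 \<le> eigval n - pot x")
    case True
    then have "(eigval n + 1) / 2 * (uu n x)\<^sup>2 \<le> (eigval n - pot x) * (uu n x)\<^sup>2" by (intro mult_right_mono) auto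
    also have "\<dots> \<le> (vv n x)\<^sup>2 - (pot x - eigval n) * (uu n x)\<^sup>2" by (simp add: algebra_simps)
    also have "\<dots> \<le> C1 * (eigval n + 1)" by (rule energy[OF x])
    finally have "(eigval n + 1) * (uu n x)\<^sup>2 \<le> (eigval n + 1) * (2 * C1)" by (simp add: algebra_simps)
    then have "(uu n x)\<^sup>2 \<le> 2 * C1" using eigval_nonneg[of n] by (subst (asm) mult_le_cancel_left_pos) auto
    then show ?thesis using C1 K0 by (simp add: C2_def add_increasing2)
  next
    case False
    then have "(eigval n + 1) * (1 - x) \<le> 2 * ((pot x + 1) * (1 - x))"
      using mult_right_mono[of "eigval n + 1" "2 * (pot x + 1)" "1 - x"] x by simp
    then have "(eigval n + 1) * (1 - x) \<le> 2 * C2" using pot_le[OF x] by linarith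
    then have "4 * C1 * ((eigval n + 1) * (1 - x)) \<le> 4 * C1 * (2 * C2)" using C1 by (intro mult_left_mono) auto
    then show ?thesis using uu[OF x, of n] C1 by (simp add: algebra_simps)
  qed
  define C where "C = 4 * C1 + 8 * C1 * C2"
  have C: "C1 \<le> C" "4 * C1 \<le> C" "2 * C1 + 8 * C1 * C2 \<le> C" "0 < C"
    using C1 K0 by (auto simp: C_def C2_def add_increasing2 intro!: add_pos_nonneg)
  show ?thesis
  proof (rule exI[of _ x1], rule exI[of _ C], intro conjI allI ballI)
    fix n :: nat and x :: real assume "x \<in> {x1..<1}"
    then have x: "x1 \<le> x" "x < 1" by auto
    have e: "0 \<le> eigval n + 1" using eigval_nonneg[of n] by simp
    show "(uu n x)\<^sup>2 \<le> C" using uu'[OF x, of n] C by linarith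
    have "4 * C1 * ((eigval n + 1) * (1 - x)) \<le> C * ((eigval n + 1) * (1 - x))"
      using C x e by (intro mult_right_mono) auto
    then show "(uu n x)\<^sup>2 \<le> C * (eigval n + 1) * (1 - x)" using uu[OF x, of n] by (simp add: mult.assoc)
    show "(vv n x)\<^sup>2 \<le> C * (eigval n + 1)"
      using vv[OF x, of n] mult_right_mono[OF C(1) e] by linarith
  qed (use x1 C in auto)
qed

text \<open>The Liouville factor is undone with \<open>amp_square\<close>, using sqrt(1 - x^2) \<ge>
  sqrt(1 - x) for x \<ge> 0; the derivative is recovered from v by subtracting the term kap u /
  sqrt(p), which the second bound on u controls.\<close>

lemma pn_pointwise_bounds:
  "\<exists>x1 C. 0 \<le> x1 \<and> x1 < 1 \<and> 0 < C \<and> (\<forall>n. \<forall>x\<in>{x1..<1}.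
     jacobi_weight \<alpha> \<beta> x * (poly (pn n) x)\<^sup>2 \<le> C / sqrt (1 - x) \<and>
     jacobi_weight \<alpha> \<beta> x * (poly (pn n) x)\<^sup>2 \<le> C * (eigval n + 1) * sqrt (1 - x) \<and>
     jacobi_weight \<alpha> \<beta> x * (jacobi_p x * (poly (pderiv (pn n)) x)\<^sup>2) \<le> C * (eigval n + 1) / sqrt (1 - x))"
proof -
  obtain x1 C where x1: "0 \<le> x1" "x1 < 1" and C: "0 < C"
    and b: "\<And>n x. x \<in> {x1..<1} \<Longrightarrow> (uu n x)\<^sup>2 \<le> C \<and>
     (uu n x)\<^sup>2 \<le> C * (eigval n + 1) * (1 - x) \<and> (vv n x)\<^sup>2 \<le> C * (eigval n + 1)"
    using sonin_bounds by blast
  have "bounded ((\<lambda>z. (kap z)\<^sup>2) ` {0..1})"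
    unfolding kap_def by (intro compact_imp_bounded compact_continuous_image continuous_intros) auto
  then obtain K where "\<forall>y\<in>(\<lambda>z. (kap z)\<^sup>2) ` {0..1}. norm y \<le> K"
    unfolding bounded_iff by blast
  then have K: "(kap z)\<^sup>2 \<le> K" if "z \<in> {0..1}" for z using that by force
  have K0: "0 \<le> K" using order_trans[OF zero_le_power2 K[of 0]] by simp
  define D where "D = C * (2 + 2 * K)"
  have D: "C \<le> D" "0 < D" using C K0 by (auto simp: D_def)
  show ?thesis
  proof (rule exI[of _ x1], rule exI[of _ D], intro conjI allI ballI)
    fix n :: nat and x :: real assume x: "x \<in> {x1..<1}"
    define R where "R = sqrt (jacobi_p x)"
    have xi: "x \<in> {-1<..<1}" using x x1 by auto
    have R: "0 < R" "jacobi_p x = R\<^sup>2" using jacobi_p_pos[OF xi] by (auto simp: R_def)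
    have sR: "sqrt (1 - x) \<le> R" "0 < sqrt (1 - x)" "sqrt (1 - x) * sqrt (1 - x) = 1 - x"
      using x x1 by (auto simp: R_def jacobi_p_eq mult_le_cancel_left1)
    have e: "0 \<le> eigval n + 1" using eigval_nonneg[of n] by simp
    let ?W = "jacobi_weight \<alpha> \<beta> x" and ?y = "poly (pn n) x" and ?y1 = "poly (pderiv (pn n)) x"
    have u2: "(uu n x)\<^sup>2 = ?W * R * ?y\<^sup>2"
      using amp_square[OF xi] by (simp add: uu_def power_mult_distrib R_def)
    have div: "a \<le> b / sqrt (1 - x)" if "R * a \<le> b" "0 \<le> a" for a b
    proof -
      have "sqrt (1 - x) * a \<le> R * a" using sR that by (intro mult_right_mono) auto
      then show ?thesis using that sR(2) by (simp add: pos_le_divide_eq mult.commute)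
    qed
    have Ru: "R * (?W * ?y\<^sup>2) = (uu n x)\<^sup>2" unfolding u2 by (simp only: mult_ac)
    have W0: "0 \<le> ?W" by (rule jacobi_weight_nonneg)
    show "?W * ?y\<^sup>2 \<le> D / sqrt (1 - x)"
    proof (rule div)
      show "R * (?W * ?y\<^sup>2) \<le> D" using b[OF x, of n] Ru D(1) by linarith
    qed (use W0 in simp)
    have "C * (eigval n + 1) * (1 - x) \<le> D * (eigval n + 1) * (1 - x)"
      using D e x by (intro mult_right_mono) auto
    then have "R * (?W * ?y\<^sup>2) \<le> D * (eigval n + 1) * (1 - x)"
      using b[OF x, of n] Ru by linarith
    then have "?W * ?y\<^sup>2 \<le> D * (eigval n + 1) * (1 - x) / sqrt (1 - x)"
      by (rule div) (use W0 in simp)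
    also have "\<dots> = D * (eigval n + 1) * sqrt (1 - x)"
      using real_div_sqrt[of "1 - x"] x by (simp flip: times_divide_eq_right)
    finally show "?W * ?y\<^sup>2 \<le> D * (eigval n + 1) * sqrt (1 - x)" .
    have "R * (?W * (jacobi_p x * ?y1\<^sup>2)) = (amp x * (R * ?y1))\<^sup>2"
    proof -
      have aR: "(amp x)\<^sup>2 = ?W * R" using amp_square[OF xi] by (simp only: R_def)
      show ?thesis unfolding power_mult_distrib aR R(2) by (simp only: mult_ac)
    qed
    also have "amp x * (R * ?y1) = vv n x - kap x * uu n x / R"
      unfolding vv_def uu_def R_def[symmetric] by (simp add: algebra_simps)
    also have "(vv n x - kap x * uu n x / R)\<^sup>2 \<le> 2 * (vv n x)\<^sup>2 + 2 * (kap x * uu n x / R)\<^sup>2"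
      using zero_le_power2[of "vv n x + kap x * uu n x / R"] unfolding power2_sum power2_diff by linarith
    also have "(kap x * uu n x / R)\<^sup>2 = (kap x)\<^sup>2 * ((uu n x)\<^sup>2 / R\<^sup>2)" by (simp add: power_divide power_mult_distrib)
    also have "\<dots> \<le> K * (C * (eigval n + 1))"
    proof (intro mult_mono K)
      have "(uu n x)\<^sup>2 \<le> C * (eigval n + 1) * (1 - x)" using b[OF x, of n] by simp
      also have "\<dots> \<le> C * (eigval n + 1) * R\<^sup>2"
        using C e x x1 unfolding R(2)[symmetric] jacobi_p_eq by (intro mult_left_mono) (auto simp: mult_le_cancel_left1)
      finally show "(uu n x)\<^sup>2 / R\<^sup>2 \<le> C * (eigval n + 1)" using R by (simp add: pos_divide_le_eq)
    qed (use x x1 K0 in auto)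
    finally have "R * (?W * (jacobi_p x * ?y1\<^sup>2)) \<le> D * (eigval n + 1)"
      using b[OF x, of n] by (simp add: D_def algebra_simps)
    then show "?W * (jacobi_p x * ?y1\<^sup>2) \<le> D * (eigval n + 1) / sqrt (1 - x)"
      by (rule div) (use W0 R in simp)
  qed (use x1 D in auto)
qed

end

section \<open>Local mass at the endpoint\<close>

text \<open>Clamped at 1: for small t the spacing of the integers sets the scale of the
  kernel.\<close>

definition time_scale :: "real \<Rightarrow> real" where
  "time_scale t = max 1 (t powr (1 / 4))"

lemma time_scale_ge_1: "1 \<le> time_scale t"
  by (simp add: time_scale_def)

lemma time_scale_pow4: "1 \<le> t \<Longrightarrow> time_scale t ^ 4 = t"
proof -
  assume t: "1 \<le> t"
  then have "1 \<le> t powr (1 / 4)" by (simp add: ge_one_powr_ge_zero)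
  then show ?thesis using t by (simp add: time_scale_def max_def powr_power)
qed

lemma time_scale_le_1: "0 < t \<Longrightarrow> t \<le> 1 \<Longrightarrow> time_scale t = 1"
  using powr_le1[of "1 / 4" t] by (simp add: time_scale_def max_def)

text \<open>Localises to 1 - x of size N^-2, that is to \<theta> of size 1/N. The exponent 3 is at
  least 3/2 and 5/2, the two decay rates met in \<open>bell_le_density\<close>.\<close>

definition bell :: "real \<Rightarrow> real \<Rightarrow> real" where
  "bell N x = 1 / (1 + N\<^sup>2 * (1 - x)) ^ 3"

definition bell_primitive :: "real \<Rightarrow> real \<Rightarrow> real" where
  "bell_primitive N x = sqrt ((1 - x) / (1 + N\<^sup>2 * (1 - x)))"

text \<open>The exact derivative of -(2/m) times the m-th power of \<open>bell_primitive\<close>, so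
  that its integral is elementary. The cases m = 1 and m = 3 replace 1/sqrt(1 - x) and sqrt(1 - x),
  each localised at the scale N^-2.\<close>

definition bell_density :: "nat \<Rightarrow> real \<Rightarrow> real \<Rightarrow> real" where
  "bell_density m N x = bell_primitive N x ^ m / ((1 - x) * (1 + N\<^sup>2 * (1 - x)))"

lemma bell_density_nonneg: "x < 1 \<Longrightarrow> 0 \<le> bell_density m N x"
  unfolding bell_density_def bell_primitive_def by (intro divide_nonneg_nonneg mult_nonneg_nonneg zero_le_power) auto

lemma bell_denominator_pos: "x \<le> 1 \<Longrightarrow> 0 < 1 + N\<^sup>2 * (1 - (x::real))"
  by (intro add_pos_nonneg) auto

lemma bell_density_integral:
  assumes m: "1 \<le> m" and N: "1 \<le> N"
  shows "set_integrable lborel {-1<..<1} (bell_density m N)"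
    and "(LBINT x:{-1<..<1}. bell_density m N x) \<le> 2 / N ^ m"
proof -
  define S where "S = bell_primitive N"
  define F where "F x = - (2 / real m) * S x ^ m" for x
  have den: "0 < 1 + N\<^sup>2 * (1 - x)" if "x \<le> 1" for x by (rule bell_denominator_pos[OF that])
  have contS: "continuous_on {-1..1} S"
  proof -
    have "1 + N\<^sup>2 * (1 - x) \<noteq> 0" if "x \<in> {-1..1}" for x using den[of x] that by auto
    then show ?thesis unfolding S_def bell_primitive_def by (intro continuous_intros) auto
  qed
  have F': "(F has_real_derivative bell_density m N x) (at x)" if x: "-1 < x" "x < 1" for x
  proof -
    define z where "z = 1 + N\<^sup>2 * (1 - x)"
    have z: "0 < z" using den[of x] x by (simp add: z_def)
    have S0: "0 < S x" using x z by (simp add: S_def bell_primitive_def z_def)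
    have S2: "(S x)\<^sup>2 = (1 - x) / z" using x z by (simp add: S_def bell_primitive_def z_def)
    have "((\<lambda>x. (1 - x) / (1 + N\<^sup>2 * (1 - x))) has_real_derivative (- 1 * z - (1 - x) * (- N\<^sup>2)) / (z * z)) (at x)"
      using z by (auto intro!: derivative_eq_intros simp: z_def)
    also have "(- 1 * z - (1 - x) * (- N\<^sup>2)) / (z * z) = - 1 / z\<^sup>2"
      by (simp add: z_def power2_eq_square algebra_simps)
    finally have d: "((\<lambda>x. (1 - x) / (1 + N\<^sup>2 * (1 - x))) has_real_derivative - 1 / z\<^sup>2) (at x)" .
    have pos: "0 < (1 - x) / (1 + N\<^sup>2 * (1 - x))" using x z by (simp add: z_def)
    have dS: "(S has_real_derivative (- 1 / z\<^sup>2) * (inverse (S x) / 2)) (at x)"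
      unfolding S_def bell_primitive_def[abs_def]
      by (rule DERIV_cong[OF DERIV_chain2[OF DERIV_real_sqrt[OF pos] d]]) simp
    have "(F has_real_derivative - (2 / real m) * (real m * S x ^ (m - 1) * ((- 1 / z\<^sup>2) * (inverse (S x) / 2)))) (at x)"
      unfolding F_def[abs_def] using m by (auto intro!: derivative_eq_intros dS)
    also have "- (2 / real m) * (real m * S x ^ (m - 1) * ((- 1 / z\<^sup>2) * (inverse (S x) / 2))) = S x ^ (m - 1) / (S x * z\<^sup>2)"
      using m S0 z by (simp add: field_simps)
    also have "\<dots> = S x ^ m / ((S x)\<^sup>2 * z\<^sup>2)"
      using m S0 by (cases m) (simp_all add: power2_eq_square)
    also have "\<dots> = bell_density m N x"
      unfolding S2 bell_density_def z_def[symmetric] S_def[symmetric] using z by (simp add: power2_eq_square)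
    finally show ?thesis .
  qed
  have contF: "continuous_on {-1..1} F" unfolding F_def by (intro continuous_intros contS)
  have lim: "((F \<circ> real_of_ereal) \<longlongrightarrow> F (-1)) (at_right (ereal (-1)))" "((F \<circ> real_of_ereal) \<longlongrightarrow> F 1) (at_left (ereal 1))"
  proof -
    have "(F \<longlongrightarrow> F (-1)) (at (-1) within {-1..1})" "(F \<longlongrightarrow> F 1) (at 1 within {-1..1})"
      using contF by (auto simp: continuous_on_def)
    then have "(F \<longlongrightarrow> F (-1)) (at_right (-1))" "(F \<longlongrightarrow> F 1) (at_left 1)"
      by (simp_all add: at_within_Icc_at_right at_within_Icc_at_left)
    then show "((F \<circ> real_of_ereal) \<longlongrightarrow> F (-1)) (at_right (ereal (-1)))" "((F \<circ> real_of_ereal) \<longlongrightarrow> F 1) (at_left (ereal 1))"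
      by (simp_all only: ereal_tendsto_simps)
  qed
  have cont: "isCont (bell_density m N) x" if "-1 < x" "x < 1" for x
  proof -
    have "isCont S x" using that F' continuous_on_interior[OF contS, of x] by (simp add: interior_atLeastAtMost_real)
    then show ?thesis unfolding bell_density_def[abs_def] S_def[symmetric]
      using den[of x] that by (intro continuous_intros) auto
  qed
  \<comment> \<open>For m = 1 the density is unbounded at x = 1; because it is nonnegative,
    integrability and the value of the integral both follow from the one-sided limits of
    \<open>F\<close>.\<close>
  note ftc = interval_integral_FTC_nonneg[of "ereal (-1)" "ereal 1" F "bell_density m N" "F (-1)" "F 1"]
  have ftc': "set_integrable lborel (einterval (ereal (-1)) (ereal 1)) (bell_density m N)"
    "(LBINT x=ereal (-1)..ereal 1. bell_density m N x) = F 1 - F (-1)"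
    by (rule ftc; (rule lim)?; use F' cont in \<open>auto intro!: AE_I2 bell_density_nonneg\<close>)+
  then show "set_integrable lborel {-1<..<1} (bell_density m N)" by simp
  have "(LBINT x:{-1<..<1}. bell_density m N x) = F 1 - F (-1)"
    using ftc'(2) by (simp add: interval_lebesgue_integral_def)
  also have "\<dots> = 2 / real m * S (-1) ^ m"
    using m by (simp add: F_def S_def bell_primitive_def)
  also have "\<dots> \<le> 2 * (1 / N) ^ m"
  proof (intro mult_mono power_mono)
    have "2 / (1 + N\<^sup>2 * 2) \<le> 2 / (N\<^sup>2 * 2)"
      using N by (intro divide_left_mono mult_pos_pos add_pos_nonneg) auto
    also have "\<dots> = (1 / N)\<^sup>2" by (simp add: power_divide)
    finally have "2 / (1 + N\<^sup>2 * 2) \<le> (1 / N)\<^sup>2" .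
    then have "sqrt (2 / (1 + N\<^sup>2 * 2)) \<le> sqrt ((1 / N)\<^sup>2)" by (rule real_sqrt_le_mono)
    then show "S (-1) \<le> 1 / N" using N by (simp add: S_def bell_primitive_def)
    show "0 \<le> S (-1)" by (simp add: S_def bell_primitive_def)
    show "2 / real m \<le> 2" using m by (simp add: divide_le_eq)
  qed (auto simp: S_def bell_primitive_def)
  finally show "(LBINT x:{-1<..<1}. bell_density m N x) \<le> 2 / N ^ m" by (simp add: power_divide)
qed

lemma bell_le_density:
  assumes "x < 1"
  shows "bell N x / sqrt (1 - x) \<le> bell_density 1 N x" "sqrt (1 - x) * bell N x \<le> bell_density 3 N x"
proof -
  define z where "z = 1 + N\<^sup>2 * (1 - x)"
  define s where "s = sqrt (1 - x)"
  define r where "r = sqrt z"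
  have z: "1 \<le> z" using assms by (simp add: z_def)
  have s: "0 < s" "1 - x = s\<^sup>2" using assms by (auto simp: s_def)
  have r: "1 \<le> r" "z = r\<^sup>2" using z by (auto simp: r_def)
  have prim: "bell_primitive N x = s / r" by (simp add: bell_primitive_def z_def s_def r_def real_sqrt_divide)
  have "r ^ 3 \<le> r ^ 6" "r ^ 5 \<le> r ^ 6" using r by (auto intro!: power_increasing)
  then have le: "1 / r ^ 6 \<le> 1 / r ^ 3" "1 / r ^ 6 \<le> 1 / r ^ 5" using r by (auto intro!: divide_left_mono)
  have 1: "bell N x = 1 / r ^ 6" unfolding bell_def z_def[symmetric] r(2) by simp
  have dens: "bell_density m N x = (s / r) ^ m / (s\<^sup>2 * r\<^sup>2)" for m
    unfolding r(2)[symmetric] s(2)[symmetric] by (simp only: bell_density_def prim z_def)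
  have 2: "bell_density 1 N x = 1 / r ^ 3 / s"
    unfolding dens using s r by (simp add: power2_eq_square power3_eq_cube)
  have 3: "bell_density 3 N x = s * (1 / r ^ 5)"
    unfolding dens using s r by (simp add: power2_eq_square eval_nat_numeral)
  show "bell N x / sqrt (1 - x) \<le> bell_density 1 N x"
    unfolding 1 2 s_def[symmetric] using le s by (intro divide_right_mono) auto
  show "sqrt (1 - x) * bell N x \<le> bell_density 3 N x"
    unfolding 1 3 s_def[symmetric] using le s by (intro mult_left_mono) auto
qed

lemma bell_nonneg: "x \<le> 1 \<Longrightarrow> 0 \<le> bell N x"
  unfolding bell_def using bell_denominator_pos[of x N] by simp

lemma bell_le_1: "x \<le> 1 \<Longrightarrow> bell N x \<le> 1"
  unfolding bell_def using bell_denominator_pos[of x N] by (simp add: one_le_power)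

context jacobi
begin

lemma integrable_bell:
  assumes F: "continuous_on UNIV F"
  shows "integrable jm (\<lambda>x. F x * bell N x)"
proof (rule Bochner_Integration.integrable_bound[of jm F])
  show "integrable jm F" by (rule integrable_continuous[OF F])
  have [measurable]: "F \<in> borel_measurable borel" by (rule borel_measurable_continuous_onI[OF F])
  show "(\<lambda>x. F x * bell N x) \<in> borel_measurable jm" unfolding bell_def by measurable
  show "AE x in jm. norm (F x * bell N x) \<le> norm (F x)"
    using AE_jm
  proof eventually_elim
    case (elim x)
    then show ?case using bell_nonneg[of x N] bell_le_1[of x N] by (auto simp: abs_mult intro!: mult_left_le)
  qed
qed

text \<open>Left of x1, and so near x = -1 too, the bell is at most (1 - x1)^-3 N^-m and the total
  mass \<open>A\<close> is enough. Right of x1 the pointwise bound is integrated against the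
  explicit density.\<close>

lemma bell_mass_le:
  assumes F: "continuous_on UNIV F" "\<And>x. x \<in> {-1<..<1} \<Longrightarrow> 0 \<le> F x" and A: "integral\<^sup>L jm F \<le> A" "0 \<le> A"
    and m: "1 \<le> m" "m \<le> 3" and N: "1 \<le> N" and x1: "0 \<le> x1" "x1 < 1" and C: "0 \<le> C"
    and le: "\<And>x. x \<in> {x1..<1} \<Longrightarrow> jacobi_weight \<alpha> \<beta> x * F x * bell N x \<le> C * bell_density m N x"
  shows "(\<integral>x. F x * bell N x \<partial>jm) \<le> (A / (1 - x1) ^ 3 + 2 * C) / N ^ m"
proof -
  define d where "d = 1 / ((1 - x1) ^ 3 * N ^ m)"
  have d: "0 \<le> d" using x1 N by (simp add: d_def)
  have Fm: "F \<in> borel_measurable borel" by (rule borel_measurable_continuous_onI[OF F(1)])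
  have FBm: "(\<lambda>x. F x * bell N x) \<in> borel_measurable borel" using Fm unfolding bell_def by measurable
  have int1: "set_integrable lborel {-1<..<1} (\<lambda>x. F x * jacobi_weight \<alpha> \<beta> x)"
    using integrable_continuous[OF F(1)] by (simp add: jm_integrable_iff[OF Fm])
  note int2 = bell_density_integral[OF m(1) N]
  have "(\<integral>x. F x * bell N x \<partial>jm) = (LBINT x:{-1<..<1}. F x * bell N x * jacobi_weight \<alpha> \<beta> x)"
    by (rule jm_integral_eq[OF FBm])
  also have "\<dots> \<le> (LBINT x:{-1<..<1}. d * (F x * jacobi_weight \<alpha> \<beta> x) + C * bell_density m N x)"
  proof (rule set_integral_mono)
    show "set_integrable lborel {-1<..<1} (\<lambda>x. F x * bell N x * jacobi_weight \<alpha> \<beta> x)"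
      using integrable_bell[OF F(1), of N] by (simp add: jm_integrable_iff[OF FBm])
    show "set_integrable lborel {-1<..<1} (\<lambda>x. d * (F x * jacobi_weight \<alpha> \<beta> x) + C * bell_density m N x)"
      by (intro set_integral_add set_integrable_mult_right int1 int2)
    fix x :: real assume x: "x \<in> {-1<..<1}"
    have nn: "0 \<le> F x * jacobi_weight \<alpha> \<beta> x" using F(2)[OF x] jacobi_weight_nonneg[of x] by simp
    have bd: "0 \<le> bell_density m N x" using x by (intro bell_density_nonneg) auto
    show "F x * bell N x * jacobi_weight \<alpha> \<beta> x \<le> d * (F x * jacobi_weight \<alpha> \<beta> x) + C * bell_density m N x"
    proof (cases "x1 \<le> x")
      case True
      then show ?thesis using le[of x] x nn d by (simp add: mult_ac add_increasing)
    next
      case False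
      have "(1 - x1) ^ 3 * N ^ m \<le> (1 - x1) ^ 3 * N ^ 6" using x1 N m by (intro mult_left_mono power_increasing) auto
      also have "\<dots> = (N\<^sup>2 * (1 - x1)) ^ 3" by (simp add: power_mult_distrib)
      also have "\<dots> \<le> (1 + N\<^sup>2 * (1 - x)) ^ 3"
        using False x1 N by (intro power_mono add_increasing mult_left_mono) auto
      finally have "bell N x \<le> d"
        unfolding bell_def d_def using x1 N by (intro divide_left_mono mult_pos_pos) (auto intro!: bell_denominator_pos simp: x[simplified] less_imp_le)
      then have "bell N x * (F x * jacobi_weight \<alpha> \<beta> x) \<le> d * (F x * jacobi_weight \<alpha> \<beta> x)"
        using nn by (intro mult_right_mono)
      then show ?thesis using C bd by (simp add: mult_ac add_increasing2)
    qed
  qed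
  also have "\<dots> = d * (LBINT x:{-1<..<1}. F x * jacobi_weight \<alpha> \<beta> x) + C * (LBINT x:{-1<..<1}. bell_density m N x)"
    using int1 int2(1) by (subst set_integral_add(2)) (auto intro!: set_integrable_mult_right)
  also have "\<dots> \<le> d * A + C * (2 / N ^ m)"
    using d C A int2(2) by (intro add_mono mult_left_mono) (simp_all add: jm_integral_eq[OF Fm])
  also have "\<dots> = (A / (1 - x1) ^ 3 + 2 * C) / N ^ m" by (simp add: d_def add_divide_distrib)
  finally show ?thesis .
qed

text \<open>The second bound beats the first exactly when eigval n + 1 < N^2: the low
  eigenfunctions, multiplied by the root of the weight, are small on the scale of the bell.\<close>

lemma pn_bell_bounds:
  "\<exists>C>0. \<forall>n N. 1 \<le> N \<longrightarrow>
     (\<integral>x. (poly (pn n) x)\<^sup>2 * bell N x \<partial>jm) \<le> C / N \<and>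
     (\<integral>x. (poly (pn n) x)\<^sup>2 * bell N x \<partial>jm) \<le> C * (eigval n + 1) / N ^ 3 \<and>
     (\<integral>x. (jacobi_p x * (poly (pderiv (pn n)) x)\<^sup>2) * bell N x \<partial>jm) \<le> C * (eigval n + 1) / N"
proof -
  obtain x1 C where x1: "0 \<le> x1" "x1 < 1" and C: "0 < C"
    and b: "\<And>n x. x \<in> {x1..<1} \<Longrightarrow>
     jacobi_weight \<alpha> \<beta> x * (poly (pn n) x)\<^sup>2 \<le> C / sqrt (1 - x) \<and>
     jacobi_weight \<alpha> \<beta> x * (poly (pn n) x)\<^sup>2 \<le> C * (eigval n + 1) * sqrt (1 - x) \<and>
     jacobi_weight \<alpha> \<beta> x * (jacobi_p x * (poly (pderiv (pn n)) x)\<^sup>2) \<le> C * (eigval n + 1) / sqrt (1 - x)"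
    using pn_pointwise_bounds by blast
  define D where "D = 1 / (1 - x1) ^ 3 + 2 * C"
  have D: "0 < D" using x1 C by (simp add: D_def add_pos_pos)
  have step1: "a * bell N x \<le> c * bell_density 1 N x" if "a \<le> c / sqrt (1 - x)" "x < 1" "0 \<le> c" for a c N x
  proof -
    have "a * bell N x \<le> c / sqrt (1 - x) * bell N x" using that bell_nonneg[of x N] by (intro mult_right_mono) auto
    also have "\<dots> = c * (bell N x / sqrt (1 - x))" by simp
    also have "\<dots> \<le> c * bell_density 1 N x" using that bell_le_density[of x N] by (intro mult_left_mono) auto
    finally show ?thesis .
  qed
  have step3: "a * bell N x \<le> c * bell_density 3 N x" if "a \<le> c * sqrt (1 - x)" "x < 1" "0 \<le> c" for a c N x
  proof -
    have "a * bell N x \<le> c * sqrt (1 - x) * bell N x" using that bell_nonneg[of x N] by (intro mult_right_mono) auto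
    also have "\<dots> = c * (sqrt (1 - x) * bell N x)" by simp
    also have "\<dots> \<le> c * bell_density 3 N x" using that bell_le_density[of x N] by (intro mult_left_mono) auto
    finally show ?thesis .
  qed
  have c1: "continuous_on UNIV (\<lambda>x. (poly (pn n) x)\<^sup>2)" for n by (intro continuous_intros)
  have c2: "continuous_on UNIV (\<lambda>x. jacobi_p x * (poly (pderiv (pn n)) x)\<^sup>2)" for n
    unfolding jacobi_p_def by (intro continuous_intros)
  have n1: "(\<integral>x. (poly (pn n) x)\<^sup>2 \<partial>jm) \<le> 1" for n using pn_orthonormal(2)[of n n] by (simp add: power2_eq_square)
  show ?thesis
  proof (intro exI[of _ D] conjI allI impI D)
    fix n and N :: real assume N: "1 \<le> N"
    have e: "1 \<le> eigval n + 1" using eigval_nonneg[of n] by simp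
    have CE: "0 \<le> C * (eigval n + 1)" using C e by simp
    have "(\<integral>x. (poly (pn n) x)\<^sup>2 * bell N x \<partial>jm) \<le> (1 / (1 - x1) ^ 3 + 2 * C) / N ^ 1"
      by (rule bell_mass_le[OF c1 _ n1 _ _ _ N x1 _ step1]) (use b C in simp_all)
    then show "(\<integral>x. (poly (pn n) x)\<^sup>2 * bell N x \<partial>jm) \<le> D / N" by (simp add: D_def)
    have "(\<integral>x. (poly (pn n) x)\<^sup>2 * bell N x \<partial>jm) \<le> (1 / (1 - x1) ^ 3 + 2 * (C * (eigval n + 1))) / N ^ 3"
      by (rule bell_mass_le[OF c1 _ n1 _ _ _ N x1 _ step3]) (use b CE in simp_all)
    also have "\<dots> \<le> D * (eigval n + 1) / N ^ 3"
      using N x1 e by (intro divide_right_mono) (auto simp: D_def distrib_right intro!: mult_right_mono[of 1 "eigval n + 1" "1 / (1 - x1) ^ 3", simplified])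
    finally show "(\<integral>x. (poly (pn n) x)\<^sup>2 * bell N x \<partial>jm) \<le> D * (eigval n + 1) / N ^ 3" .
    have "(\<integral>x. (jacobi_p x * (poly (pderiv (pn n)) x)\<^sup>2) * bell N x \<partial>jm) \<le> ((eigval n + 1) / (1 - x1) ^ 3 + 2 * (C * (eigval n + 1))) / N ^ 1"
      by (rule bell_mass_le[OF c2 _ _ _ _ _ N x1 _ step1])
        (use b CE e jacobi_p_pos in \<open>simp_all add: pn_deriv_norm less_imp_le\<close>)
    then show "(\<integral>x. (jacobi_p x * (poly (pderiv (pn n)) x)\<^sup>2) * bell N x \<partial>jm) \<le> D * (eigval n + 1) / N"
      by (simp add: D_def algebra_simps)
  qed
qed

end

section \<open>Symbols and matrix coefficients\<close>

text \<open>For s > 1 the polynomial is compared with s^(2m), and y \<le> exp y at y = c s^2 / m,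
  raised to the power m, compares that with the exponential. The factor (1 + s)^4 provides the decay
  of symbols away from the endpoint.\<close>

lemma power_times_gaussian_bounded:
  fixes c :: real
  assumes c: "0 < c"
  shows "\<exists>B>0. \<forall>s\<ge>0. s ^ k * (1 + s) ^ 4 * exp (- (c * s\<^sup>2)) \<le> B"
proof -
  define m where "m = k + 4"
  have m0: "0 < real m" by (simp add: m_def)
  define B where "B = 2 ^ m * (1 + (real m / c) ^ m)"
  have B: "0 < B" using c by (auto simp: B_def intro!: mult_pos_pos add_pos_nonneg)
  have "s ^ k * (1 + s) ^ 4 * exp (- (c * s\<^sup>2)) \<le> B" if s: "0 \<le> s" for s
  proof -
    have "s ^ k * (1 + s) ^ 4 \<le> (1 + s) ^ k * (1 + s) ^ 4" using s by (intro mult_right_mono power_mono) auto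
    also have "\<dots> = (1 + s) ^ m" by (simp add: m_def power_add)
    also have "\<dots> \<le> B * exp (c * s\<^sup>2)"
    proof (cases "s \<le> 1")
      case True
      then have "(1 + s) ^ m \<le> 2 ^ m" using s by (intro power_mono) auto
      also have "\<dots> \<le> B * 1" using c by (simp add: B_def)
      also have "\<dots> \<le> B * exp (c * s\<^sup>2)" using B c by (intro mult_left_mono) auto
      finally show ?thesis .
    next
      case False
      have "(1 + s) ^ m \<le> (2 * s\<^sup>2) ^ m"
      proof (rule power_mono)
        have "s * 1 \<le> s * s" using False by (intro mult_left_mono) auto
        then show "1 + s \<le> 2 * s\<^sup>2" using False unfolding power2_eq_square by linarith
      qed (use s in auto)
      also have "\<dots> = 2 ^ m * (real m / c) ^ m * (c * s\<^sup>2 / real m) ^ m"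
      proof -
        have "2 * s\<^sup>2 = 2 * (real m / c) * (c * s\<^sup>2 / real m)" using c m0 by simp
        then show ?thesis by (simp only: power_mult_distrib)
      qed
      also have "\<dots> \<le> 2 ^ m * (real m / c) ^ m * exp (c * s\<^sup>2)"
      proof (intro mult_left_mono)
        have "c * s\<^sup>2 / real m \<le> exp (c * s\<^sup>2 / real m)"
          using exp_ge_add_one_self[of "c * s\<^sup>2 / real m"] by linarith
        then have "(c * s\<^sup>2 / real m) ^ m \<le> exp (c * s\<^sup>2 / real m) ^ m"
          using c by (intro power_mono) auto
        also have "\<dots> = exp (c * s\<^sup>2)" by (simp add: exp_of_nat_mult[symmetric] m_def)
        finally show "(c * s\<^sup>2 / real m) ^ m \<le> exp (c * s\<^sup>2)" .
      qed (use c in auto)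
      also have "\<dots> \<le> B * exp (c * s\<^sup>2)" using c by (intro mult_right_mono) (auto simp: B_def distrib_left)
      finally show ?thesis .
    qed
    finally show ?thesis by (simp add: exp_minus field_simps)
  qed
  then have le: "\<forall>s\<ge>0. s ^ k * (1 + s) ^ 4 * exp (- (c * s\<^sup>2)) \<le> B" by blast
  show ?thesis by (rule exI[of _ B], rule conjI[OF B le])
qed

section \<open>Symbols attached to the diffusion factor\<close>

text \<open>The derivative of \<open>Q\<close> is b with its zero at 1 split off. The quadratic
  lower bound for Q 1 - Q x is the one-sided comparison that turns the diffusion factor into a
  Gaussian in s = N^2 (1 - x).\<close>

locale jacobi_diffusion = jacobi +
  fixes b1 :: "real poly" and Q :: "real \<Rightarrow> real" and c0 :: real
  assumes c0: "0 < c0"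
    and Q_deriv: "\<And>x. (Q has_real_derivative (1 - x) * poly b1 x) (at x)"
    and Q_lower: "\<And>x. x \<in> {-1..1} \<Longrightarrow> c0 * (1 - x)\<^sup>2 \<le> Q 1 - Q x"
begin

definition gauss :: "real \<Rightarrow> real \<Rightarrow> real" where
  "gauss t x = exp (- ((Q 1 - Q x) * t))"

text \<open>With \<open>t \<sim> N^4\<close> and \<open>1 - x \<sim> N^-2\<close>, a member of \<open>symbol d\<close> has size \<open>N^d\<close>;
  differentiation raises the order by 2 and multiplication by \<open>1 - x\<close> lowers it by 2.\<close>

inductive symbol :: "nat \<Rightarrow> (real \<Rightarrow> real \<Rightarrow> real) \<Rightarrow> bool" where
  monomial: "4 * j \<le> d + 2 * k \<Longrightarrow> symbol d (\<lambda>t x. t ^ j * (1 - x) ^ k * poly r x * gauss t x)"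
| plus: "symbol d f \<Longrightarrow> symbol d h \<Longrightarrow> symbol d (\<lambda>t x. f t x + h t x)"

lemma DERIV_gauss: "(gauss t has_real_derivative t * (1 - x) * poly b1 x * gauss t x) (at x)"
  unfolding gauss_def[abs_def] by (auto intro!: derivative_eq_intros Q_deriv)

lemma symbol_gauss: "symbol 0 gauss"
  using symbol.monomial[of 0 0 0 1] by simp

lemma symbol_mono: "symbol d f \<Longrightarrow> d \<le> d' \<Longrightarrow> symbol d' f"
proof (induction rule: symbol.induct)
  case (monomial j d k r)
  then show ?case by (intro symbol.monomial) simp
next
  case (plus d f h)
  then show ?case by (intro symbol.plus) simp_all
qed

lemma symbol_poly: "symbol d f \<Longrightarrow> symbol d (\<lambda>t x. poly s x * f t x)"
proof (induction rule: symbol.induct)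
  case (monomial j d k r)
  then show ?case using symbol.monomial[of j d k "s * r"] by (simp add: mult_ac)
next
  case (plus d f h)
  then show ?case using symbol.plus[of d "\<lambda>t x. poly s x * f t x" "\<lambda>t x. poly s x * h t x"] by (simp add: distrib_left)
qed

lemma symbol_scale: "symbol d f \<Longrightarrow> symbol d (\<lambda>t x. c * f t x)"
  using symbol_poly[of d f "[:c:]"] by simp

lemma symbol_lower: "symbol (d + 2) f \<Longrightarrow> symbol d (\<lambda>t x. (1 - x) * f t x)"
proof (induction "d + 2" f rule: symbol.induct)
  case (monomial j k r)
  then show ?case using symbol.monomial[of j d "Suc k" r] by (simp add: mult_ac)
next
  case (plus f h)
  then show ?case using symbol.plus[of d "\<lambda>t x. (1 - x) * f t x" "\<lambda>t x. (1 - x) * h t x"] by (simp add: distrib_left)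
qed

lemma symbol_jacobi_p: "symbol (d + 2) f \<Longrightarrow> symbol d (\<lambda>t x. jacobi_p x * f t x)"
proof -
  assume "symbol (d + 2) f"
  then have "symbol d (\<lambda>t x. poly [:1, 1:] x * ((1 - x) * f t x))" by (intro symbol_poly symbol_lower)
  moreover have "(\<lambda>t x. poly [:1, 1:] x * ((1 - x) * f t x)) = (\<lambda>t x. jacobi_p x * f t x)"
    by (simp add: fun_eq_iff jacobi_p_eq)
  ultimately show ?thesis by simp
qed

lemma symbol_jacobi_q: "symbol d f \<Longrightarrow> symbol d (\<lambda>t x. jacobi_q \<alpha> \<beta> x * f t x)"
proof -
  assume "symbol d f"
  then have "symbol d (\<lambda>t x. poly [:\<beta> - \<alpha>, - (\<alpha> + \<beta> + 2):] x * f t x)" by (rule symbol_poly)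
  moreover have "poly [:\<beta> - \<alpha>, - (\<alpha> + \<beta> + 2):] x = jacobi_q \<alpha> \<beta> x" for x
    by (simp add: jacobi_q_def algebra_simps)
  ultimately show ?thesis by simp
qed

lemma symbol_time: "symbol d f \<Longrightarrow> symbol (d + 4) (\<lambda>t x. t * f t x)"
proof (induction rule: symbol.induct)
  case (monomial j d k r)
  then show ?case using symbol.monomial[of "Suc j" "d + 4" k r] by (simp add: mult_ac)
next
  case (plus d f h)
  then show ?case using symbol.plus[of "d + 4" "\<lambda>t x. t * f t x" "\<lambda>t x. t * h t x"] by (simp add: distrib_left)
qed

text \<open>Each term of the product rule costs at most order 2: either a power of 1 - x is lost, or
  the polynomial is differentiated at no cost, or the exponential yields t (1 - x), of order 4 -
  2.\<close>

lemma symbol_deriv: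
  "symbol d f \<Longrightarrow> \<exists>f'. symbol (d + 2) f' \<and> (\<forall>t x. (f t has_real_derivative f' t x) (at x))"
proof (induction rule: symbol.induct)
  case (monomial j d k r)
  let ?f1 = "\<lambda>t x. t ^ j * (1 - x) ^ (k - 1) * poly (smult (- real k) r) x * gauss t x"
  let ?f2 = "\<lambda>t x. t ^ j * (1 - x) ^ k * poly (pderiv r) x * gauss t x"
  let ?f3 = "\<lambda>t x. t ^ Suc j * (1 - x) ^ Suc k * poly (r * b1) x * gauss t x"
  have s1: "symbol (d + 2) ?f1"
  \<comment> \<open>For k = 0 the exponent k - 1 is truncated to 0, but the coefficient k vanishes
    as well, so the term is the zero symbol.\<close>
  proof (cases k)
    case 0
    then show ?thesis using symbol.monomial[of 0 "d + 2" 0 0] by simp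
  next
    case (Suc l)
    then show ?thesis using monomial by (intro symbol.monomial) simp
  qed
  have s2: "symbol (d + 2) ?f2" using monomial by (intro symbol.monomial) simp
  have s3: "symbol (d + 2) ?f3" using monomial by (intro symbol.monomial) simp
  have d: "((\<lambda>x. t ^ j * (1 - x) ^ k * poly r x * gauss t x) has_real_derivative ?f1 t x + ?f2 t x + ?f3 t x) (at x)" for t x
  proof -
    have product_rule: "(T * - (K * A) * R + R' * (T * B)) * G + t * X * b * G * (T * B * R)
        = T * A * (- K * R) * G + T * B * R' * G + t * T * (X * B) * (R * b) * G"
      for T K A R R' B G X b :: real by (simp add: algebra_simps)
    have "((\<lambda>x. (1 - x) ^ k) has_real_derivative - (real k * (1 - x) ^ (k - 1))) (at x)"
      by (auto intro!: derivative_eq_intros)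
    from DERIV_mult[OF DERIV_mult[OF DERIV_cmult[OF this, of "t ^ j"] poly_DERIV[of r x]] DERIV_gauss[of t x]]
    show ?thesis by (rule DERIV_cong) (unfold power_Suc poly_smult poly_mult, rule product_rule)
  qed
  show ?case
    by (intro exI[of _ "\<lambda>t x. ?f1 t x + ?f2 t x + ?f3 t x"] conjI allI d symbol.plus s1 s2 s3)
next
  case (plus d f h)
  obtain f' where f': "symbol (d + 2) f' \<and> (\<forall>t x. (f t has_real_derivative f' t x) (at x))"
    using plus.IH(1) by (rule exE)
  obtain h' where h': "symbol (d + 2) h' \<and> (\<forall>t x. (h t has_real_derivative h' t x) (at x))"
    using plus.IH(2) by (rule exE)
  have "((\<lambda>x. f t x + h t x) has_real_derivative f' t x + h' t x) (at x)" for t x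
    using f' h' by (intro DERIV_add) simp_all
  moreover have "symbol (d + 2) (\<lambda>t x. f' t x + h' t x)" using f' h' by (intro symbol.plus) simp_all
  ultimately show ?case by (intro exI[of _ "\<lambda>t x. f' t x + h' t x"] conjI allI)
qed

text \<open>For t \<ge> 1, t = N^4 and s = N^2 (1 - x) turn a monomial into N^(4j - 2k) s^k times at
  most exp(-c0 s^2), and 4j - 2k \<le> d. For t < 1 the scale is N = 1 and every factor is
  bounded.\<close>

lemma symbol_bound:
  "symbol d f \<Longrightarrow> \<exists>C>0. \<forall>t>0. \<forall>x\<in>{-1<..<1}. \<bar>f t x\<bar> \<le> C * time_scale t ^ d / (1 + (time_scale t)\<^sup>2 * (1 - x)) ^ 4"
proof (induction rule: symbol.induct)
  case (monomial j d k r)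
  have "bounded (poly r ` {-1..1})"
    by (intro compact_imp_bounded compact_continuous_image continuous_intros) auto
  then obtain R where R: "0 < R" "\<And>x. x \<in> {-1..1} \<Longrightarrow> \<bar>poly r x\<bar> \<le> R"
    unfolding bounded_pos real_norm_def by blast
  obtain B where B': "0 < B \<and> (\<forall>s\<ge>0. s ^ k * (1 + s) ^ 4 * exp (- (c0 * s\<^sup>2)) \<le> B)"
    using power_times_gaussian_bounded[OF c0, of k] by (rule exE)
  have B: "0 < B" "s ^ k * (1 + s) ^ 4 * exp (- (c0 * s\<^sup>2)) \<le> B" if "0 \<le> s" for s
    using B' that by auto
  have B0: "0 < B" using B' by simp
  define C where "C = R * (B + 2 ^ k * 3 ^ 4)"
  have C: "0 < C" unfolding C_def using R(1) B0 by (intro mult_pos_pos add_pos_pos) auto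
  have "\<bar>t ^ j * (1 - x) ^ k * poly r x * gauss t x\<bar> \<le> C * time_scale t ^ d / (1 + (time_scale t)\<^sup>2 * (1 - x)) ^ 4"
    if t: "0 < t" and x: "x \<in> {-1<..<1}" for t x
  proof -
    define N where "N = time_scale t"
    define s where "s = N\<^sup>2 * (1 - x)"
    have N: "1 \<le> N" unfolding N_def by (rule time_scale_ge_1)
    have s: "0 \<le> s" using x by (simp add: s_def)
    have g: "0 < gauss t x" "gauss t x \<le> exp (- (c0 * (1 - x)\<^sup>2 * t))"
      using Q_lower[of x] x t by (auto simp: gauss_def intro!: mult_right_mono)
    have key: "t ^ j * (1 - x) ^ k * gauss t x * (1 + s) ^ 4 \<le> (B + 2 ^ k * 3 ^ 4) * N ^ d"
    proof (cases "1 \<le> t")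
      case True
      have tN: "t = N ^ 4" using time_scale_pow4[OF True] by (simp add: N_def)
      have "t ^ j * (1 - x) ^ k = N ^ (4 * j) * (1 - x) ^ k" by (simp add: tN power_mult)
      also have "\<dots> \<le> N ^ (d + 2 * k) * (1 - x) ^ k"
        using N monomial x by (intro mult_right_mono power_increasing) auto
      also have "\<dots> = N ^ d * s ^ k" by (simp add: s_def power_add power_mult power_mult_distrib)
      finally have 1: "t ^ j * (1 - x) ^ k \<le> N ^ d * s ^ k" .
      have "c0 * (1 - x)\<^sup>2 * t = c0 * s\<^sup>2" by (simp add: tN s_def power_mult_distrib)
      then have "gauss t x \<le> exp (- (c0 * s\<^sup>2))" using g(2) by (simp only:)
      from mult_mono[OF 1 this] have "t ^ j * (1 - x) ^ k * gauss t x \<le> N ^ d * s ^ k * exp (- (c0 * s\<^sup>2))"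
        using g(1) N s by simp
      then have "t ^ j * (1 - x) ^ k * gauss t x * (1 + s) ^ 4 \<le> N ^ d * s ^ k * exp (- (c0 * s\<^sup>2)) * (1 + s) ^ 4"
        using s by (intro mult_right_mono) auto
      also have "\<dots> = N ^ d * (s ^ k * (1 + s) ^ 4 * exp (- (c0 * s\<^sup>2)))" by (simp add: mult_ac)
      also have "\<dots> \<le> N ^ d * (B + 2 ^ k * 3 ^ 4)" using N B(2)[of s, OF s] by (intro mult_left_mono add_increasing2) auto
      finally show ?thesis by (simp add: mult_ac)
    next
      case False
      then have N1: "N = 1" using t by (simp add: N_def time_scale_le_1)
      have "gauss t x \<le> 1" using g(2) c0 t by (rule_tac order_trans[OF g(2)]) simp
      moreover have "t ^ j \<le> 1" using t False by (intro power_le_one) auto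
      moreover have "(1 - x) ^ k \<le> 2 ^ k" using x by (intro power_mono) auto
      moreover have "(1 + s) ^ 4 \<le> 3 ^ 4" using x by (intro power_mono) (auto simp: s_def N1)
      ultimately have "t ^ j * (1 - x) ^ k * gauss t x * (1 + s) ^ 4 \<le> 1 * 2 ^ k * 1 * 3 ^ 4"
        using t x g(1) s by (intro mult_mono) (auto intro!: mult_nonneg_nonneg)
      then show ?thesis using B0 by (simp add: N1)
    qed
    have "\<bar>t ^ j * (1 - x) ^ k * poly r x * gauss t x\<bar> * (1 + s) ^ 4 = \<bar>poly r x\<bar> * (t ^ j * (1 - x) ^ k * gauss t x * (1 + s) ^ 4)"
      using t x g by (simp add: abs_mult mult_ac)
    also have "\<dots> \<le> R * ((B + 2 ^ k * 3 ^ 4) * N ^ d)"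
    proof (rule mult_mono[OF _ key])
      show "0 \<le> t ^ j * (1 - x) ^ k * gauss t x * (1 + s) ^ 4"
        using x t g(1) s by (intro mult_nonneg_nonneg) auto
    qed (use R(2)[of x] R(1) x in auto)
    finally have "\<bar>t ^ j * (1 - x) ^ k * poly r x * gauss t x\<bar> * (1 + s) ^ 4 \<le> C * N ^ d" by (simp add: C_def mult_ac)
    then show ?thesis using s unfolding N_def[symmetric] s_def[symmetric]
      by (simp add: pos_le_divide_eq)
  qed
  then show ?case using C by blast
next
  case (plus d f h)
  then obtain C C' where "0 < C" "0 < C'" and
    C: "\<forall>t>0. \<forall>x\<in>{-1<..<1}. \<bar>f t x\<bar> \<le> C * time_scale t ^ d / (1 + (time_scale t)\<^sup>2 * (1 - x)) ^ 4"
    "\<forall>t>0. \<forall>x\<in>{-1<..<1}. \<bar>h t x\<bar> \<le> C' * time_scale t ^ d / (1 + (time_scale t)\<^sup>2 * (1 - x)) ^ 4" by blast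
  have "\<bar>f t x + h t x\<bar> \<le> (C + C') * time_scale t ^ d / (1 + (time_scale t)\<^sup>2 * (1 - x)) ^ 4"
    if tx: "0 < t" "x \<in> {-1<..<1}" for t x
  proof -
    have "\<bar>f t x + h t x\<bar> \<le> C * time_scale t ^ d / (1 + (time_scale t)\<^sup>2 * (1 - x)) ^ 4 + C' * time_scale t ^ d / (1 + (time_scale t)\<^sup>2 * (1 - x)) ^ 4"
      using C(1)[rule_format, OF tx] C(2)[rule_format, OF tx] by (intro order_trans[OF abs_triangle_ineq] add_mono)
    then show ?thesis by (simp add: distrib_right add_divide_distrib)
  qed
  then show ?case using \<open>0 < C\<close> \<open>0 < C'\<close> by (intro exI[of _ "C + C'"]) auto
qed

text \<open>Symbols decay like the fourth power while the bell has the third: the spare power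
  absorbs sqrt(p) N, so a factor sqrt(p) is worth 1/N.\<close>

lemma symbol_bound_bell:
  assumes "symbol d f"
  shows "\<exists>C>0. \<forall>t x. 0 < t \<longrightarrow> x \<in> {-1<..<1} \<longrightarrow>
    \<bar>f t x\<bar> \<le> C * time_scale t ^ d * bell (time_scale t) x \<and>
    sqrt (jacobi_p x) * \<bar>f t x\<bar> * time_scale t \<le> C * time_scale t ^ d * bell (time_scale t) x"
proof -
  obtain C where C: "0 < C" "\<And>t x. 0 < t \<Longrightarrow> x \<in> {-1<..<1} \<Longrightarrow> \<bar>f t x\<bar> \<le> C * time_scale t ^ d / (1 + (time_scale t)\<^sup>2 * (1 - x)) ^ 4"
    using symbol_bound[OF assms] by blast
  show ?thesis
  proof (rule exI[of _ "2 * C"], intro conjI allI impI)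
    fix t x :: real assume t: "0 < t" and x: "x \<in> {-1<..<1}"
    define N where "N = time_scale t"
    have N: "1 \<le> N" unfolding N_def by (rule time_scale_ge_1)
    define z where "z = 1 + N\<^sup>2 * (1 - x)"
    have z: "1 \<le> z" using x by (simp add: z_def)
    have bell: "bell N x = 1 / z ^ 3" by (simp add: bell_def z_def)
    have f: "\<bar>f t x\<bar> \<le> C * N ^ d / z ^ 4" using C(2)[OF t x] by (simp add: N_def z_def)
    have CN: "0 \<le> C * N ^ d" using C N by simp
    have "C * N ^ d / z ^ 4 \<le> C * N ^ d / z ^ 3"
      using z CN by (intro divide_left_mono power_increasing) auto
    also have "\<dots> \<le> 2 * C * N ^ d / z ^ 3" using z CN by (intro divide_right_mono) auto
    finally show "\<bar>f t x\<bar> \<le> 2 * C * time_scale t ^ d * bell (time_scale t) x"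
      using f unfolding N_def[symmetric] bell by simp
    have "sqrt (jacobi_p x) * N \<le> 2 * z"
    proof -
      have "sqrt (jacobi_p x) * N = sqrt (jacobi_p x * N\<^sup>2)" using N by (simp add: real_sqrt_mult)
      also have "jacobi_p x * N\<^sup>2 \<le> (2 * z)\<^sup>2"
      proof -
        have "jacobi_p x * N\<^sup>2 = (1 + x) * (z - 1)" by (simp add: jacobi_p_eq z_def algebra_simps)
        also have "\<dots> \<le> 2 * z" using x z by (intro mult_mono) auto
        also have "\<dots> \<le> (2 * z) * (2 * z)" using z by (simp add: mult_le_cancel_left1)
        finally show ?thesis by (simp add: power2_eq_square)
      qed
      finally have "sqrt (jacobi_p x) * N \<le> sqrt ((2 * z)\<^sup>2)" by simp
      also have "\<dots> = 2 * z" using z by (subst real_sqrt_abs) simp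
      finally show ?thesis .
    qed
    then have "sqrt (jacobi_p x) * N * \<bar>f t x\<bar> \<le> 2 * z * (C * N ^ d / z ^ 4)"
      by (rule mult_mono) (use f z in auto)
    also have "\<dots> = 2 * C * N ^ d / z ^ 3" using z by (simp add: eval_nat_numeral)
    finally show "sqrt (jacobi_p x) * \<bar>f t x\<bar> * time_scale t \<le> 2 * C * time_scale t ^ d * bell (time_scale t) x"
      unfolding N_def[symmetric] bell by (simp add: mult_ac)
  qed (use C in auto)
qed

lemma symbol_continuous: "symbol d f \<Longrightarrow> continuous_on UNIV (f t)"
proof -
  assume "symbol d f"
  then obtain f' where "\<forall>t x. (f t has_real_derivative f' t x) (at x)" using symbol_deriv[of d f] by blast
  then show ?thesis by (auto intro!: continuous_at_imp_continuous_on DERIV_isCont)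
qed


section \<open>Matrix coefficients in the Jacobi basis\<close>

definition matrix_coeff :: "(real \<Rightarrow> real) \<Rightarrow> nat \<Rightarrow> nat \<Rightarrow> real" where
  "matrix_coeff h n m = (\<integral>x. h x * poly (pn n) x * poly (pn m) x \<partial>jm)"

lemma matrix_coeff_commute: "matrix_coeff h n m = matrix_coeff h m n"
  unfolding matrix_coeff_def by (simp only: mult.assoc mult.commute[of "poly (pn n) _"])

text \<open>Cauchy-Schwarz by way of the arithmetic-geometric mean with the weights B/A and A/B. The
  separate \<open>F\<close> and \<open>G\<close> allow the square of sqrt(p) y' to be replaced by p
  y'^2, from which it differs where p < 0.\<close>

lemma bell_integral_AM_GM:
  assumes cont: "continuous_on UNIV f" "continuous_on UNIV g" "continuous_on UNIV F" "continuous_on UNIV G"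
    and F: "\<And>x. x \<in> {-1<..<1} \<Longrightarrow> (f x)\<^sup>2 = F x" "(\<integral>x. F x * bell N x \<partial>jm) \<le> A\<^sup>2"
    and G: "\<And>x. x \<in> {-1<..<1} \<Longrightarrow> (g x)\<^sup>2 = G x" "(\<integral>x. G x * bell N x \<partial>jm) \<le> B\<^sup>2"
    and AB: "0 < A" "0 < B"
  shows "(\<integral>x. \<bar>f x * g x\<bar> * bell N x \<partial>jm) \<le> A * B"
proof -
  have int: "integrable jm (\<lambda>x. F x * bell N x)" "integrable jm (\<lambda>x. G x * bell N x)"
    "integrable jm (\<lambda>x. \<bar>f x * g x\<bar> * bell N x)"
    by (intro integrable_bell cont continuous_intros)+
  have "(\<integral>x. \<bar>f x * g x\<bar> * bell N x \<partial>jm) \<le> (\<integral>x. (B / A) / 2 * (F x * bell N x) + (A / B) / 2 * (G x * bell N x) \<partial>jm)"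
  proof (intro jm_integral_mono int Bochner_Integration.integrable_add integrable_mult_right)
    fix x :: real assume x: "x \<in> {-1<..<1}"
    have h: "0 \<le> bell N x" using x by (intro bell_nonneg) simp
    have "0 \<le> (\<bar>f x\<bar> * B - \<bar>g x\<bar> * A)\<^sup>2" by simp
    then have "2 * (\<bar>f x\<bar> * \<bar>g x\<bar>) * (A * B) \<le> (f x)\<^sup>2 * B\<^sup>2 + (g x)\<^sup>2 * A\<^sup>2"
      by (simp add: power2_diff power_mult_distrib algebra_simps)
    then have "\<bar>f x * g x\<bar> \<le> (B / A) / 2 * (f x)\<^sup>2 + (A / B) / 2 * (g x)\<^sup>2"
      using AB by (simp add: abs_mult field_simps power2_eq_square)
    from mult_right_mono[OF this h] F(1)[OF x] G(1)[OF x]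
    show "\<bar>f x * g x\<bar> * bell N x \<le> (B / A) / 2 * (F x * bell N x) + (A / B) / 2 * (G x * bell N x)"
      by (simp add: distrib_right mult.assoc)
  qed
  also have "\<dots> = (B / A) / 2 * (\<integral>x. F x * bell N x \<partial>jm) + (A / B) / 2 * (\<integral>x. G x * bell N x \<partial>jm)"
    using int by simp
  also have "\<dots> \<le> (B / A) / 2 * A\<^sup>2 + (A / B) / 2 * B\<^sup>2"
    using F G AB by (intro add_mono mult_left_mono) auto
  also have "\<dots> = A * B" using AB by (simp add: power2_eq_square field_simps)
  finally show ?thesis .
qed

text \<open>Comparable with n + 1; the shift inside the root keeps it at least 1, so that it may be
  divided by.\<close>

definition freq :: "nat \<Rightarrow> real" where
  "freq n = sqrt (eigval n + 1)"

lemma freq_square: "(freq n)\<^sup>2 = eigval n + 1"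
  using eigval_nonneg[of n] by (simp add: freq_def)

lemma freq_ge_1: "1 \<le> freq n"
  using eigval_nonneg[of n] by (simp add: freq_def)

text \<open>In the proof, the square of \<open>S n\<close> is the better of the mass bounds C/N and
  C (freq n)^2 / N^3. Pairing two such roots produces the gain for both indices
  simultaneously.\<close>

lemma pn_product_bell:
  "\<exists>C>0. \<forall>n m N. 1 \<le> N \<longrightarrow>
     (\<integral>x. \<bar>poly (pn n) x * poly (pn m) x\<bar> * bell N x \<partial>jm) \<le> C / N * min 1 (freq n / N) * min 1 (freq m / N) \<and>
     (\<integral>x. \<bar>(sqrt (jacobi_p x) * poly (pderiv (pn n)) x) * poly (pn m) x\<bar> * bell N x \<partial>jm) \<le> C * freq n / N"
proof -
  obtain C where C: "0 < C" and b: "\<And>n N. 1 \<le> N \<Longrightarrow>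
     (\<integral>x. (poly (pn n) x)\<^sup>2 * bell N x \<partial>jm) \<le> C / N \<and>
     (\<integral>x. (poly (pn n) x)\<^sup>2 * bell N x \<partial>jm) \<le> C * (eigval n + 1) / N ^ 3 \<and>
     (\<integral>x. (jacobi_p x * (poly (pderiv (pn n)) x)\<^sup>2) * bell N x \<partial>jm) \<le> C * (eigval n + 1) / N"
    using pn_bell_bounds by blast
  have c1: "continuous_on UNIV (poly (pn n))" "continuous_on UNIV (\<lambda>x. (poly (pn n) x)\<^sup>2)" for n
    by (intro continuous_intros)+
  have c2: "continuous_on UNIV (\<lambda>x. sqrt (jacobi_p x) * poly (pderiv (pn n)) x)"
     "continuous_on UNIV (\<lambda>x. jacobi_p x * (poly (pderiv (pn n)) x)\<^sup>2)" for n
    unfolding jacobi_p_def by (intro continuous_intros)+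
  show ?thesis
  proof (rule exI[of _ C], rule conjI[OF C], intro allI impI conjI)
    fix n m :: nat and N :: real assume N: "1 \<le> N"
    define S where "S n = sqrt (C / N) * min 1 (freq n / N)" for n
    have sq: "0 < sqrt (C / N)" "(sqrt (C / N))\<^sup>2 = C / N" using C N by simp_all
    have S: "0 < S n" for n using sq N freq_ge_1[of n] by (simp add: S_def)
    have S2: "(\<integral>x. (poly (pn n) x)\<^sup>2 * bell N x \<partial>jm) \<le> (S n)\<^sup>2" for n
    proof (cases "1 \<le> freq n / N")
      case True
      then have "(S n)\<^sup>2 = C / N" using sq by (simp add: S_def)
      then show ?thesis using b[OF N, of n] by simp
    next
      case False
      then have "(S n)\<^sup>2 = C / N * ((eigval n + 1) / N\<^sup>2)"
        using sq by (simp add: S_def power_mult_distrib power_divide freq_square)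
      also have "\<dots> = C * (eigval n + 1) / N ^ 3" by (simp add: power2_eq_square power3_eq_cube)
      finally show ?thesis using b[OF N, of n] by simp
    qed
    have "(\<integral>x. \<bar>poly (pn n) x * poly (pn m) x\<bar> * bell N x \<partial>jm) \<le> S n * S m"
      by (rule bell_integral_AM_GM[OF c1(1) c1(1) c1(2) c1(2) refl S2 refl S2 S S])
    also have "S n * S m = (sqrt (C / N))\<^sup>2 * min 1 (freq n / N) * min 1 (freq m / N)"
      unfolding S_def power2_eq_square by (simp only: mult_ac)
    finally show "(\<integral>x. \<bar>poly (pn n) x * poly (pn m) x\<bar> * bell N x \<partial>jm) \<le> C / N * min 1 (freq n / N) * min 1 (freq m / N)"
      unfolding sq(2) .
    have "(\<integral>x. \<bar>(sqrt (jacobi_p x) * poly (pderiv (pn n)) x) * poly (pn m) x\<bar> * bell N x \<partial>jm)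
        \<le> (sqrt (C / N) * freq n) * sqrt (C / N)"
    proof (rule bell_integral_AM_GM[OF c2(1) c1(1) c2(2) c1(2)])
      show "(sqrt (jacobi_p x) * poly (pderiv (pn n)) x)\<^sup>2 = jacobi_p x * (poly (pderiv (pn n)) x)\<^sup>2"
        if "x \<in> {-1<..<1}" for x using jacobi_p_pos[OF that] by (simp add: power_mult_distrib)
      show "(\<integral>x. jacobi_p x * (poly (pderiv (pn n)) x)\<^sup>2 * bell N x \<partial>jm) \<le> (sqrt (C / N) * freq n)\<^sup>2"
        using b[OF N, of n] unfolding power_mult_distrib sq(2) freq_square by simp
      show "(\<integral>x. (poly (pn m) x)\<^sup>2 * bell N x \<partial>jm) \<le> (sqrt (C / N))\<^sup>2"
        using b[OF N, of m] unfolding sq(2) by simp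
      show "0 < sqrt (C / N) * freq n" using sq(1) freq_ge_1[of n] by (intro mult_pos_pos) auto
    qed (use sq in auto)
    also have "(sqrt (C / N) * freq n) * sqrt (C / N) = (sqrt (C / N))\<^sup>2 * freq n" by (simp only: power2_eq_square mult_ac)
    also have "\<dots> = C * freq n / N" unfolding sq(2) by simp
    finally show "(\<integral>x. \<bar>(sqrt (jacobi_p x) * poly (pderiv (pn n)) x) * poly (pn m) x\<bar> * bell N x \<partial>jm) \<le> C * freq n / N" .
  qed
qed

lemma matrix_coeff_direct:
  assumes "symbol d h"
  shows "\<exists>C>0. \<forall>t>0. \<forall>n m. \<bar>matrix_coeff (h t) n m\<bar>
    \<le> C * time_scale t ^ d / time_scale t * min 1 (freq n / time_scale t) * min 1 (freq m / time_scale t)"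
proof -
  obtain C where C: "0 < C" "\<And>t x. 0 < t \<Longrightarrow> x \<in> {-1<..<1} \<Longrightarrow> \<bar>h t x\<bar> \<le> C * time_scale t ^ d * bell (time_scale t) x"
    using symbol_bound_bell[OF assms] by metis
  obtain D where D: "0 < D" "\<And>n m N. 1 \<le> N \<Longrightarrow>
     (\<integral>x. \<bar>poly (pn n) x * poly (pn m) x\<bar> * bell N x \<partial>jm) \<le> D / N * min 1 (freq n / N) * min 1 (freq m / N)"
    using pn_product_bell by metis
  show ?thesis
  proof (rule exI[of _ "C * D"], rule conjI, simp add: C D, intro allI impI)
    fix t :: real and n m assume t: "0 < t"
    have c: "continuous_on UNIV (h t)" by (rule symbol_continuous[OF assms])
    have "\<bar>matrix_coeff (h t) n m\<bar> \<le> (\<integral>x. \<bar>h t x * poly (pn n) x * poly (pn m) x\<bar> \<partial>jm)"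
      unfolding matrix_coeff_def by (rule integral_abs_bound)
    also have "\<dots> \<le> (\<integral>x. C * time_scale t ^ d * (\<bar>poly (pn n) x * poly (pn m) x\<bar> * bell (time_scale t) x) \<partial>jm)"
    proof (rule jm_integral_mono)
      show "integrable jm (\<lambda>x. \<bar>h t x * poly (pn n) x * poly (pn m) x\<bar>)"
        by (intro integrable_continuous continuous_intros c)
      show "integrable jm (\<lambda>x. C * time_scale t ^ d * (\<bar>poly (pn n) x * poly (pn m) x\<bar> * bell (time_scale t) x))"
        by (intro integrable_mult_right integrable_bell continuous_intros)
      fix x :: real assume x: "x \<in> {-1<..<1}"
      have "\<bar>h t x\<bar> * \<bar>poly (pn n) x * poly (pn m) x\<bar> \<le> C * time_scale t ^ d * bell (time_scale t) x * \<bar>poly (pn n) x * poly (pn m) x\<bar>"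
        using C(2)[OF t x] by (intro mult_right_mono) auto
      then show "\<bar>h t x * poly (pn n) x * poly (pn m) x\<bar> \<le> C * time_scale t ^ d * (\<bar>poly (pn n) x * poly (pn m) x\<bar> * bell (time_scale t) x)"
        by (simp only: abs_mult mult_ac)
    qed
    also have "\<dots> = C * time_scale t ^ d * (\<integral>x. \<bar>poly (pn n) x * poly (pn m) x\<bar> * bell (time_scale t) x \<partial>jm)" by simp
    also have "\<dots> \<le> C * time_scale t ^ d * (D / time_scale t * min 1 (freq n / time_scale t) * min 1 (freq m / time_scale t))"
      using C D(2)[OF time_scale_ge_1, of n m t] time_scale_ge_1[of t] by (intro mult_left_mono) auto
    finally show "\<bar>matrix_coeff (h t) n m\<bar> \<le> C * D * time_scale t ^ d / time_scale t * min 1 (freq n / time_scale t) * min 1 (freq m / time_scale t)"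
      by (simp only: mult_ac times_divide_eq_left times_divide_eq_right)
  qed
qed

section \<open>Double commutator with the Jacobi operator\<close>

text \<open>Here p1 and p2 stand for p' and p'', s for -q', and y with its derivatives for an
  eigenfunction. The difference of the two sides is a combination of the residuals of the equation
  and of its derivative, with the coefficients displayed in the proof. This eliminates y'' and y''',
  leaving only y and y', whose local masses are under control.\<close>

lemma commutator_identity:
  fixes p q y y1 y2 y3 p1 p2 s lam h1 h2 h3 H H1 H2 :: real
  assumes ode: "p * y2 = - q * y1 - lam * y" and ode': "p * y3 = - p1 * y2 - q * y2 + s * y1 - lam * y1"
  shows "p * (2 * (p2 * h1 + 2 * p1 * h2 + p * h3) * y1 + 4 * (p1 * h1 + p * h2) * y2 + 2 * p * h1 * y3 + H2 * y + 2 * H1 * y1 + H * y2)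
      + q * (2 * (p1 * h1 + p * h2) * y1 + 2 * p * h1 * y2 + H1 * y + H * y1)
      + lam * (2 * p * h1 * y1 + H * y)
    = (p * H2 + q * H1) * y - lam * (4 * p * h2 + 2 * p1 * h1) * y
      + p * (2 * (p2 * h1 + 2 * p1 * h2 + p * h3) - 2 * q * h2 + 2 * s * h1 + 2 * H1) * y1"
proof -
  have "p * (2 * (p2 * h1 + 2 * p1 * h2 + p * h3) * y1 + 4 * (p1 * h1 + p * h2) * y2 + 2 * p * h1 * y3 + H2 * y + 2 * H1 * y1 + H * y2)
      + q * (2 * (p1 * h1 + p * h2) * y1 + 2 * p * h1 * y2 + H1 * y + H * y1)
      + lam * (2 * p * h1 * y1 + H * y)
    - ((p * H2 + q * H1) * y - lam * (4 * p * h2 + 2 * p1 * h1) * y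
      + p * (2 * (p2 * h1 + 2 * p1 * h2 + p * h3) - 2 * q * h2 + 2 * s * h1 + 2 * H1) * y1)
    = (4 * (p1 * h1 + p * h2) + H + 2 * q * h1) * (p * y2 - (- q * y1 - lam * y))
      + 2 * p * h1 * (p * y3 - (- p1 * y2 - q * y2 + s * y1 - lam * y1))
      - (2 * p1 * h1 + 2 * q * h1) * (p * y2 - (- q * y1 - lam * y))"
    by (simp add: algebra_simps)
  also have "\<dots> = 0" unfolding ode ode' by simp
  finally show ?thesis by simp
qed

lemma pn_ode_deriv:
  "jacobi_p x * poly (pderiv (pderiv (pderiv (pn n)))) x
    = 2 * x * poly (pderiv (pderiv (pn n))) x - jacobi_q \<alpha> \<beta> x * poly (pderiv (pderiv (pn n))) x
      + (\<alpha> + \<beta> + 2) * poly (pderiv (pn n)) x - eigval n * poly (pderiv (pn n)) x"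
proof -
  let ?y1 = "poly (pderiv (pn n))" and ?y2 = "poly (pderiv (pderiv (pn n)))"
    and ?y3 = "poly (pderiv (pderiv (pderiv (pn n))))"
  have dq: "(jacobi_q \<alpha> \<beta> has_real_derivative - (\<alpha> + \<beta> + 2)) (at x)"
    unfolding jacobi_q_def[abs_def] by (auto intro!: derivative_eq_intros)
  have "((\<lambda>x. jacobi_p x * ?y2 x + jacobi_q \<alpha> \<beta> x * ?y1 x) has_real_derivative
     ((- 2 * x) * ?y2 x + ?y3 x * jacobi_p x) + (- (\<alpha> + \<beta> + 2) * ?y1 x + ?y2 x * jacobi_q \<alpha> \<beta> x)) (at x)"
    by (rule DERIV_add[OF DERIV_mult[OF DERIV_jacobi_p poly_DERIV] DERIV_mult[OF dq poly_DERIV]])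
  moreover have "((\<lambda>x. jacobi_p x * ?y2 x + jacobi_q \<alpha> \<beta> x * ?y1 x) has_real_derivative - eigval n * ?y1 x) (at x)"
    unfolding pn_ode by (rule DERIV_cmult[OF poly_DERIV])
  ultimately have "((- 2 * x) * ?y2 x + ?y3 x * jacobi_p x) + (- (\<alpha> + \<beta> + 2) * ?y1 x + ?y2 x * jacobi_q \<alpha> \<beta> x)
     = - eigval n * ?y1 x" by (rule DERIV_unique)
  then show ?thesis by (simp add: algebra_simps)
qed

text \<open>Let F be the commutator of the operator T with multiplication by h, applied to y.
  Symmetry of T gives <F, z> = (eigval n - eigval m) <h y, z>; the same argument with F gives <(T +
  eigval n) F, z> = (eigval n - eigval m) <F, z>. The elimination identity rewrites (T + eigval n)
  F.\<close>

lemma double_commutator: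
  fixes h h1 h2 h3 H H1 H2 :: "real \<Rightarrow> real"
  assumes h: "\<And>x. (h has_real_derivative h1 x) (at x)" "\<And>x. (h1 has_real_derivative h2 x) (at x)"
      "\<And>x. (h2 has_real_derivative h3 x) (at x)" and h3: "continuous_on UNIV h3"
    and H: "\<And>x. H x = jacobi_p x * h2 x + jacobi_q \<alpha> \<beta> x * h1 x"
      "\<And>x. (H has_real_derivative H1 x) (at x)" "\<And>x. (H1 has_real_derivative H2 x) (at x)" and H2: "continuous_on UNIV H2"
  shows "(eigval n - eigval m)\<^sup>2 * matrix_coeff h n m = (\<integral>x.
      ((jacobi_p x * H2 x + jacobi_q \<alpha> \<beta> x * H1 x) * poly (pn n) x
       - eigval n * (4 * jacobi_p x * h2 x - 4 * x * h1 x) * poly (pn n) x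
       + jacobi_p x * (2 * (- 2 * h1 x - 4 * x * h2 x + jacobi_p x * h3 x)
          - 2 * jacobi_q \<alpha> \<beta> x * h2 x + 2 * (\<alpha> + \<beta> + 2) * h1 x + 2 * H1 x) * poly (pderiv (pn n)) x)
      * poly (pn m) x \<partial>jm)"
proof -
  let ?p = jacobi_p and ?q = "jacobi_q \<alpha> \<beta>"
  let ?y = "poly (pn n)" and ?y1 = "poly (pderiv (pn n))" and ?y2 = "poly (pderiv (pderiv (pn n)))"
    and ?y3 = "poly (pderiv (pderiv (pderiv (pn n))))"
  let ?z = "poly (pn m)" and ?z1 = "poly (pderiv (pn m))" and ?z2 = "poly (pderiv (pderiv (pn m)))"
  have ch: "continuous_on UNIV h" "continuous_on UNIV h1" "continuous_on UNIV h2" "continuous_on UNIV H" "continuous_on UNIV H1"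
    by (meson DERIV_isCont continuous_at_imp_continuous_on h H)+
  have cpq: "continuous_on UNIV ?p" "continuous_on UNIV ?q"
    unfolding jacobi_p_def[abs_def] jacobi_q_def[abs_def] by (intro continuous_intros)+
  note cont = ch h3 H2 cpq
  define F where "F x = 2 * ?p x * h1 x * ?y1 x + H x * ?y x" for x
  define F1 where "F1 x = 2 * (- 2 * x * h1 x + ?p x * h2 x) * ?y1 x + 2 * ?p x * h1 x * ?y2 x + H1 x * ?y x + H x * ?y1 x" for x
  define F2 where "F2 x = 2 * (- 2 * h1 x + 2 * (- 2 * x) * h2 x + ?p x * h3 x) * ?y1 x + 4 * (- 2 * x * h1 x + ?p x * h2 x) * ?y2 x
     + 2 * ?p x * h1 x * ?y3 x + H2 x * ?y x + 2 * H1 x * ?y1 x + H x * ?y2 x" for x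
  have cF: "continuous_on UNIV F" "continuous_on UNIV F1" "continuous_on UNIV F2"
    unfolding F_def F1_def F2_def by (intro continuous_intros cont)+
  have dF: "(F has_real_derivative F1 x) (at x)" for x
  proof -
    have "(F has_real_derivative ((2 * (- 2 * x)) * h1 x + 2 * ?p x * h2 x) * ?y1 x + 2 * ?p x * h1 x * ?y2 x + (H1 x * ?y x + H x * ?y1 x)) (at x)"
      unfolding F_def[abs_def]
      by (rule derivative_eq_intros DERIV_jacobi_p h H poly_DERIV refl | simp add: algebra_simps)+
    then show ?thesis by (rule DERIV_cong) (simp add: F1_def algebra_simps)
  qed
  have dF1: "(F1 has_real_derivative F2 x) (at x)" for x
    unfolding F1_def[abs_def]
    by (rule derivative_eq_intros DERIV_jacobi_p h H poly_DERIV refl | simp add: F2_def algebra_simps)+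
  have dz: "(?z has_real_derivative ?z1 x) (at x)" "(?z1 has_real_derivative ?z2 x) (at x)" for x
    by (rule poly_DERIV)+
  have Tz: "?p x * ?z2 x + ?q x * ?z1 x = - eigval m * ?z x" for x by (rule pn_ode)
  have cz2: "continuous_on UNIV ?z2" by (intro continuous_intros)
  define X where "X = (\<integral>x. F x * ?z x \<partial>jm)"
  have first: "X = (eigval n - eigval m) * matrix_coeff h n m"
  proof -
    have d1: "((\<lambda>x. h x * ?y x) has_real_derivative h1 x * ?y x + h x * ?y1 x) (at x)" for x
      by (rule DERIV_cong[OF DERIV_mult[OF h(1) poly_DERIV]]) simp
    have d2: "((\<lambda>x. h1 x * ?y x + h x * ?y1 x) has_real_derivative h2 x * ?y x + 2 * (h1 x * ?y1 x) + h x * ?y2 x) (at x)" for x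
      by (rule DERIV_cong[OF DERIV_add[OF DERIV_mult[OF h(2) poly_DERIV] DERIV_mult[OF h(1) poly_DERIV]]]) (simp add: algebra_simps)
    have "(\<integral>x. (?p x * (h2 x * ?y x + 2 * (h1 x * ?y1 x) + h x * ?y2 x) + ?q x * (h1 x * ?y x + h x * ?y1 x)) * ?z x \<partial>jm)
        = (\<integral>x. h x * ?y x * (?p x * ?z2 x + ?q x * ?z1 x) \<partial>jm)"
      by (rule jacobi_T_symmetric[OF d1 d2 dz _ cz2]) (intro continuous_intros cont)
    also have "(\<lambda>x. (?p x * (h2 x * ?y x + 2 * (h1 x * ?y1 x) + h x * ?y2 x) + ?q x * (h1 x * ?y x + h x * ?y1 x)) * ?z x)
        = (\<lambda>x. F x * ?z x - eigval n * (h x * ?y x * ?z x))"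
    proof
      fix x
      have "(?p x * (h2 x * ?y x + 2 * (h1 x * ?y1 x) + h x * ?y2 x) + ?q x * (h1 x * ?y x + h x * ?y1 x)) * ?z x
        = F x * ?z x + h x * (?p x * ?y2 x + ?q x * ?y1 x) * ?z x"
        by (simp add: F_def H(1) algebra_simps)
      then show "(?p x * (h2 x * ?y x + 2 * (h1 x * ?y1 x) + h x * ?y2 x) + ?q x * (h1 x * ?y x + h x * ?y1 x)) * ?z x
        = F x * ?z x - eigval n * (h x * ?y x * ?z x)" unfolding pn_ode by (simp add: algebra_simps)
    qed
    also have "(\<integral>x. F x * ?z x - eigval n * (h x * ?y x * ?z x) \<partial>jm) = X - eigval n * matrix_coeff h n m"
      unfolding X_def matrix_coeff_def
      by (subst Bochner_Integration.integral_diff) (auto intro!: integrable_continuous continuous_intros cont cF)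
    also have "(\<integral>x. h x * ?y x * (?p x * ?z2 x + ?q x * ?z1 x) \<partial>jm) = - eigval m * matrix_coeff h n m"
      unfolding Tz matrix_coeff_def by (subst integral_mult_right_zero[symmetric]) (simp only: mult_ac)
    finally show ?thesis by (simp add: algebra_simps)
  qed
  have second: "(\<integral>x. (?p x * F2 x + ?q x * F1 x + eigval n * F x) * ?z x \<partial>jm) = (eigval n - eigval m) * X"
  proof -
    have "(\<integral>x. (?p x * F2 x + ?q x * F1 x) * ?z x \<partial>jm) = (\<integral>x. F x * (?p x * ?z2 x + ?q x * ?z1 x) \<partial>jm)"
      by (rule jacobi_T_symmetric[OF dF dF1 dz cF(3) cz2])
    also have "\<dots> = - eigval m * X"
      unfolding Tz X_def by (subst integral_mult_right_zero[symmetric]) (simp only: mult_ac)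
    finally have 1: "(\<integral>x. (?p x * F2 x + ?q x * F1 x) * ?z x \<partial>jm) = - eigval m * X" .
    have "(\<integral>x. (?p x * F2 x + ?q x * F1 x + eigval n * F x) * ?z x \<partial>jm)
        = (\<integral>x. (?p x * F2 x + ?q x * F1 x) * ?z x + eigval n * (F x * ?z x) \<partial>jm)"
      by (simp only: distrib_right mult.assoc)
    also have "\<dots> = (\<integral>x. (?p x * F2 x + ?q x * F1 x) * ?z x \<partial>jm) + eigval n * X"
      unfolding X_def
      by (subst Bochner_Integration.integral_add) (auto intro!: integrable_continuous continuous_intros cont cF)
    finally show ?thesis using 1 by (simp add: algebra_simps)
  qed
  have "(eigval n - eigval m)\<^sup>2 * matrix_coeff h n m = (\<integral>x. (?p x * F2 x + ?q x * F1 x + eigval n * F x) * ?z x \<partial>jm)"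
    unfolding second first by (simp add: power2_eq_square)
  also have "(\<lambda>x. ?p x * F2 x + ?q x * F1 x + eigval n * F x)
      = (\<lambda>x. (?p x * H2 x + ?q x * H1 x) * ?y x - eigval n * (4 * ?p x * h2 x - 4 * x * h1 x) * ?y x
       + ?p x * (2 * (- 2 * h1 x - 4 * x * h2 x + ?p x * h3 x) - 2 * ?q x * h2 x + 2 * (\<alpha> + \<beta> + 2) * h1 x + 2 * H1 x) * ?y1 x)"
  proof
    fix x
    have ode: "?p x * ?y2 x = - ?q x * ?y1 x - eigval n * ?y x" using pn_ode[of x n] by simp
    have ode': "?p x * ?y3 x = - (- 2 * x) * ?y2 x - ?q x * ?y2 x + (\<alpha> + \<beta> + 2) * ?y1 x - eigval n * ?y1 x"
      using pn_ode_deriv[of x n] by (simp add: algebra_simps)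
    from commutator_identity[OF ode ode', of "-2" "h1 x" "h2 x" "h3 x" "H2 x" "H1 x" "H x"]
    show "?p x * F2 x + ?q x * F1 x + eigval n * F x
      = (?p x * H2 x + ?q x * H1 x) * ?y x - eigval n * (4 * ?p x * h2 x - 4 * x * h1 x) * ?y x
       + ?p x * (2 * (- 2 * h1 x - 4 * x * h2 x + ?p x * h3 x) - 2 * ?q x * h2 x + 2 * (\<alpha> + \<beta> + 2) * h1 x + 2 * H1 x) * ?y1 x"
      unfolding F_def F1_def F2_def by (simp add: mult.assoc)
  qed
  finally show ?thesis .
qed

end

section \<open>Combining direct and off-diagonal estimates\<close>

text \<open>Here a \<le> b are two frequencies, d the distance of their indices, \<open>G\<close>
  and \<open>E\<close> the coefficients of orders 0 and 2. The ratio b/a is harmless for b \<le> 2a.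
  Otherwise, for b < N both minima are used and leave (b/N)^2 \<le> 1; for b \<ge> N,
  \<open>sep\<close> gives b \<le> 2 s d, so a factor b^2 is bought with the commutator bound. The
  constant 9 is 8 for \<open>G\<close> plus 1 for \<open>E\<close>.\<close>

lemma kernel_arith:
  fixes C N a b d s G E :: real
  assumes N: "1 \<le> N" and a: "1 \<le> a" and ab: "a \<le> b" and d: "0 \<le> d" "d \<le> b" and s: "1 \<le> s" and C: "0 < C"
    and nn: "0 \<le> G" "0 \<le> E"
    and G1: "G \<le> C / N * min 1 (a / N) * min 1 (b / N)" and E1: "E \<le> C * N * min 1 (a / N) * min 1 (b / N)"
    and G2: "(d * b)\<^sup>2 * G \<le> C * N * a * (N + a)" and E2: "(d * b)\<^sup>2 * E \<le> C * N ^ 3 * a * (N + a)"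
    and sep: "b - a \<le> s * d"
  shows "b / a * G + E / (a * b) \<le> 9 * s\<^sup>2 * C / N" "(b / a * G + E / (a * b)) * d\<^sup>2 \<le> 9 * s\<^sup>2 * C * N"
proof -
  have b: "1 \<le> b" using a ab by simp
  have s2: "1 \<le> s\<^sup>2" using s by simp
  have sC: "C \<le> s\<^sup>2 * C" using s2 C by simp
  have dG: "d\<^sup>2 * (b / a * G) \<le> C * N * ((N + a) / b)"
  proof -
    have "d\<^sup>2 * (b / a * G) = ((d * b)\<^sup>2 * G) / (a * b)"
      using a b by (simp add: power2_eq_square field_simps)
    also have "\<dots> \<le> (C * N * a * (N + a)) / (a * b)" using a b by (intro divide_right_mono G2) auto
    also have "\<dots> = C * N * ((N + a) / b)" using a by simp
    finally show ?thesis .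
  qed
  have dE: "d\<^sup>2 * (E / (a * b)) \<le> C * N * ((N / b)\<^sup>2 * ((N + a) / b))"
  proof -
    have "d\<^sup>2 * (E / (a * b)) = ((d * b)\<^sup>2 * E) / (a * b ^ 3)"
      using a b by (simp add: power2_eq_square power3_eq_cube field_simps)
    also have "\<dots> \<le> (C * N ^ 3 * a * (N + a)) / (a * b ^ 3)" using a b by (intro divide_right_mono E2) auto
    also have "\<dots> = C * N * ((N / b)\<^sup>2 * ((N + a) / b))" using a by (simp add: power2_eq_square power3_eq_cube)
    finally show ?thesis .
  qed
  have E_le: "E / (a * b) \<le> C / N"
  proof -
    have "E \<le> C * N * (a / N) * (b / N)"
      using E1 by (rule order_trans) (use a b N C in \<open>intro mult_mono mult_nonneg_nonneg; simp\<close>)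
    also have "\<dots> = C / N * (a * b)" using N by simp
    finally show ?thesis using a b by (simp add: pos_divide_le_eq)
  qed
  have ratio: "(N + a) / b \<le> 2" if "N \<le> b" using that ab b by (simp add: pos_divide_le_eq)
  have dG': "d\<^sup>2 * (b / a * G) \<le> 2 * C * N" if "N \<le> b"
  proof -
    have "C * N * ((N + a) / b) \<le> C * N * 2" using ratio[OF that] C N by (intro mult_left_mono) auto
    then show ?thesis using dG by simp
  qed
  have G_le: "b / a * G \<le> 8 * s\<^sup>2 * C / N"
  proof (cases "b \<le> 2 * a")
    case True
    have "G \<le> C / N * 1 * 1" using G1 by (rule order_trans) (use a b N C in \<open>intro mult_mono mult_nonneg_nonneg; simp\<close>)
    moreover have "b / a \<le> 2" using True a by (simp add: pos_divide_le_eq)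
    ultimately have "b / a * G \<le> 2 * (C / N)" using nn a by (intro mult_mono) auto
    also have "\<dots> \<le> 8 * s\<^sup>2 * C / N" using sC N C by (simp add: divide_right_mono)
    finally show ?thesis .
  next
    case False
    show ?thesis
    proof (cases "N \<le> b")
      case True
      have "b \<le> 2 * (s * d)" using sep False by linarith
      then have "b\<^sup>2 \<le> (2 * (s * d))\<^sup>2" using b by (intro power_mono) auto
      then have b2: "b\<^sup>2 \<le> 4 * s\<^sup>2 * d\<^sup>2" by (simp add: power_mult_distrib)
      have bG: "0 \<le> b / a * G" using nn a b by simp
      have "N * N * (b / a * G) \<le> b\<^sup>2 * (b / a * G)"
        unfolding power2_eq_square using True N bG by (intro mult_right_mono mult_mono) auto
      also have "\<dots> \<le> 4 * s\<^sup>2 * d\<^sup>2 * (b / a * G)" using b2 bG by (intro mult_right_mono)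
      also have "\<dots> \<le> 4 * s\<^sup>2 * (2 * C * N)"
        using dG'[OF True] s2 unfolding mult.assoc[of "4 * s\<^sup>2"] by (intro mult_left_mono) auto
      finally have "N * (N * (b / a * G)) \<le> N * (8 * s\<^sup>2 * C)" by (simp add: mult_ac)
      then have "N * (b / a * G) \<le> 8 * s\<^sup>2 * C" by (rule mult_left_le_imp_le) (use N in simp)
      then show ?thesis using N by (simp add: pos_le_divide_eq mult.commute)
    next
      case NB: False
      have "G \<le> C / N * (a / N) * (b / N)"
        using G1 by (rule order_trans) (use a b N C in \<open>intro mult_mono mult_nonneg_nonneg; simp\<close>)
      then have "b / a * G \<le> b / a * (C / N * (a / N) * (b / N))" using a b by (intro mult_left_mono) auto
      also have "\<dots> = C / N * (b / N)\<^sup>2" using a N by (simp add: power2_eq_square algebra_simps)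
      also have "\<dots> \<le> C / N * 1"
        using NB b N C by (intro mult_left_mono power_le_one) auto
      also have "\<dots> \<le> 8 * s\<^sup>2 * C / N" using sC N C by (simp add: divide_right_mono)
      finally show ?thesis .
    qed
  qed
  have "b / a * G + E / (a * b) \<le> 8 * s\<^sup>2 * C / N + C / N" using G_le E_le by simp
  also have "\<dots> \<le> 9 * s\<^sup>2 * C / N"
  proof -
    have "8 * s\<^sup>2 * C + C \<le> 9 * s\<^sup>2 * C" using sC by linarith
    then show ?thesis using N unfolding add_divide_distrib[symmetric] by (intro divide_right_mono) auto
  qed
  finally show first: "b / a * G + E / (a * b) \<le> 9 * s\<^sup>2 * C / N" .
  show "(b / a * G + E / (a * b)) * d\<^sup>2 \<le> 9 * s\<^sup>2 * C * N"
  proof (cases "N \<le> b")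
    case True
    have "(N / b)\<^sup>2 * ((N + a) / b) \<le> 1 * 2"
      using ratio[OF True] True N a b by (intro mult_mono power_le_one) auto
    then have "C * N * ((N / b)\<^sup>2 * ((N + a) / b)) \<le> C * N * 2" using C N by (intro mult_left_mono) auto
    then have "d\<^sup>2 * (b / a * G) + d\<^sup>2 * (E / (a * b)) \<le> 4 * (C * N)" using dG'[OF True] dE by linarith
    also have "\<dots> \<le> 9 * (s\<^sup>2 * C * N)"
    proof -
      have "C * N \<le> s\<^sup>2 * C * N" "0 \<le> C * N" using sC N C by (auto intro!: mult_right_mono)
      then show ?thesis by linarith
    qed
    finally show ?thesis by (simp add: algebra_simps)
  next
    \<comment> \<open>Now d \<le> b < N, so d^2 \<le> N^2 and the first bound already implies the
      second.\<close>
    case False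
    have "d\<^sup>2 \<le> N\<^sup>2" using d False by (intro power_mono) auto
    then have "(b / a * G + E / (a * b)) * d\<^sup>2 \<le> 9 * s\<^sup>2 * C / N * N\<^sup>2"
      using first C N s2 by (intro mult_mono) auto
    also have "\<dots> = 9 * s\<^sup>2 * C * N" using N by (simp add: power2_eq_square)
    finally show ?thesis .
  qed
qed

context jacobi_diffusion
begin

lemma symbol_deriv':
  "symbol d f \<Longrightarrow> d' = d + 2 \<Longrightarrow> \<exists>f'. symbol d' f' \<and> (\<forall>t x. (f t has_real_derivative f' t x) (at x))"
  using symbol_deriv[of d f] by simp

text \<open>In the double commutator the coefficient of y has order d + 4, that of eigval n y order
  d + 2, that of p y' order d + 4. Writing p as a product of square roots, one root lowers the last
  order to d + 3 and the other accompanies y'. With the local masses, each term is at most a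
  multiple of N^(d+1) freq n (N + freq n).\<close>

lemma matrix_coeff_offdiag:
  assumes h: "symbol d h"
  shows "\<exists>C>0. \<forall>t>0. \<forall>n m. (eigval n - eigval m)\<^sup>2 * \<bar>matrix_coeff (h t) n m\<bar>
    \<le> C * time_scale t ^ (d + 1) * freq n * (time_scale t + freq n)"
proof -
  obtain h1 where h1: "symbol (d + 2) h1" "\<forall>t x. (h t has_real_derivative h1 t x) (at x)"
    using symbol_deriv'[OF h, of "d + 2"] by auto
  obtain h2 where h2: "symbol (d + 4) h2" "\<forall>t x. (h1 t has_real_derivative h2 t x) (at x)"
    using symbol_deriv'[OF h1(1), of "d + 4"] by auto
  obtain h3 where h3: "symbol (d + 6) h3" "\<forall>t x. (h2 t has_real_derivative h3 t x) (at x)"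
    using symbol_deriv'[OF h2(1), of "d + 6"] by auto
  define H where "H t x = jacobi_p x * h2 t x + jacobi_q \<alpha> \<beta> x * h1 t x" for t x
  have symp: "symbol d' (\<lambda>t x. jacobi_p x * f t x)" if "symbol d'' f" "d'' = d' + 2" for d' d'' f
    using symbol_jacobi_p[of d' f] that by simp
  have "symbol (d + 2) (\<lambda>t x. jacobi_p x * h2 t x)" by (rule symp[OF h2(1)]) simp
  then have H: "symbol (d + 2) H" unfolding H_def by (intro symbol.plus symbol_jacobi_q h1(1))
  obtain H1 where H1: "symbol (d + 4) H1" "\<forall>t x. (H t has_real_derivative H1 t x) (at x)"
    using symbol_deriv'[OF H, of "d + 4"] by auto
  obtain H2 where H2: "symbol (d + 6) H2" "\<forall>t x. (H1 t has_real_derivative H2 t x) (at x)"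
    using symbol_deriv'[OF H1(1), of "d + 6"] by auto
  define a0 where "a0 t x = jacobi_p x * H2 t x + jacobi_q \<alpha> \<beta> x * H1 t x" for t x
  define a1 where "a1 t x = 4 * jacobi_p x * h2 t x - 4 * x * h1 t x" for t x
  define a3 where "a3 t x = 2 * (- 2 * h1 t x - 4 * x * h2 t x + jacobi_p x * h3 t x)
          - 2 * jacobi_q \<alpha> \<beta> x * h2 t x + 2 * (\<alpha> + \<beta> + 2) * h1 t x + 2 * H1 t x" for t x
  have a0: "symbol (d + 4) a0"
  proof -
    have "symbol (d + 4) (\<lambda>t x. jacobi_p x * H2 t x)" by (rule symp[OF H2(1)]) simp
    then show ?thesis unfolding a0_def by (intro symbol.plus symbol_jacobi_q H1(1))
  qed
  have a1: "symbol (d + 2) a1"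
  proof -
    have "symbol (d + 2) (\<lambda>t x. 4 * (jacobi_p x * h2 t x) + poly [:0, -4:] x * h1 t x)"
      by (intro symbol.plus symbol_scale symbol_poly h1(1) symp[OF h2(1)]) simp
    moreover have "(\<lambda>t x. 4 * (jacobi_p x * h2 t x) + poly [:0, -4:] x * h1 t x) = a1"
      by (simp add: fun_eq_iff a1_def)
    ultimately show ?thesis by simp
  qed
  have a3: "symbol (d + 4) a3"
  proof -
    have m: "symbol (d + 4) h1" by (rule symbol_mono[OF h1(1)]) simp
    have p3: "symbol (d + 4) (\<lambda>t x. jacobi_p x * h3 t x)" by (rule symp[OF h3(1)]) simp
    have "symbol (d + 4) (\<lambda>t x. (2 * (\<alpha> + \<beta> + 2) - 4) * h1 t x + poly [:0, -8:] x * h2 t x + 2 * (jacobi_p x * h3 t x)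
        + (- 2) * (jacobi_q \<alpha> \<beta> x * h2 t x) + 2 * H1 t x)"
      by (intro symbol.plus symbol_scale symbol_poly symbol_jacobi_q h2(1) H1(1) m p3)
    moreover have "(\<lambda>t x. (2 * (\<alpha> + \<beta> + 2) - 4) * h1 t x + poly [:0, -8:] x * h2 t x + 2 * (jacobi_p x * h3 t x)
        + (- 2) * (jacobi_q \<alpha> \<beta> x * h2 t x) + 2 * H1 t x) = a3"
      by (simp add: fun_eq_iff a3_def algebra_simps)
    ultimately show ?thesis by simp
  qed
  obtain C0 where C0': "0 < C0 \<and> (\<forall>t x. 0 < t \<longrightarrow> x \<in> {-1<..<1} \<longrightarrow> \<bar>a0 t x\<bar> \<le> C0 * time_scale t ^ (d + 4) * bell (time_scale t) x \<and>
    sqrt (jacobi_p x) * \<bar>a0 t x\<bar> * time_scale t \<le> C0 * time_scale t ^ (d + 4) * bell (time_scale t) x)"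
    using symbol_bound_bell[OF a0] by (rule exE)
  have C0: "0 < C0" using C0' by (rule conjunct1)
  have C0_bell: "\<bar>a0 t x\<bar> \<le> C0 * time_scale t ^ (d + 4) * bell (time_scale t) x" if "0 < t" "x \<in> {-1<..<1}" for t x
    using conjunct2[OF C0', THEN spec, THEN spec, THEN mp, THEN mp, OF that] by (rule conjunct1)
  obtain C1 where C1': "0 < C1 \<and> (\<forall>t x. 0 < t \<longrightarrow> x \<in> {-1<..<1} \<longrightarrow> \<bar>a1 t x\<bar> \<le> C1 * time_scale t ^ (d + 2) * bell (time_scale t) x \<and>
    sqrt (jacobi_p x) * \<bar>a1 t x\<bar> * time_scale t \<le> C1 * time_scale t ^ (d + 2) * bell (time_scale t) x)"
    using symbol_bound_bell[OF a1] by (rule exE)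
  have C1: "0 < C1" using C1' by (rule conjunct1)
  have C1_bell: "\<bar>a1 t x\<bar> \<le> C1 * time_scale t ^ (d + 2) * bell (time_scale t) x" if "0 < t" "x \<in> {-1<..<1}" for t x
    using conjunct2[OF C1', THEN spec, THEN spec, THEN mp, THEN mp, OF that] by (rule conjunct1)
  obtain C3 where C3': "0 < C3 \<and> (\<forall>t x. 0 < t \<longrightarrow> x \<in> {-1<..<1} \<longrightarrow> \<bar>a3 t x\<bar> \<le> C3 * time_scale t ^ (d + 4) * bell (time_scale t) x \<and>
    sqrt (jacobi_p x) * \<bar>a3 t x\<bar> * time_scale t \<le> C3 * time_scale t ^ (d + 4) * bell (time_scale t) x)"
    using symbol_bound_bell[OF a3] by (rule exE)
  have C3: "0 < C3" using C3' by (rule conjunct1)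
  have C3_bell: "sqrt (jacobi_p x) * \<bar>a3 t x\<bar> * time_scale t \<le> C3 * time_scale t ^ (d + 4) * bell (time_scale t) x" if "0 < t" "x \<in> {-1<..<1}" for t x
    using conjunct2[OF C3', THEN spec, THEN spec, THEN mp, THEN mp, OF that] by (rule conjunct2)
  obtain D where D0: "0 < D \<and> (\<forall>n m N. 1 \<le> N \<longrightarrow>
     (\<integral>x. \<bar>poly (pn n) x * poly (pn m) x\<bar> * bell N x \<partial>jm) \<le> D / N * min 1 (freq n / N) * min 1 (freq m / N) \<and>
     (\<integral>x. \<bar>(sqrt (jacobi_p x) * poly (pderiv (pn n)) x) * poly (pn m) x\<bar> * bell N x \<partial>jm) \<le> D * freq n / N)"
    using pn_product_bell by (rule exE)
  note D1 = conjunct2[OF D0, THEN spec, THEN spec, THEN spec, THEN mp]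
  have D: "0 < D" "\<And>n m N. 1 \<le> N \<Longrightarrow> (\<integral>x. \<bar>poly (pn n) x * poly (pn m) x\<bar> * bell N x \<partial>jm) \<le> D / N * min 1 (freq n / N) * min 1 (freq m / N)"
     "\<And>n m N. 1 \<le> N \<Longrightarrow> (\<integral>x. \<bar>(sqrt (jacobi_p x) * poly (pderiv (pn n)) x) * poly (pn m) x\<bar> * bell N x \<partial>jm) \<le> D * freq n / N"
    by (rule conjunct1[OF D0] conjunct1[OF D1] conjunct2[OF D1], assumption?)+
  define C where "C = D * (C0 + C1 + C3)"
  have C: "0 < C" using D C0 C1 C3 by (simp add: C_def add_pos_pos)
  have main: "(eigval n - eigval m)\<^sup>2 * \<bar>matrix_coeff (h t) n m\<bar> \<le> C * time_scale t ^ (d + 1) * freq n * (time_scale t + freq n)"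
    if t: "0 < t" for t n m
  proof -
    define N where "N = time_scale t"
    have N: "1 \<le> N" unfolding N_def by (rule time_scale_ge_1)
    let ?y = "poly (pn n)" and ?y1 = "poly (pderiv (pn n))" and ?z = "poly (pn m)"
    have cont: "continuous_on UNIV (a0 t)" "continuous_on UNIV (a1 t)" "continuous_on UNIV (a3 t)"
      "continuous_on UNIV (h3 t)" "continuous_on UNIV (H2 t)"
      using symbol_continuous a0 a1 a3 h3(1) H2(1) by blast+
    have cp: "continuous_on UNIV jacobi_p" unfolding jacobi_p_def[abs_def] by (intro continuous_intros)
    let ?I1 = "\<lambda>x. \<bar>?y x * ?z x\<bar> * bell N x" and ?I2 = "\<lambda>x. \<bar>(sqrt (jacobi_p x) * ?y1 x) * ?z x\<bar> * bell N x"
    have int: "integrable jm ?I1" "integrable jm ?I2"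
      by (intro integrable_bell continuous_intros cp)+
    have "(eigval n - eigval m)\<^sup>2 * matrix_coeff (h t) n m =
       (\<integral>x. (a0 t x * ?y x - eigval n * a1 t x * ?y x + jacobi_p x * a3 t x * ?y1 x) * ?z x \<partial>jm)"
      unfolding a0_def a1_def a3_def
    proof (rule double_commutator[where H = "H t"])
      show "H t x = jacobi_p x * h2 t x + jacobi_q \<alpha> \<beta> x * h1 t x" for x by (rule H_def)
    qed (use h1 h2 h3 H1 H2 cont in simp_all)
    from arg_cong[OF this, of abs] have "(eigval n - eigval m)\<^sup>2 * \<bar>matrix_coeff (h t) n m\<bar> =
       \<bar>\<integral>x. (a0 t x * ?y x - eigval n * a1 t x * ?y x + jacobi_p x * a3 t x * ?y1 x) * ?z x \<partial>jm\<bar>"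
      unfolding abs_mult[of "(eigval n - eigval m)\<^sup>2"] abs_power2 .
    also have "\<dots> \<le> (\<integral>x. \<bar>(a0 t x * ?y x - eigval n * a1 t x * ?y x + jacobi_p x * a3 t x * ?y1 x) * ?z x\<bar> \<partial>jm)"
      by (rule integral_abs_bound)
    also have "\<dots> \<le> (\<integral>x. (C0 * N ^ (d + 4) + eigval n * (C1 * N ^ (d + 2))) * ?I1 x + C3 * N ^ (d + 3) * ?I2 x \<partial>jm)"
    proof (rule jm_integral_mono)
      show "integrable jm (\<lambda>x. \<bar>(a0 t x * ?y x - eigval n * a1 t x * ?y x + jacobi_p x * a3 t x * ?y1 x) * ?z x\<bar>)"
        by (intro integrable_continuous continuous_intros cont cp)
      show "integrable jm (\<lambda>x. (C0 * N ^ (d + 4) + eigval n * (C1 * N ^ (d + 2))) * ?I1 x + C3 * N ^ (d + 3) * ?I2 x)"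
        by (intro Bochner_Integration.integrable_add integrable_mult_right int)
      fix x :: real assume x: "x \<in> {-1<..<1}"
      define B where "B = bell N x"
      define P where "P = sqrt (jacobi_p x)"
      have P: "0 < P" "jacobi_p x = P * P" using jacobi_p_pos[OF x] by (auto simp: P_def)
      have b0: "\<bar>a0 t x\<bar> \<le> C0 * N ^ (d + 4) * B" using C0_bell[OF t x] by (simp add: B_def N_def)
      have b1: "\<bar>a1 t x\<bar> \<le> C1 * N ^ (d + 2) * B" using C1_bell[OF t x] by (simp add: B_def N_def)
      have b3: "P * \<bar>a3 t x\<bar> \<le> C3 * N ^ (d + 3) * B"
      proof -
        have "N * (P * \<bar>a3 t x\<bar>) \<le> C3 * N ^ (d + 4) * B" using C3_bell[OF t x] by (simp add: B_def N_def P_def mult_ac)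
        also have "\<dots> = N * (C3 * N ^ (d + 3) * B)" by (simp add: eval_nat_numeral)
        finally show ?thesis using N by simp
      qed
      have "\<bar>(a0 t x * ?y x - eigval n * a1 t x * ?y x + jacobi_p x * a3 t x * ?y1 x) * ?z x\<bar>
         = \<bar>a0 t x * (?y x * ?z x) - eigval n * (a1 t x * (?y x * ?z x)) + (P * a3 t x) * (P * ?y1 x * ?z x)\<bar>"
        unfolding P(2) by (simp add: algebra_simps)
      also have "\<dots> \<le> \<bar>a0 t x\<bar> * \<bar>?y x * ?z x\<bar> + eigval n * (\<bar>a1 t x\<bar> * \<bar>?y x * ?z x\<bar>) + (P * \<bar>a3 t x\<bar>) * \<bar>P * ?y1 x * ?z x\<bar>"
      proof -
        have "\<bar>u - v + w\<bar> \<le> \<bar>u\<bar> + \<bar>v\<bar> + \<bar>w\<bar>" for u v w :: real by linarith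
        from this[of "a0 t x * (?y x * ?z x)" "eigval n * (a1 t x * (?y x * ?z x))" "(P * a3 t x) * (P * ?y1 x * ?z x)"]
        show ?thesis using P(1) eigval_nonneg[of n] by (simp add: abs_mult)
      qed
      also have "\<dots> \<le> C0 * N ^ (d + 4) * B * \<bar>?y x * ?z x\<bar> + eigval n * (C1 * N ^ (d + 2) * B * \<bar>?y x * ?z x\<bar>)
          + C3 * N ^ (d + 3) * B * \<bar>P * ?y1 x * ?z x\<bar>"
        by (intro add_mono mult_right_mono mult_left_mono b0 b1 b3 eigval_nonneg) auto
      also have "\<dots> = (C0 * N ^ (d + 4) + eigval n * (C1 * N ^ (d + 2))) * ?I1 x + C3 * N ^ (d + 3) * ?I2 x"
        by (simp add: B_def P_def algebra_simps)
      finally show "\<bar>(a0 t x * ?y x - eigval n * a1 t x * ?y x + jacobi_p x * a3 t x * ?y1 x) * ?z x\<bar>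
         \<le> (C0 * N ^ (d + 4) + eigval n * (C1 * N ^ (d + 2))) * ?I1 x + C3 * N ^ (d + 3) * ?I2 x" .
    qed
    also have "\<dots> = C0 * N ^ (d + 4) * integral\<^sup>L jm ?I1 + eigval n * (C1 * N ^ (d + 2)) * integral\<^sup>L jm ?I1 + C3 * N ^ (d + 3) * integral\<^sup>L jm ?I2"
      using int by (simp add: distrib_right)
    also have "\<dots> \<le> C0 * N ^ (d + 4) * (D / N * (freq n / N)) + (freq n)\<^sup>2 * (C1 * N ^ (d + 2)) * (D / N) + C3 * N ^ (d + 3) * (D * freq n / N)"
    proof -
      have f: "1 \<le> freq n" "1 \<le> freq m" by (rule freq_ge_1)+
      have DN: "0 \<le> D / N" using D N by simp
      have i1: "integral\<^sup>L jm ?I1 \<le> D / N * min 1 (freq n / N) * min 1 (freq m / N)" by (rule D(2)[OF N])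
      have "D / N * min 1 (freq n / N) * min 1 (freq m / N) \<le> D / N * (freq n / N) * 1"
        using f N DN by (intro mult_mono mult_nonneg_nonneg) auto
      then have i1': "integral\<^sup>L jm ?I1 \<le> D / N * (freq n / N)" using i1 by simp
      have "D / N * min 1 (freq n / N) * min 1 (freq m / N) \<le> D / N * 1 * 1"
        using f N DN by (intro mult_mono mult_nonneg_nonneg) auto
      then have i1'': "integral\<^sup>L jm ?I1 \<le> D / N" using i1 by simp
      have i0: "0 \<le> integral\<^sup>L jm ?I1"
      proof (rule integral_nonneg_AE)
        show "AE x in jm. 0 \<le> ?I1 x"
          using AE_jm by eventually_elim (auto intro!: mult_nonneg_nonneg bell_nonneg)
      qed
      show ?thesis
        using C0 C1 C3 N eigval_nonneg[of n] D
        by (intro add_mono mult_left_mono mult_mono i1' i1'' D(3)[OF N] i0)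
          (auto simp: freq_square intro!: mult_nonneg_nonneg)
    qed
    also have "\<dots> = D * N ^ (d + 1) * (C0 * (N * freq n) + C1 * (freq n * freq n) + C3 * (N * freq n))"
      using N by (simp add: eval_nat_numeral field_simps)
    also have "\<dots> \<le> D * N ^ (d + 1) * ((C0 + C1 + C3) * (freq n * (N + freq n)))"
    proof (intro mult_left_mono)
      have "0 \<le> C0 * (freq n * freq n)" "0 \<le> C1 * (N * freq n)" "0 \<le> C3 * (freq n * freq n)"
        using C0 C1 C3 N freq_ge_1[of n] by auto
      then show "C0 * (N * freq n) + C1 * (freq n * freq n) + C3 * (N * freq n) \<le> (C0 + C1 + C3) * (freq n * (N + freq n))"
        by (simp add: algebra_simps)
    qed (use D N in auto)
    finally show ?thesis unfolding N_def C_def by (simp only: mult_ac)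
  qed
  show ?thesis by (rule exI[of _ C], rule conjI[OF C]) (use main in blast)
qed

lemma eigval_diff: "eigval m - eigval n = (real m - real n) * (real n + real m + \<alpha> + \<beta> + 1)"
  by (simp add: eigval_def algebra_simps)

lemma freq_bounds: "real n + 1 \<le> freq n" "freq n \<le> real n + (\<alpha> + \<beta> + 1)"
proof -
  define s where "s = \<alpha> + \<beta> + 1"
  have s: "2 \<le> s" using \<alpha> \<beta> by (simp add: s_def)
  have e: "eigval n + 1 = (real n)\<^sup>2 + real n * s + 1" by (simp add: eigval_def s_def power2_eq_square algebra_simps)
  have "(real n + 1)\<^sup>2 \<le> eigval n + 1"
    unfolding e using mult_left_mono[OF s, of "real n"] by (simp add: power2_eq_square algebra_simps)
  then show "real n + 1 \<le> freq n" unfolding freq_def by (rule real_le_rsqrt)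
  have "eigval n + 1 \<le> (real n + s)\<^sup>2"
  proof -
    have "1 * 1 \<le> s * s" using s by (intro mult_mono) auto
    moreover have "0 \<le> real n * s" using s by simp
    ultimately show ?thesis unfolding e by (simp add: power2_eq_square algebra_simps)
  qed
  then show "freq n \<le> real n + (\<alpha> + \<beta> + 1)"
    unfolding freq_def s_def[symmetric] using s by (intro real_le_lsqrt) auto
qed

lemma freq_mono: "n \<le> m \<Longrightarrow> freq n \<le> freq m"
  unfolding freq_def eigval_def using \<alpha> \<beta> by (intro real_sqrt_le_mono add_right_mono mult_mono) auto

text \<open>The difference of eigenvalues is a difference of squares of frequencies; it is divided
  by freq m + freq n, which is at least n + m + 2.\<close>

lemma freq_diff_le:
  assumes "n \<le> m"
  shows "freq m - freq n \<le> (\<alpha> + \<beta> + 1) * (real m - real n)"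
proof -
  define s where "s = \<alpha> + \<beta> + 1"
  have s: "2 \<le> s" using \<alpha> \<beta> by (simp add: s_def)
  have sum: "real n + real m + 2 \<le> freq m + freq n" using freq_bounds(1)[of n] freq_bounds(1)[of m] by simp
  have "(freq m - freq n) * (freq m + freq n) = (freq m)\<^sup>2 - (freq n)\<^sup>2" by (simp add: power2_eq_square algebra_simps)
  also have "\<dots> = eigval m - eigval n" by (simp add: freq_square)
  also have "\<dots> = (real m - real n) * (real n + real m + s)" unfolding eigval_diff s_def by (simp add: add.assoc)
  also have "\<dots> \<le> (real m - real n) * (s * (freq m + freq n))"
  proof (rule mult_left_mono)
    have "s * (real n + real m + 2) \<le> s * (freq m + freq n)" using s sum by (intro mult_left_mono) auto
    moreover have "1 * (real n + real m) \<le> s * (real n + real m)" using s by (intro mult_right_mono) auto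
    ultimately show "real n + real m + s \<le> s * (freq m + freq n)" using s by (simp add: distrib_left)
  qed (use assms in simp)
  finally have "(freq m - freq n) * (freq m + freq n) \<le> (s * (real m - real n)) * (freq m + freq n)" by (simp add: mult_ac)
  then show ?thesis using sum unfolding s_def[symmetric] by (subst (asm) mult_le_cancel_right_pos) auto
qed

text \<open>The constants min 1 lam and max 1 lam make eigval n + lam comparable with the square of
  freq n, which brings the identity \<open>K\<close> into the shape of \<open>kernel_arith\<close>.
  Both coefficients are symmetric in n and m, hence so is the kernel, and the case n \<le> m
  suffices.\<close>

theorem kernel_bound:
  assumes lam: "0 < lam" and h: "symbol 2 h"
    and K: "\<And>t n m. 0 < t \<Longrightarrow> sqrt (eigval n + lam) * sqrt (eigval m + lam) * K t n m
      = (eigval n + eigval m + 2 * lam) / 2 * matrix_coeff (gauss t) n m + matrix_coeff (h t) n m"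
  shows "\<exists>C>0. \<forall>t>0. \<exists>N\<ge>1. \<forall>n m. \<bar>K t n m\<bar> \<le> C / N \<and> \<bar>K t n m\<bar> * (real n - real m)\<^sup>2 \<le> C * N"
proof -
  obtain A1 where A1: "0 < A1" "\<And>t n m. 0 < t \<Longrightarrow> \<bar>matrix_coeff (gauss t) n m\<bar>
    \<le> A1 * time_scale t ^ 0 / time_scale t * min 1 (freq n / time_scale t) * min 1 (freq m / time_scale t)"
    using matrix_coeff_direct[OF symbol_gauss] by metis
  obtain A2 where A2: "0 < A2" "\<And>t n m. 0 < t \<Longrightarrow> \<bar>matrix_coeff (h t) n m\<bar>
    \<le> A2 * time_scale t ^ 2 / time_scale t * min 1 (freq n / time_scale t) * min 1 (freq m / time_scale t)"
    using matrix_coeff_direct[OF h] by metis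
  obtain A3 where A3: "0 < A3" "\<And>t n m. 0 < t \<Longrightarrow> (eigval n - eigval m)\<^sup>2 * \<bar>matrix_coeff (gauss t) n m\<bar>
    \<le> A3 * time_scale t ^ (0 + 1) * freq n * (time_scale t + freq n)"
    using matrix_coeff_offdiag[OF symbol_gauss] by metis
  obtain A4 where A4: "0 < A4" "\<And>t n m. 0 < t \<Longrightarrow> (eigval n - eigval m)\<^sup>2 * \<bar>matrix_coeff (h t) n m\<bar>
    \<le> A4 * time_scale t ^ (2 + 1) * freq n * (time_scale t + freq n)"
    using matrix_coeff_offdiag[OF h] by metis
  define A where "A = A1 + A2 + A3 + A4"
  have A: "0 < A" "A1 \<le> A" "A2 \<le> A" "A3 \<le> A" "A4 \<le> A" using A1 A2 A3 A4 by (auto simp: A_def)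
  define s where "s = \<alpha> + \<beta> + 1"
  have s: "2 \<le> s" using \<alpha> \<beta> by (simp add: s_def)
  define \<kappa> where "\<kappa> = min 1 lam"
  define \<Lambda> where "\<Lambda> = max 1 lam"
  have \<kappa>: "0 < \<kappa>" "\<kappa> \<le> 1" "1 \<le> \<Lambda>" using lam by (auto simp: \<kappa>_def \<Lambda>_def)
  have low: "\<kappa> * (freq n)\<^sup>2 \<le> eigval n + lam" for n
  proof -
    have "\<kappa> * eigval n \<le> 1 * eigval n" using \<kappa> eigval_nonneg[of n] by (intro mult_right_mono) auto
    then show ?thesis unfolding freq_square by (simp add: distrib_left \<kappa>_def)
  qed
  have up: "eigval n + lam \<le> \<Lambda> * (freq n)\<^sup>2" for n
  proof -
    have "1 * eigval n \<le> \<Lambda> * eigval n" using \<kappa> eigval_nonneg[of n] by (intro mult_right_mono) auto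
    then show ?thesis unfolding freq_square by (simp add: distrib_left \<Lambda>_def)
  qed
  define C where "C = \<Lambda> / \<kappa> * (9 * s\<^sup>2 * A)"
  have C: "0 < C" using \<kappa> s A by (simp add: C_def)
  have main: "\<bar>K t n m\<bar> \<le> C / time_scale t \<and> \<bar>K t n m\<bar> * (real m - real n)\<^sup>2 \<le> C * time_scale t"
    if t: "0 < t" and nm: "n \<le> m" for t n m
  proof -
    define N where "N = time_scale t"
    have N: "1 \<le> N" unfolding N_def by (rule time_scale_ge_1)
    define a where "a = freq n"
    define b where "b = freq m"
    define d where "d = real m - real n"
    define G where "G = \<bar>matrix_coeff (gauss t) n m\<bar>"
    define E where "E = \<bar>matrix_coeff (h t) n m\<bar>"
    have a: "1 \<le> a" "a \<le> b" unfolding a_def b_def using freq_ge_1 freq_mono[OF nm] by auto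
    have b: "1 \<le> b" using a by simp
    have d: "0 \<le> d" "d \<le> b" using nm freq_bounds(1)[of m] by (auto simp: d_def b_def)
    have nn: "0 \<le> G" "0 \<le> E" by (auto simp: G_def E_def)
    have G1: "G \<le> A / N * min 1 (a / N) * min 1 (b / N)"
    proof -
      have "G \<le> A1 / N * min 1 (a / N) * min 1 (b / N)" using A1(2)[OF t, of n m] by (simp add: G_def N_def a_def b_def)
      also have "\<dots> \<le> A / N * min 1 (a / N) * min 1 (b / N)"
        using A N a b by (intro mult_right_mono divide_right_mono) auto
      finally show ?thesis .
    qed
    have E1: "E \<le> A * N * min 1 (a / N) * min 1 (b / N)"
    proof -
      have "E \<le> A2 * N * min 1 (a / N) * min 1 (b / N)"
        using A2(2)[OF t, of n m] N by (simp add: E_def N_def[symmetric] a_def b_def power2_eq_square)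
      also have "\<dots> \<le> A * N * min 1 (a / N) * min 1 (b / N)"
        using A N a b by (intro mult_right_mono) auto
      finally show ?thesis .
    qed
    have db: "(d * b)\<^sup>2 \<le> (eigval n - eigval m)\<^sup>2"
    proof -
      have "d * b \<le> d * (real n + real m + s)"
        using d freq_bounds(2)[of m] by (intro mult_left_mono) (auto simp: b_def s_def)
      also have "\<dots> = eigval m - eigval n" unfolding eigval_diff d_def s_def by (simp add: add.assoc)
      finally have "(d * b)\<^sup>2 \<le> (eigval m - eigval n)\<^sup>2" using d b by (intro power_mono) auto
      then show ?thesis by (simp add: power2_commute)
    qed
    have G2: "(d * b)\<^sup>2 * G \<le> A * N * a * (N + a)"
    proof -
      have "(d * b)\<^sup>2 * G \<le> (eigval n - eigval m)\<^sup>2 * G" using db nn by (intro mult_right_mono)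
      also have "\<dots> \<le> A3 * N * a * (N + a)" using A3(2)[OF t, of n m] by (simp add: G_def N_def a_def)
      also have "\<dots> \<le> A * N * a * (N + a)" using A N a by (intro mult_right_mono) auto
      finally show ?thesis .
    qed
    have E2: "(d * b)\<^sup>2 * E \<le> A * N ^ 3 * a * (N + a)"
    proof -
      have "(d * b)\<^sup>2 * E \<le> (eigval n - eigval m)\<^sup>2 * E" using db nn by (intro mult_right_mono)
      also have "\<dots> \<le> A4 * N ^ 3 * a * (N + a)" using A4(2)[OF t, of n m] by (simp add: E_def N_def a_def)
      also have "\<dots> \<le> A * N ^ 3 * a * (N + a)" using A N a by (intro mult_right_mono) auto
      finally show ?thesis .
    qed
    have sep: "b - a \<le> s * d" using freq_diff_le[OF nm] by (simp add: a_def b_def s_def d_def)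
    note arith = kernel_arith[OF N a d _ A(1) nn G1 E1 G2 E2 sep]
    define \<sigma> where "\<sigma> = sqrt (eigval n + lam) * sqrt (eigval m + lam)"
    have \<sigma>_low: "\<kappa> * (a * b) \<le> \<sigma>"
    proof -
      have "sqrt \<kappa> * a \<le> sqrt (eigval n + lam)" "sqrt \<kappa> * b \<le> sqrt (eigval m + lam)"
        using low[of n] low[of m] \<kappa> a b by (auto intro!: real_le_rsqrt simp: power_mult_distrib a_def b_def)
      then have "(sqrt \<kappa> * a) * (sqrt \<kappa> * b) \<le> \<sigma>"
        unfolding \<sigma>_def using \<kappa> b eigval_nonneg[of n] lam by (intro mult_mono) simp_all
      moreover have "(sqrt \<kappa> * a) * (sqrt \<kappa> * b) = (sqrt \<kappa> * sqrt \<kappa>) * (a * b)" by (simp only: mult_ac)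
      ultimately show ?thesis using \<kappa> by simp
    qed
    have \<sigma>0: "0 < \<kappa> * (a * b)" using \<kappa> a b by simp
    define X where "X = b / a * G + E / (a * b)"
    have X0: "0 \<le> X" using nn a b by (simp add: X_def)
    have "\<sigma> * \<bar>K t n m\<bar> = \<bar>\<sigma> * K t n m\<bar>" using \<sigma>_low \<sigma>0 by (simp add: abs_mult)
    also have "\<dots> \<le> (eigval n + eigval m + 2 * lam) / 2 * G + E"
      unfolding \<sigma>_def K[OF t] G_def E_def using eigval_nonneg[of n] eigval_nonneg[of m] lam
      by (intro order_trans[OF abs_triangle_ineq]) (simp add: abs_mult)
    also have "\<dots> \<le> \<Lambda> * b\<^sup>2 * G + \<Lambda> * E"
    proof (intro add_mono mult_right_mono nn)
      have "\<Lambda> * a\<^sup>2 \<le> \<Lambda> * b\<^sup>2" using a \<kappa> by (intro mult_left_mono power_mono) auto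
      then show "(eigval n + eigval m + 2 * lam) / 2 \<le> \<Lambda> * b\<^sup>2" using up[of n] up[of m] by (simp add: a_def b_def)
      show "E \<le> \<Lambda> * E" using \<kappa> nn by (simp add: mult_le_cancel_right1)
    qed
    also have "\<dots> = \<Lambda> * (a * b) * X" using a b by (simp add: X_def power2_eq_square field_simps)
    finally have 1: "\<sigma> * \<bar>K t n m\<bar> \<le> \<Lambda> * (a * b) * X" .
    have "\<kappa> * (a * b) * \<bar>K t n m\<bar> \<le> \<sigma> * \<bar>K t n m\<bar>" using \<sigma>_low by (intro mult_right_mono) auto
    then have "\<kappa> * (a * b) * \<bar>K t n m\<bar> \<le> \<Lambda> * (a * b) * X" using 1 by linarith
    then have "(a * b) * (\<kappa> * \<bar>K t n m\<bar>) \<le> (a * b) * (\<Lambda> * X)" by (simp only: mult_ac)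
    then have "\<kappa> * \<bar>K t n m\<bar> \<le> \<Lambda> * X" using a b by (subst (asm) mult_le_cancel_left_pos) auto
    then have KX: "\<bar>K t n m\<bar> \<le> \<Lambda> / \<kappa> * X" using \<kappa> by (simp add: pos_le_divide_eq mult.commute)
    have LK: "0 \<le> \<Lambda> / \<kappa>" using \<kappa> by simp
    have "\<bar>K t n m\<bar> \<le> \<Lambda> / \<kappa> * (9 * s\<^sup>2 * A / N)"
      using KX mult_left_mono[OF arith(1) LK] s unfolding X_def by linarith
    moreover have "\<bar>K t n m\<bar> * d\<^sup>2 \<le> \<Lambda> / \<kappa> * X * d\<^sup>2" using KX by (intro mult_right_mono) auto
    then have "\<bar>K t n m\<bar> * d\<^sup>2 \<le> \<Lambda> / \<kappa> * (9 * s\<^sup>2 * A * N)"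
      using mult_left_mono[OF arith(2) LK] s unfolding X_def by (simp add: mult.assoc)
    ultimately show ?thesis unfolding N_def[symmetric] d_def C_def by (simp add: mult.assoc)
  qed
  have sym: "K t n m = K t m n" if t: "0 < t" for t n m
  proof -
    have "sqrt (eigval n + lam) * sqrt (eigval m + lam) * K t n m = sqrt (eigval n + lam) * sqrt (eigval m + lam) * K t m n"
      using K[OF t, of n m] K[OF t, of m n] matrix_coeff_commute[of "gauss t" n m] matrix_coeff_commute[of "h t" n m]
      by (simp add: mult_ac add_ac)
    moreover have "sqrt (eigval n + lam) * sqrt (eigval m + lam) \<noteq> 0"
      using lam eigval_nonneg[of n] eigval_nonneg[of m] by simp
    ultimately show ?thesis by simp
  qed
  show ?thesis
  proof (rule exI[of _ C], rule conjI[OF C], intro allI impI)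
    fix t :: real assume t: "0 < t"
    have "\<bar>K t n m\<bar> \<le> C / time_scale t \<and> \<bar>K t n m\<bar> * (real n - real m)\<^sup>2 \<le> C * time_scale t" for n m
    proof (cases "n \<le> m")
      case True
      then show ?thesis using main[OF t True] by (simp add: power2_commute)
    next
      case False
      then show ?thesis using main[OF t, of m n] sym[OF t, of n m] by simp
    qed
    then show "\<exists>N\<ge>1. \<forall>n m. \<bar>K t n m\<bar> \<le> C / N \<and> \<bar>K t n m\<bar> * (real n - real m)\<^sup>2 \<le> C * N"
      using time_scale_ge_1[of t] by blast
  qed
qed

end

section \<open>Exceptional Jacobi polynomials\<close>

text \<open>Serves to exclude orders of vanishing of b at -1 that would give the exceptional weight
  infinite mass.\<close>

lemma not_integrable_inverse_shift:
  "\<not> set_integrable lborel {-1<..<0} (\<lambda>x::real. 1 / (1 + x))"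
proof
  assume int: "set_integrable lborel {-1<..<0} (\<lambda>x::real. 1 / (1 + x))"
  define I where "I = (LBINT x:{-1<..<0}. 1 / (1 + (x::real)))"
  \<comment> \<open>With this cutoff the integral over [-1 + e, -1/2] equals ln(1/2) + |I| + 2,
    which exceeds I because ln 2 \<le> 1.\<close>
  define e where "e = exp (- (\<bar>I\<bar> + 2))"
  have e: "0 < e" by (simp add: e_def)
  have "2 \<le> exp (\<bar>I\<bar> + 2)" using exp_ge_add_one_self[of "\<bar>I\<bar> + 2"] by linarith
  then have "inverse (exp (\<bar>I\<bar> + 2)) \<le> inverse 2" by (rule le_imp_inverse_le) simp
  then have e2: "e \<le> 1 / 2" unfolding e_def exp_minus by simp
  have sub: "{-1 + e..-1/2} \<subseteq> {-1<..<0}" using e by auto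
  have int': "set_integrable lborel {-1 + e..-1/2} (\<lambda>x::real. 1 / (1 + x))"
    by (rule set_integrable_subset[OF int _ sub]) simp
  have "((\<lambda>x. 1 / (1 + x)) has_integral (ln (1 + (-1/2)) - ln (1 + (-1 + e)))) {-1 + e..-1/2}"
  proof (rule fundamental_theorem_of_calculus)
    fix x :: real assume "x \<in> {-1 + e..-1/2}"
    then have "0 < 1 + x" using e by auto
    then have "((\<lambda>x. ln (1 + x)) has_real_derivative 1 / (1 + x)) (at x)"
      by (auto intro!: derivative_eq_intros)
    then show "((\<lambda>x. ln (1 + x)) has_vector_derivative 1 / (1 + x)) (at x within {-1 + e..-1/2})"
      by (simp add: has_real_derivative_iff_has_vector_derivative has_vector_derivative_at_within)
  qed (use e2 in simp)
  then have "(LBINT x:{-1 + e..-1/2}. 1 / (1 + x)) = ln (1/2) + (\<bar>I\<bar> + 2)"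
    using set_borel_integral_eq_integral(2)[OF int'] by (simp add: integral_unique e_def)
  moreover have "(LBINT x:{-1 + e..-1/2}. 1 / (1 + x)) \<le> I"
    unfolding I_def set_lebesgue_integral_def
  proof (rule integral_mono)
    show "integrable lborel (\<lambda>x::real. indicator {-1 + e..-1/2} x *\<^sub>R (1 / (1 + x)))"
      using int' by (simp only: set_integrable_def)
    show "integrable lborel (\<lambda>x::real. indicator {-1<..<0} x *\<^sub>R (1 / (1 + x)))"
      using int by (simp only: set_integrable_def)
    fix x :: real
    show "indicator {-1 + e..-1/2} x *\<^sub>R (1 / (1 + x)) \<le> indicator {-1<..<0} x *\<^sub>R (1 / (1 + x))"
      using e by (auto simp: indicator_def)
  qed
  moreover have "- 1 \<le> ln (1 / 2 :: real)" using ln_le_minus_one[of 2] by (simp add: ln_div)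
  ultimately show False by linarith
qed

text \<open>Positivity of \<open>b1\<close> includes the point 1, where it expresses that the zero
  of b is simple. It excludes -1, where b may vanish; the order of that zero is bounded through
  \<open>moments\<close>.\<close>

locale exceptional_jacobi = jacobi_diffusion +
  fixes b bw :: "real poly" and w :: "real \<Rightarrow> real" and lam :: real
  assumes b_eq: "b = [:1, -1:] * b1"
    and b1_pos: "\<And>x. -1 < x \<Longrightarrow> x \<le> 1 \<Longrightarrow> 0 < poly b1 x"
    and data: "darboux_data \<alpha> \<beta> b w bw lam"
    and moments: "finite_moments (exc_weight \<alpha> \<beta> b)"
    and orthonormal: "orthonormal_wrt (exc_weight \<alpha> \<beta> b) (exc_jacobi \<alpha> \<beta> b bw pn)"
begin

abbreviation W :: "real \<Rightarrow> real" where "W \<equiv> exc_weight \<alpha> \<beta> b"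
abbreviation P :: "nat \<Rightarrow> real \<Rightarrow> real" where "P n \<equiv> poly (exc_poly b bw pn n)"
abbreviation \<sigma> :: "nat \<Rightarrow> real" where "\<sigma> \<equiv> exc_sigma \<alpha> \<beta> b bw pn"

lemma b_pos: "x \<in> {-1<..<1} \<Longrightarrow> 0 < poly b x"
  using data by (simp add: darboux_data_def)

lemma poly_b: "poly b x = (1 - x) * poly b1 x"
  by (simp add: b_eq algebra_simps)

text \<open>The operator identity is evaluated at the constant polynomial 1. Replacing w by bw / b
  and multiplying by b^2 leaves an identity between polynomials.\<close>

lemma riccati:
  assumes x: "x \<in> {-1<..<1}"
  shows "jacobi_p x * (poly (pderiv bw) x * poly b x - poly bw x * poly (pderiv b) x)
    + jacobi_p x * (poly bw x)\<^sup>2 + jacobi_q \<alpha> \<beta> x * poly bw x * poly b x = lam * (poly b x)\<^sup>2"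
proof -
  have w: "poly b z * w z = poly bw z" if "z \<in> {-1<..<1}" for z
    using data b_pos[OF that] by (auto simp: darboux_data_def)
  have p1: "poly (1 :: real poly) = (\<lambda>x. 1)" by auto
  have T1: "jacobi_T \<alpha> \<beta> (poly 1) x = 0" by (simp add: jacobi_T_def p1)
  have A1: "darboux_A b w (poly 1) z = - poly bw z" if "z \<in> {-1<..<1}" for z
    using w[OF that] by (simp add: darboux_A_def p1)
  have "((\<lambda>z. - poly bw z) has_real_derivative - poly (pderiv bw) x) (at x)"
    by (intro DERIV_minus poly_DERIV)
  \<comment> \<open>The function agrees with -bw only where b is nonzero, but the derivative at x
    sees just a neighbourhood inside the open interval.\<close>
  then have "(darboux_A b w (poly 1) has_real_derivative - poly (pderiv bw) x) (at x)"
    by (rule has_field_derivative_transform_within_open[of _ _ _ "{-1<..<1}"]) (use x A1 in auto)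
  then have d: "deriv (darboux_A b w (poly 1)) x = - poly (pderiv bw) x" by (rule DERIV_imp_deriv)
  have "jacobi_T \<alpha> \<beta> (poly 1) x = darboux_B \<alpha> \<beta> b w (darboux_A b w (poly 1)) x + lam * poly 1 x"
    using data x unfolding darboux_data_def by blast
  then have "0 = jacobi_p x / poly b x * (- poly (pderiv bw) x -
      (- w x - jacobi_q \<alpha> \<beta> x / jacobi_p x + poly (pderiv b) x / poly b x) * (- poly bw x)) + lam"
    unfolding T1 darboux_B_def d A1[OF x] darboux_bhat_def darboux_what_def by simp
  moreover have "w x = poly bw x / poly b x" using w[OF x] b_pos[OF x] by (simp add: field_simps)
  ultimately have e: "0 = jacobi_p x / poly b x * (- poly (pderiv bw) x -
      (- (poly bw x / poly b x) - jacobi_q \<alpha> \<beta> x / jacobi_p x + poly (pderiv b) x / poly b x) * (- poly bw x)) + lam" by simp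
  have gen: "lam * B\<^sup>2 = p * (W' * B - W * B') + p * W\<^sup>2 + q * W * B"
    if "0 < p" "0 < B" "0 = p / B * (- W' - (- (W / B) - q / p + B' / B) * (- W)) + lam" for p q B B' W W' :: real
  proof -
    have "p / B * (- W' - (- (W / B) - q / p + B' / B) * (- W)) * B\<^sup>2
      = p * (- W' * B - W * W - q / p * W * B + B' * W)"
      using that by (simp add: field_simps power2_eq_square)
    also have "\<dots> = - (p * (W' * B - W * B') + p * W\<^sup>2 + q * W * B)"
      using that(1) by (simp add: algebra_simps power2_eq_square)
    finally have "p / B * (- W' - (- (W / B) - q / p + B' / B) * (- W)) * B\<^sup>2
      = - (p * (W' * B - W * B') + p * W\<^sup>2 + q * W * B)" .
    moreover have "p / B * (- W' - (- (W / B) - q / p + B' / B) * (- W)) = - lam" using that(3) by linarith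
    ultimately have "- lam * B\<^sup>2 = - (p * (W' * B - W * B') + p * W\<^sup>2 + q * W * B)" by (simp only:)
    then show ?thesis by simp
  qed
  show ?thesis using gen[OF jacobi_p_pos[OF x] b_pos[OF x] e] by simp
qed

text \<open>Near -1 the weight behaves like (1 + x)^(\<beta> + 1 - 2k), so finite mass forces 2k <
  \<beta> + 2; since \<beta> \<ge> -1/2, this implies k < \<beta> + 1, whether k = 0 or not. The
  latter is the condition under which the boundary term vanishes at -1.\<close>

lemma endpoint_order:
  obtains k b2 where "b1 = [:1, 1:] ^ k * b2" "poly b2 (-1) \<noteq> 0" "real k < \<beta> + 1"
proof -
  have "b1 \<noteq> 0" using b1_pos[of 0] by auto
  then obtain b2 where b2: "b1 = [:- (- 1), 1:] ^ order (- 1) b1 * b2" "\<not> [:- (- 1), 1:] dvd b2"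
    using order_decomp by blast
  define k where "k = order (- 1) b1"
  have b1k: "b1 = [:1, 1:] ^ k * b2" using b2(1) by (simp add: k_def)
  have nz: "poly b2 (-1) \<noteq> 0" using b2(2) poly_eq_0_iff_dvd[of b2 "-1"] by simp
  have "bounded ((\<lambda>x. (poly b2 x)\<^sup>2) ` {-1..0})"
    by (intro compact_imp_bounded compact_continuous_image continuous_intros) auto
  then obtain M where M: "0 < M" "\<And>x. x \<in> {-1..0} \<Longrightarrow> (poly b2 x)\<^sup>2 \<le> M"
    unfolding bounded_pos real_norm_def by fastforce
  have "2 * real k < \<beta> + 2"
  proof (rule ccontr)
    assume k: "\<not> 2 * real k < \<beta> + 2"
    have "set_integrable lborel {-1<..<1} (\<lambda>x. x ^ 0 * W x)" using moments unfolding finite_moments_def by blast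
    then have "set_integrable lborel {-1<..<1} W" by simp
    then have intW: "set_integrable lborel {-1<..<0} W" by (rule set_integrable_subset) auto
    have "set_integrable lborel {-1<..<0} (\<lambda>x::real. 1 / (1 + x))"
      unfolding set_integrable_def
    proof (rule Bochner_Integration.integrable_bound[of lborel "\<lambda>x. M * (indicator {-1<..<0} x *\<^sub>R W x)"])
      show "integrable lborel (\<lambda>x. M * (indicator {-1<..<0} x *\<^sub>R W x))"
        using intW unfolding set_integrable_def by (rule integrable_mult_right)
      have "norm (indicator {-1<..<0} x *\<^sub>R (1 / (1 + x))) \<le> norm (M * (indicator {-1<..<0} x *\<^sub>R W x))" for x :: real
      proof (cases "x \<in> {-1<..<0}")
        case True
        then have x: "-1 < x" "x < 0" by auto
        define y where "y = 1 + x"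
        have y: "0 < y" "y \<le> 1" using x by (auto simp: y_def)
        have B2: "0 < (poly b2 x)\<^sup>2" using b1_pos[of x] x unfolding b1k by auto
        have pw: "poly b x = (1 - x) * (y ^ k * poly b2 x)" unfolding poly_b b1k by (simp add: y_def)
        have Wx: "W x = (1 - x) powr (\<alpha> - 1) * (y powr (\<beta> + 1 - 2 * real k) / (poly b2 x)\<^sup>2)"
        proof -
          have "W x = (1 - x) * y * ((1 - x) powr \<alpha> * y powr \<beta>) / ((1 - x) * (y ^ k * poly b2 x))\<^sup>2"
            unfolding exc_weight_def pw jacobi_p_eq jacobi_weight_def y_def ..
          also have "y ^ k = y powr real k" using y by (simp add: powr_realpow)
          also have "(1 - x) * y * ((1 - x) powr \<alpha> * y powr \<beta>) / ((1 - x) * (y powr real k * poly b2 x))\<^sup>2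
             = ((1 - x) powr \<alpha> / (1 - x)) * (y * y powr \<beta> / (y powr real k)\<^sup>2 / (poly b2 x)\<^sup>2)"
          proof -
            have gen: "u * y * (A * Y) / (u * (K * B))\<^sup>2 = A / u * (y * Y / K\<^sup>2 / B\<^sup>2)"
              if "u \<noteq> 0" "K \<noteq> 0" "B \<noteq> 0" for u A Y K B :: real
              using that by (simp add: field_simps power2_eq_square)
            show ?thesis using x y B2 by (intro gen) auto
          qed
          also have "(1 - x) powr \<alpha> / (1 - x) = (1 - x) powr (\<alpha> - 1)" using x by (simp add: powr_diff)
          also have "y * y powr \<beta> / (y powr real k)\<^sup>2 = y powr (\<beta> + 1 - 2 * real k)"
          proof -
            have "y * y powr \<beta> = y powr (\<beta> + 1)" using y by (simp add: powr_add)
            moreover have "(y powr real k)\<^sup>2 = y powr (2 * real k)" by (simp add: power2_eq_square flip: powr_add)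
            ultimately show ?thesis by (simp add: powr_diff)
          qed
          finally show ?thesis .
        qed
        have "1 / y \<le> y powr (\<beta> + 1 - 2 * real k)"
          using powr_mono'[of "\<beta> + 1 - 2 * real k" "-1" y] y k by (simp add: powr_minus_divide)
        also have "\<dots> = M * (y powr (\<beta> + 1 - 2 * real k) / M)" using M by simp
        also have "\<dots> \<le> M * (y powr (\<beta> + 1 - 2 * real k) / (poly b2 x)\<^sup>2)"
          using M(1) M(2)[of x] x B2 by (intro mult_left_mono divide_left_mono) auto
        also have "\<dots> \<le> M * W x"
        proof -
          have "1 \<le> (1 - x) powr (\<alpha> - 1)" using x \<alpha> by (intro ge_one_powr_ge_zero) auto
          then have "1 * (y powr (\<beta> + 1 - 2 * real k) / (poly b2 x)\<^sup>2) \<le> W x"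
            unfolding Wx by (intro mult_right_mono) auto
          from mult_left_mono[OF this, of M] show ?thesis using M(1) by simp
        qed
        finally have "1 / y \<le> M * W x" .
        then show ?thesis using True y by (simp add: y_def)
      qed simp
      then show "AE x in lborel. norm (indicator {-1<..<0} x *\<^sub>R (1 / (1 + x))) \<le> norm (M * (indicator {-1<..<0} x *\<^sub>R W x))" by simp
    qed simp
    then show False using not_integrable_inverse_shift by blast
  qed
  then have "real k < \<beta> + 1" using \<beta> by (cases k) auto
  then show ?thesis using that b1k nz by blast
qed

text \<open>The product of p, the Jacobi weight, bw / b, \<open>gauss t\<close>, p_n and p_m, with
  the common factor 1 - x of p and b cancelled so that continuity at x = 1 is visible.\<close>

definition boundary_term :: "real \<Rightarrow> nat \<Rightarrow> nat \<Rightarrow> real \<Rightarrow> real" where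
  "boundary_term t n m x = (1 + x) * jacobi_weight \<alpha> \<beta> x / poly b1 x * (poly bw x * gauss t x * poly (pn n) x * poly (pn m) x)"

lemma cont_gauss: "continuous_on A (gauss t)"
  using symbol_continuous[OF symbol_gauss] by (rule continuous_on_subset) simp

lemma boundary_term_tendsto_right: "(boundary_term t n m \<longlongrightarrow> 0) (at_left 1)"
proof (rule tendsto_at_left_1I)
  have "poly b1 x \<noteq> 0" if "x \<in> {0..1}" for x using b1_pos[of x] that by auto
  then show "continuous_on {0..1} (boundary_term t n m)"
    unfolding boundary_term_def jacobi_weight_def using \<alpha>
    by (intro continuous_intros continuous_on_powr' cont_gauss) auto
  show "boundary_term t n m 1 = 0" using \<alpha> by (simp add: boundary_term_def jacobi_weight_def)
qed

lemma boundary_term_tendsto_left: "(boundary_term t n m \<longlongrightarrow> 0) (at_right (-1))"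
proof -
  obtain k b2 where k: "b1 = [:1, 1:] ^ k * b2" "poly b2 (-1) \<noteq> 0" "real k < \<beta> + 1" by (rule endpoint_order)
  define F where "F x = (1 + x) powr (\<beta> + 1 - real k) * ((1 - x) powr \<alpha> / poly b2 x * (poly bw x * gauss t x * poly (pn n) x * poly (pn m) x))" for x
  have nz: "poly b2 x \<noteq> 0" if "x \<in> {-1..0}" for x
  proof (cases "x = -1")
    case False
    then have "0 < poly b1 x" using that by (intro b1_pos) auto
    then show ?thesis unfolding k(1) by auto
  qed (use k(2) in simp)
  have "continuous_on {-1..0} F"
    unfolding F_def using \<alpha> k(3) nz
    by (intro continuous_intros continuous_on_powr' cont_gauss) auto
  then have "(F \<longlongrightarrow> F (-1)) (at (-1) within {-1..0})" by (auto simp: continuous_on_def)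
  then have "(F \<longlongrightarrow> 0) (at_right (-1))" using k(3) by (simp add: at_within_Icc_at_right F_def)
  moreover have "\<forall>\<^sub>F x in at_right (-1). F x = boundary_term t n m x"
  proof -
    have "\<forall>\<^sub>F x in at_right (-1::real). x \<in> {-1<..<0}" by (rule eventually_at_right_real) simp
    then show ?thesis
    proof eventually_elim
      case (elim x)
      then have y: "0 < 1 + x" by simp
      have "(1 + x) powr (\<beta> + 1 - real k) = (1 + x) * (1 + x) powr \<beta> / (1 + x) ^ k"
        using y by (simp add: powr_diff powr_add powr_realpow)
      moreover have "poly b1 x = (1 + x) ^ k * poly b2 x" unfolding k(1) by simp
      ultimately show ?case unfolding F_def boundary_term_def jacobi_weight_def by (simp add: mult_ac)
    qed
  qed
  ultimately show ?thesis by (rule Lim_transform_eventually)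
qed

lemma sigma_nonzero: "\<sigma> n \<noteq> 0"
proof
  assume "\<sigma> n = 0"
  then have "(LBINT x:{-1<..<1}. exc_jacobi \<alpha> \<beta> b bw pn n x * exc_jacobi \<alpha> \<beta> b bw pn n x * W x) = 0"
    by (simp add: exc_jacobi_def)
  then show False using orthonormal by (simp add: orthonormal_wrt_def)
qed

lemma P_integrable: "set_integrable lborel {-1<..<1} (\<lambda>x. P n x * P m x * W x)"
proof -
  have "set_integrable lborel {-1<..<1} (\<lambda>x. \<sigma> n * \<sigma> m * (exc_jacobi \<alpha> \<beta> b bw pn n x * exc_jacobi \<alpha> \<beta> b bw pn m x * W x))"
    using orthonormal by (intro set_integrable_mult_right) (simp add: orthonormal_wrt_def)
  then show ?thesis using sigma_nonzero by (simp add: exc_jacobi_def)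
qed

lemma gauss_le_1: "0 \<le> t \<Longrightarrow> x \<in> {-1..1} \<Longrightarrow> gauss t x \<le> 1"
proof -
  assume "0 \<le> t" "x \<in> {-1..1}"
  moreover from this have "0 \<le> c0 * (1 - x)\<^sup>2" using c0 by simp
  ultimately have "0 \<le> (Q 1 - Q x) * t" using Q_lower[of x] by (intro mult_nonneg_nonneg) auto
  then show ?thesis by (simp add: gauss_def)
qed

lemma P_gauss_integrable:
  assumes t: "0 \<le> t"
  shows "set_integrable lborel {-1<..<1} (\<lambda>x. gauss t x * P n x * P m x * W x)"
  unfolding set_integrable_def
proof (rule Bochner_Integration.integrable_bound[OF P_integrable[of n m, unfolded set_integrable_def]])
  have [measurable]: "gauss t \<in> borel_measurable borel" by (intro borel_measurable_continuous_onI cont_gauss)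
  show "(\<lambda>x. indicator {-1<..<1} x *\<^sub>R (gauss t x * P n x * P m x * W x)) \<in> borel_measurable lborel"
    unfolding exc_weight_def jacobi_p_def by measurable
  have "norm (indicator {-1<..<1} x *\<^sub>R (gauss t x * P n x * P m x * W x)) \<le> norm (indicator {-1<..<1} x *\<^sub>R (P n x * P m x * W x))" for x
  proof (cases "x \<in> {-1<..<1}")
    case True
    then have "gauss t x \<le> 1" "0 \<le> gauss t x" using t gauss_le_1[of t x] by (auto simp: gauss_def)
    then have "gauss t x * \<bar>P n x * P m x * W x\<bar> \<le> \<bar>P n x * P m x * W x\<bar>" by (intro mult_left_le_one_le) auto
    then show ?thesis using True \<open>0 \<le> gauss t x\<close> by (simp add: abs_mult mult.assoc)
  qed simp
  then show "AE x in lborel. norm (indicator {-1<..<1} x *\<^sub>R (gauss t x * P n x * P m x * W x)) \<le> norm (indicator {-1<..<1} x *\<^sub>R (P n x * P m x * W x))" by simp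
qed

section \<open>Reduction of exceptional integrals to Jacobi coefficients\<close>

text \<open>Half of the Jacobi operator applied to \<open>gauss t\<close>, plus p bw / b times the
  derivative of \<open>gauss t\<close>. These are the contributions of the two integrations by parts
  in which derivatives fall on the exponential.\<close>

definition exc_symbol :: "real \<Rightarrow> real \<Rightarrow> real" where
  "exc_symbol t x = (jacobi_p x * (t * (poly (pderiv b) x + t * (poly b x)\<^sup>2) * gauss t x) + jacobi_q \<alpha> \<beta> x * (t * poly b x * gauss t x)) / 2
     + t * (jacobi_p x * (poly bw x * gauss t x))"

lemma DERIV_gauss_b: "(gauss t has_real_derivative t * poly b x * gauss t x) (at x)"
  using DERIV_gauss[of t x] by (simp add: poly_b mult.assoc)

lemma DERIV_gauss_b2: "((\<lambda>x. t * poly b x * gauss t x) has_real_derivative t * (poly (pderiv b) x + t * (poly b x)\<^sup>2) * gauss t x) (at x)"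
proof -
  have "((\<lambda>x. t * poly b x * gauss t x) has_real_derivative (t * poly (pderiv b) x) * gauss t x + (t * poly b x * gauss t x) * (t * poly b x)) (at x)"
    by (rule DERIV_mult[OF DERIV_cmult[OF poly_DERIV] DERIV_gauss_b])
  then show ?thesis by (rule DERIV_cong) (simp add: algebra_simps power2_eq_square)
qed

text \<open>Each t raises the order by 4, while p and every factor b lower it by 2 through their
  zeros at x = 1. The terms with one t carry p or b, and the term with t^2 carries p b^2, so order 2
  results throughout.\<close>

lemma symbol_exc_symbol: "symbol 2 exc_symbol"
proof -
  have p: "symbol 2 (\<lambda>t x. t * (jacobi_p x * (poly r x * gauss t x)))" for r
  proof -
    have "symbol 4 (\<lambda>t x. t * (poly r x * gauss t x))"
      using symbol_time[OF symbol_poly[OF symbol_gauss, of r]] by simp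
    then have "symbol 2 (\<lambda>t x. jacobi_p x * (t * (poly r x * gauss t x)))"
      using symbol_jacobi_p[of 2 "\<lambda>t x. t * (poly r x * gauss t x)"] by simp
    then show ?thesis by (simp add: mult.left_commute)
  qed
  have xi: "symbol 2 (\<lambda>t x. t * (poly b x * gauss t x))"
  proof -
    have "symbol 4 (\<lambda>t x. t * (poly b1 x * gauss t x))"
      using symbol_time[OF symbol_poly[OF symbol_gauss, of b1]] by simp
    then have "symbol 2 (\<lambda>t x. (1 - x) * (t * (poly b1 x * gauss t x)))"
      using symbol_lower[of 2 "\<lambda>t x. t * (poly b1 x * gauss t x)"] by simp
    then show ?thesis by (simp add: poly_b mult_ac)
  qed
  have q: "symbol 2 (\<lambda>t x. jacobi_q \<alpha> \<beta> x * (t * (poly b x * gauss t x)))"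
    by (rule symbol_jacobi_q[OF xi])
  have sq: "symbol 2 (\<lambda>t x. jacobi_p x * (t * (t * ((poly b x)\<^sup>2 * gauss t x))))"
  proof -
    have "symbol 8 (\<lambda>t x. t * (t * (poly (b1 * b1) x * gauss t x)))"
      using symbol_time[OF symbol_time[OF symbol_poly[OF symbol_gauss, of "b1 * b1"]]] by simp
    then have "symbol 6 (\<lambda>t x. (1 - x) * (t * (t * (poly (b1 * b1) x * gauss t x))))"
      using symbol_lower[of 6 "\<lambda>t x. t * (t * (poly (b1 * b1) x * gauss t x))"] by simp
    then have "symbol 4 (\<lambda>t x. (1 - x) * ((1 - x) * (t * (t * (poly (b1 * b1) x * gauss t x)))))"
      using symbol_lower[of 4 "\<lambda>t x. (1 - x) * (t * (t * (poly (b1 * b1) x * gauss t x)))"] by simp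
    then have "symbol 2 (\<lambda>t x. jacobi_p x * ((1 - x) * ((1 - x) * (t * (t * (poly (b1 * b1) x * gauss t x))))))"
      using symbol_jacobi_p[of 2 "\<lambda>t x. (1 - x) * ((1 - x) * (t * (t * (poly (b1 * b1) x * gauss t x))))"] by simp
    moreover have "(\<lambda>t x. jacobi_p x * ((1 - x) * ((1 - x) * (t * (t * (poly (b1 * b1) x * gauss t x))))))
      = (\<lambda>t x. jacobi_p x * (t * (t * ((poly b x)\<^sup>2 * gauss t x))))"
      by (simp add: fun_eq_iff poly_b power2_eq_square)
    ultimately show ?thesis by simp
  qed
  have "symbol 2 (\<lambda>t x. (1 / 2) * (t * (jacobi_p x * (poly (pderiv b) x * gauss t x))) + (1 / 2) * (jacobi_p x * (t * (t * ((poly b x)\<^sup>2 * gauss t x))))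
     + (1 / 2) * (jacobi_q \<alpha> \<beta> x * (t * (poly b x * gauss t x))) + t * (jacobi_p x * (poly bw x * gauss t x)))"
    by (intro symbol.plus symbol_scale p q sq)
  moreover have "(\<lambda>t x. (1 / 2) * (t * (jacobi_p x * (poly (pderiv b) x * gauss t x))) + (1 / 2) * (jacobi_p x * (t * (t * ((poly b x)\<^sup>2 * gauss t x))))
     + (1 / 2) * (jacobi_q \<alpha> \<beta> x * (t * (poly b x * gauss t x))) + t * (jacobi_p x * (poly bw x * gauss t x))) = exc_symbol"
    by (simp add: fun_eq_iff exc_symbol_def algebra_simps add_divide_distrib)
  ultimately show ?thesis by simp
qed

text \<open>The operator sends y z to 2 p y' z' - (eigval n + eigval m) y z. Pairing with
  \<open>gauss t\<close> and moving the operator onto the exponential isolates the integral of p y'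
  z'.\<close>

lemma product_derivative_integral:
  "(\<integral>x. gauss t x * (jacobi_p x * (poly (pderiv (pn n)) x * poly (pderiv (pn m)) x)) \<partial>jm)
   = (eigval n + eigval m) / 2 * matrix_coeff (gauss t) n m
     + (\<integral>x. poly (pn n) x * poly (pn m) x * ((jacobi_p x * (t * (poly (pderiv b) x + t * (poly b x)\<^sup>2) * gauss t x) + jacobi_q \<alpha> \<beta> x * (t * poly b x * gauss t x)) / 2) \<partial>jm)"
proof -
  let ?y = "poly (pn n)" and ?y1 = "poly (pderiv (pn n))" and ?y2 = "poly (pderiv (pderiv (pn n)))"
  let ?z = "poly (pn m)" and ?z1 = "poly (pderiv (pn m))" and ?z2 = "poly (pderiv (pderiv (pn m)))"
  let ?g1 = "\<lambda>x. t * poly b x * gauss t x" and ?g2 = "\<lambda>x. t * (poly (pderiv b) x + t * (poly b x)\<^sup>2) * gauss t x"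
  have cp: "continuous_on UNIV jacobi_p" "continuous_on UNIV (jacobi_q \<alpha> \<beta>)"
    unfolding jacobi_p_def[abs_def] jacobi_q_def[abs_def] by (intro continuous_intros)+
  have d1: "((\<lambda>x. ?y x * ?z x) has_real_derivative ?y1 x * ?z x + ?y x * ?z1 x) (at x)" for x
    by (rule DERIV_cong[OF DERIV_mult[OF poly_DERIV poly_DERIV]]) simp
  have d2: "((\<lambda>x. ?y1 x * ?z x + ?y x * ?z1 x) has_real_derivative ?y2 x * ?z x + 2 * (?y1 x * ?z1 x) + ?y x * ?z2 x) (at x)" for x
    by (rule DERIV_cong[OF DERIV_add[OF DERIV_mult[OF poly_DERIV poly_DERIV] DERIV_mult[OF poly_DERIV poly_DERIV]]]) simp
  have "(\<integral>x. (jacobi_p x * (?y2 x * ?z x + 2 * (?y1 x * ?z1 x) + ?y x * ?z2 x) + jacobi_q \<alpha> \<beta> x * (?y1 x * ?z x + ?y x * ?z1 x)) * gauss t x \<partial>jm)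
     = (\<integral>x. ?y x * ?z x * (jacobi_p x * ?g2 x + jacobi_q \<alpha> \<beta> x * ?g1 x) \<partial>jm)"
    by (rule jacobi_T_symmetric[OF d1 d2 DERIV_gauss_b DERIV_gauss_b2]) (intro continuous_intros cont_gauss)+
  also have "(\<lambda>x. (jacobi_p x * (?y2 x * ?z x + 2 * (?y1 x * ?z1 x) + ?y x * ?z2 x) + jacobi_q \<alpha> \<beta> x * (?y1 x * ?z x + ?y x * ?z1 x)) * gauss t x)
     = (\<lambda>x. 2 * (gauss t x * (jacobi_p x * (?y1 x * ?z1 x))) - (eigval n + eigval m) * (gauss t x * ?y x * ?z x))"
  proof
    fix x
    have "(jacobi_p x * (?y2 x * ?z x + 2 * (?y1 x * ?z1 x) + ?y x * ?z2 x) + jacobi_q \<alpha> \<beta> x * (?y1 x * ?z x + ?y x * ?z1 x)) * gauss t x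
      = 2 * (gauss t x * (jacobi_p x * (?y1 x * ?z1 x))) + (jacobi_p x * ?y2 x + jacobi_q \<alpha> \<beta> x * ?y1 x) * ?z x * gauss t x
        + ?y x * (jacobi_p x * ?z2 x + jacobi_q \<alpha> \<beta> x * ?z1 x) * gauss t x"
      by (simp add: algebra_simps)
    then show "(jacobi_p x * (?y2 x * ?z x + 2 * (?y1 x * ?z1 x) + ?y x * ?z2 x) + jacobi_q \<alpha> \<beta> x * (?y1 x * ?z x + ?y x * ?z1 x)) * gauss t x
      = 2 * (gauss t x * (jacobi_p x * (?y1 x * ?z1 x))) - (eigval n + eigval m) * (gauss t x * ?y x * ?z x)"
      unfolding pn_ode by (simp add: algebra_simps)
  qed
  also have "(\<integral>x. 2 * (gauss t x * (jacobi_p x * (?y1 x * ?z1 x))) - (eigval n + eigval m) * (gauss t x * ?y x * ?z x) \<partial>jm)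
     = (\<integral>x. 2 * (gauss t x * (jacobi_p x * (?y1 x * ?z1 x))) \<partial>jm) - (\<integral>x. (eigval n + eigval m) * (gauss t x * ?y x * ?z x) \<partial>jm)"
    by (intro Bochner_Integration.integral_diff integrable_continuous continuous_intros cont_gauss cp)
  finally show ?thesis by (simp add: matrix_coeff_def)
qed

text \<open>Dividing (b y' - bw y)(b z' - bw z) by b^2 leaves y' z', a term with bw / b times (y
  z)', and one with the square of bw / b. Integrating the middle term by parts and inserting the
  Riccati equation trades all poles for the constant lam, plus a term in which the derivative hits
  the exponential.\<close>

lemma exc_integral:
  assumes t: "0 \<le> t"
  shows "(LBINT x:{-1<..<1}. gauss t x * P n x * P m x * W x)
    = (eigval n + eigval m + 2 * lam) / 2 * matrix_coeff (gauss t) n m + matrix_coeff (exc_symbol t) n m"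
proof -
  let ?y = "poly (pn n)" and ?y1 = "poly (pderiv (pn n))"
  let ?z = "poly (pn m)" and ?z1 = "poly (pderiv (pn m))"
  define R where "R x = gauss t x * (jacobi_p x * (?y1 x * ?z1 x)) + (lam * (gauss t x * ?y x * ?z x) + t * (jacobi_p x * (poly bw x * gauss t x)) * ?y x * ?z x)" for x
  define f where "f x = R x * jacobi_weight \<alpha> \<beta> x - gauss t x * P n x * P m x * W x" for x
  have cp: "continuous_on UNIV jacobi_p" "continuous_on UNIV (jacobi_q \<alpha> \<beta>)"
    unfolding jacobi_p_def[abs_def] jacobi_q_def[abs_def] by (intro continuous_intros)+
  have cR: "continuous_on UNIV R" unfolding R_def by (intro continuous_intros cont_gauss cp)
  have Rm: "R \<in> borel_measurable borel" by (rule borel_measurable_continuous_onI[OF cR])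
  have intR: "set_integrable lborel {-1<..<1} (\<lambda>x. R x * jacobi_weight \<alpha> \<beta> x)"
    using integrable_continuous[OF cR] by (simp add: jm_integrable_iff[OF Rm])
  note intP = P_gauss_integrable[OF t, of n m]
  have F': "(boundary_term t n m has_real_derivative f x) (at x)" if x: "x \<in> {-1<..<1}" for x
  proof -
    define U where "U = (\<lambda>z. (1 - z) powr (\<alpha> + 1) * (1 + z) powr (\<beta> + 1))"
    define V where "V = (\<lambda>z. poly bw z / poly b z)"
    define X where "X = (\<lambda>z. gauss t z * ?y z * ?z z)"
    have B: "0 < poly b x" by (rule b_pos[OF x])
    have eq: "U z * V z * X z = boundary_term t n m z" if "z \<in> {-1<..<1}" for z
    proof -
      have "U z = (1 - z) * (1 + z) * jacobi_weight \<alpha> \<beta> z"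
        using that by (simp add: U_def jacobi_weight_def powr_add)
      moreover have "0 < poly b1 z" "1 - z \<noteq> 0" using b1_pos[of z] that by auto
      moreover have gen: "(u * v * J) * (c / (u * B)) * (g * y * z) = v * J / B * (c * g * y * z)" if "u \<noteq> 0" for u v J c B g y z :: real
        using that by simp
      ultimately show ?thesis unfolding V_def X_def boundary_term_def poly_b by (simp only: gen)
    qed
    have e: "(1 - x) powr (\<alpha> + 1) = (1 - x) powr \<alpha> * (1 - x)" "(1 + x) powr (\<beta> + 1) = (1 + x) powr \<beta> * (1 + x)"
      using x by (auto simp: powr_add)
    have dU: "(U has_real_derivative jacobi_q \<alpha> \<beta> x * jacobi_weight \<alpha> \<beta> x) (at x)"
    proof -
      have "(U has_real_derivative (- (\<alpha> + 1) * (1 - x) powr \<alpha>) * (1 + x) powr (\<beta> + 1) + (1 - x) powr (\<alpha> + 1) * ((\<beta> + 1) * (1 + x) powr \<beta>)) (at x)"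
        unfolding U_def using x by (auto intro!: derivative_eq_intros simp: algebra_simps)
      then show ?thesis by (rule DERIV_cong) (unfold e jacobi_q_def jacobi_weight_def, simp add: algebra_simps)
    qed
    have dV: "(V has_real_derivative (poly (pderiv bw) x * poly b x - poly bw x * poly (pderiv b) x) / (poly b x * poly b x)) (at x)"
      unfolding V_def using B by (intro DERIV_divide poly_DERIV) auto
    have dX: "(X has_real_derivative (t * poly b x * gauss t x * ?y x + ?y1 x * gauss t x) * ?z x + ?z1 x * (gauss t x * ?y x)) (at x)"
      unfolding X_def by (intro DERIV_mult DERIV_gauss_b poly_DERIV)
    have d: "((\<lambda>z. U z * V z * X z) has_real_derivative
       (jacobi_q \<alpha> \<beta> x * jacobi_weight \<alpha> \<beta> x * V x
         + (poly (pderiv bw) x * poly b x - poly bw x * poly (pderiv b) x) / (poly b x * poly b x) * U x) * X x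
       + ((t * poly b x * gauss t x * ?y x + ?y1 x * gauss t x) * ?z x + ?z1 x * (gauss t x * ?y x)) * (U x * V x)) (at x)"
      by (intro DERIV_mult dU dV dX)
    have Ux: "U x = jacobi_p x * jacobi_weight \<alpha> \<beta> x"
      using x by (simp add: U_def jacobi_weight_def jacobi_p_eq powr_add)
    \<comment> \<open>After multiplication by B^2 the left side of the Riccati equation appears as a
      block, is replaced by lam B^2, and the rest is a polynomial identity.\<close>
    have gen: "(q * w * (c / B) + (c' * B - c * B') / (B * B) * (p * w)) * (g * y * z)
         + ((t * B * g * y + y1 * g) * z + z1 * (g * y)) * (p * w * (c / B))
       = (g * (p * (y1 * z1)) + (lam * (g * y * z) + t * (p * (c * g)) * y * z)) * w
         - g * (B * y1 - c * y) * (B * z1 - c * z) * (p * w / B\<^sup>2)"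
      if B: "0 < B" and ric: "p * (c' * B - c * B') + p * c\<^sup>2 + q * c * B = lam * B\<^sup>2"
      for q w c B c' B' p g y z y1 z1 :: real
    proof -
      have "B\<^sup>2 * ((q * w * (c / B) + (c' * B - c * B') / (B * B) * (p * w)) * (g * y * z)
         + ((t * B * g * y + y1 * g) * z + z1 * (g * y)) * (p * w * (c / B)))
        = (q * w * (c * B) + (c' * B - c * B') * (p * w)) * (g * y * z)
         + ((t * B * g * y + y1 * g) * z + z1 * (g * y)) * (p * w * (c * B))"
        using B by (simp add: field_simps power2_eq_square)
      also have "\<dots> = w * (g * y * z) * (p * (c' * B - c * B') + p * c\<^sup>2 + q * c * B) - w * (g * y * z) * (p * c\<^sup>2)
         + ((t * B * g * y + y1 * g) * z + z1 * (g * y)) * (p * w * (c * B))"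
        by (simp add: algebra_simps)
      also have "\<dots> = w * (g * y * z) * (lam * B\<^sup>2) - w * (g * y * z) * (p * c\<^sup>2)
         + ((t * B * g * y + y1 * g) * z + z1 * (g * y)) * (p * w * (c * B))"
        unfolding ric ..
      also have "\<dots> = B\<^sup>2 * ((g * (p * (y1 * z1)) + (lam * (g * y * z) + t * (p * (c * g)) * y * z)) * w)
         - g * (B * y1 - c * y) * (B * z1 - c * z) * (p * w)"
        by (simp add: algebra_simps power2_eq_square)
      also have "\<dots> = B\<^sup>2 * ((g * (p * (y1 * z1)) + (lam * (g * y * z) + t * (p * (c * g)) * y * z)) * w
         - g * (B * y1 - c * y) * (B * z1 - c * z) * (p * w / B\<^sup>2))"
        using B by (simp add: right_diff_distrib)
      finally show ?thesis using B by simp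
    qed
    have fx: "f x = (gauss t x * (jacobi_p x * (?y1 x * ?z1 x)) + (lam * (gauss t x * ?y x * ?z x) + t * (jacobi_p x * (poly bw x * gauss t x)) * ?y x * ?z x)) * jacobi_weight \<alpha> \<beta> x
         - gauss t x * (poly b x * ?y1 x - poly bw x * ?y x) * (poly b x * ?z1 x - poly bw x * ?z x) * (jacobi_p x * jacobi_weight \<alpha> \<beta> x / (poly b x)\<^sup>2)"
      unfolding f_def R_def exc_weight_def exc_poly_def by simp
    have "((\<lambda>z. U z * V z * X z) has_real_derivative f x) (at x)"
      using d unfolding fx gen[OF B riccati[OF x], symmetric] Ux V_def X_def .
    then show ?thesis
      by (rule has_field_derivative_transform_within_open[of _ _ _ "{-1<..<1}"]) (use x eq in auto)
  qed
  have cf: "isCont f x" if x: "x \<in> {-1<..<1}" for x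
  proof -
    have "poly b x \<noteq> 0" using b_pos[OF x] by simp
    then show ?thesis
      using x cR cont_gauss[of UNIV t] unfolding f_def[abs_def] exc_weight_def jacobi_p_def jacobi_weight_def
      by (intro continuous_intros) (auto simp: continuous_on_eq_continuous_at)
  qed
  \<comment> \<open>Both parts of f are integrable, one as a continuous function against the Jacobi
    weight, the other by orthonormality; the integral is then the difference of the boundary limits,
    both 0.\<close>
  have "(LBINT x=ereal (-1)..ereal 1. f x) = 0 - 0"
  proof (rule interval_integral_FTC_integrable)
    show "set_integrable lborel (einterval (ereal (-1)) (ereal 1)) f"
      unfolding f_def using set_integral_diff(1)[OF intR intP] by simp
    show "((boundary_term t n m \<circ> real_of_ereal) \<longlongrightarrow> 0) (at_right (ereal (-1)))"
      using boundary_term_tendsto_left by (simp only: ereal_tendsto_simps)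
    show "((boundary_term t n m \<circ> real_of_ereal) \<longlongrightarrow> 0) (at_left (ereal 1))"
      using boundary_term_tendsto_right by (simp only: ereal_tendsto_simps)
    fix x assume "ereal (-1) < ereal x" "ereal x < ereal 1"
    then have x: "x \<in> {-1<..<1}" by simp
    show "(boundary_term t n m has_vector_derivative f x) (at x)"
      using F'[OF x] by (simp only: has_real_derivative_iff_has_vector_derivative)
    show "isCont f x" by (rule cf[OF x])
  qed simp
  then have "(LBINT x:{-1<..<1}. f x) = 0" by (simp add: interval_lebesgue_integral_def)
  then have "(LBINT x:{-1<..<1}. gauss t x * P n x * P m x * W x) = (LBINT x:{-1<..<1}. R x * jacobi_weight \<alpha> \<beta> x)"
    unfolding f_def using set_integral_diff(2)[OF intR intP] by simp
  also have "\<dots> = integral\<^sup>L jm R" by (rule jm_integral_eq[OF Rm, symmetric])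
  also have "\<dots> = (\<integral>x. gauss t x * (jacobi_p x * (?y1 x * ?z1 x)) \<partial>jm)
      + ((\<integral>x. lam * (gauss t x * ?y x * ?z x) \<partial>jm) + (\<integral>x. t * (jacobi_p x * (poly bw x * gauss t x)) * ?y x * ?z x \<partial>jm))"
  proof -
    have i: "integrable jm (\<lambda>x. gauss t x * (jacobi_p x * (?y1 x * ?z1 x)))" "integrable jm (\<lambda>x. lam * (gauss t x * ?y x * ?z x))"
      "integrable jm (\<lambda>x. t * (jacobi_p x * (poly bw x * gauss t x)) * ?y x * ?z x)"
      by (intro integrable_continuous continuous_intros cont_gauss cp)+
    show ?thesis unfolding R_def
      by (simp only: Bochner_Integration.integral_add[OF i(1) Bochner_Integration.integrable_add[OF i(2,3)]] Bochner_Integration.integral_add[OF i(2,3)])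
  qed
  also have "(\<integral>x. lam * (gauss t x * ?y x * ?z x) \<partial>jm) = lam * matrix_coeff (gauss t) n m"
    by (simp add: matrix_coeff_def)
  finally have 1: "(LBINT x:{-1<..<1}. gauss t x * P n x * P m x * W x)
     = (\<integral>x. gauss t x * (jacobi_p x * (?y1 x * ?z1 x)) \<partial>jm) + (lam * matrix_coeff (gauss t) n m
       + (\<integral>x. t * (jacobi_p x * (poly bw x * gauss t x)) * ?y x * ?z x \<partial>jm))" .
  let ?S = "\<lambda>x. ?y x * ?z x * ((jacobi_p x * (t * (poly (pderiv b) x + t * (poly b x)\<^sup>2) * gauss t x) + jacobi_q \<alpha> \<beta> x * (t * poly b x * gauss t x)) / 2)"
  have split: "(A + B) * y * z = y * z * A + B * y * z" for A B y z :: real by (simp add: algebra_simps)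
  have "matrix_coeff (exc_symbol t) n m = (\<integral>x. ?S x + t * (jacobi_p x * (poly bw x * gauss t x)) * ?y x * ?z x \<partial>jm)"
    unfolding matrix_coeff_def exc_symbol_def by (intro Bochner_Integration.integral_cong refl) (rule split)
  also have "\<dots> = integral\<^sup>L jm ?S + (\<integral>x. t * (jacobi_p x * (poly bw x * gauss t x)) * ?y x * ?z x \<partial>jm)"
    by (intro Bochner_Integration.integral_add integrable_continuous continuous_intros cont_gauss cp) simp_all
  finally show ?thesis unfolding 1 product_derivative_integral by (simp add: algebra_simps add_divide_distrib)
qed

text \<open>The integral identity at t = 0, where \<open>gauss 0\<close> is 1 and the exceptional
  symbol vanishes.\<close>

lemma sigma_eq: "\<sigma> n = sqrt (eigval n + lam)"
proof -
  have g0: "gauss 0 = (\<lambda>x. 1)" by (simp add: gauss_def fun_eq_iff)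
  have "(LBINT x:{-1<..<1}. (P n x)\<^sup>2 * W x) = (LBINT x:{-1<..<1}. gauss 0 x * P n x * P n x * W x)"
    unfolding g0 by (simp add: power2_eq_square)
  also have "\<dots> = (eigval n + lam) * matrix_coeff (gauss 0) n n + matrix_coeff (exc_symbol 0) n n"
    by (subst exc_integral) (simp_all add: field_simps)
  also have "\<dots> = eigval n + lam"
    by (simp add: matrix_coeff_def g0 exc_symbol_def[abs_def] pn_orthonormal(2))
  finally show ?thesis by (simp add: exc_sigma_def)
qed

text \<open>Since eigval 0 = 0, lam is the squared norm of the first exceptional polynomial, and
  normalisation prevents it from being 0.\<close>

lemma lam_pos: "0 < lam"
proof -
  have "(LBINT x:{-1<..<1}. exc_jacobi \<alpha> \<beta> b bw pn 0 x * exc_jacobi \<alpha> \<beta> b bw pn 0 x * W x) = 1"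
    using orthonormal by (simp add: orthonormal_wrt_def)
  have "0 \<le> (LBINT x:{-1<..<1}. (P 0 x)\<^sup>2 * W x)"
    unfolding set_lebesgue_integral_def
    by (intro integral_nonneg_AE AE_I2) (auto simp: indicator_def exc_weight_def jacobi_weight_nonneg intro!: mult_nonneg_nonneg divide_nonneg_nonneg less_imp_le[OF jacobi_p_pos])
  then have "0 \<le> \<sigma> 0" by (simp add: exc_sigma_def)
  then have "0 < \<sigma> 0" using sigma_nonzero[of 0] by simp
  then show ?thesis by (simp add: sigma_eq eigval_def)
qed

lemma exc_kernel_bound:
  "\<exists>C>0. \<forall>t>0. \<exists>N\<ge>1. \<forall>n m. \<bar>exc_kernel \<alpha> \<beta> b bw pn Q t n m\<bar> \<le> C / N \<and>
     \<bar>exc_kernel \<alpha> \<beta> b bw pn Q t n m\<bar> * (real n - real m)\<^sup>2 \<le> C * N"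
proof (rule kernel_bound[OF lam_pos symbol_exc_symbol])
  fix t n m assume t: "(0::real) < t"
  have "exc_kernel \<alpha> \<beta> b bw pn Q t n m = (LBINT x:{-1<..<1}. 1 / (\<sigma> n * \<sigma> m) * (gauss t x * P n x * P m x * W x))"
    unfolding exc_kernel_def exc_jacobi_def gauss_def by (simp add: mult_ac)
  also have "\<dots> = 1 / (\<sigma> n * \<sigma> m) * (LBINT x:{-1<..<1}. gauss t x * P n x * P m x * W x)"
    by (rule set_integral_mult_right)
  finally have "\<sigma> n * \<sigma> m * exc_kernel \<alpha> \<beta> b bw pn Q t n m = (LBINT x:{-1<..<1}. gauss t x * P n x * P m x * W x)"
    using sigma_nonzero by simp
  then show "sqrt (eigval n + lam) * sqrt (eigval m + lam) * exc_kernel \<alpha> \<beta> b bw pn Q t n m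
      = (eigval n + eigval m + 2 * lam) / 2 * matrix_coeff (gauss t) n m + matrix_coeff (exc_symbol t) n m"
    unfolding sigma_eq using exc_integral[of t n m] t by simp
qed

end

text \<open>On [0, 1] the derivative of Q is at least m (1 - x), with m the minimum of
  \<open>b1\<close> there. On [-1, 0], where \<open>b1\<close> may vanish at the left end, Q is
  still nondecreasing, and (1 - x)^2 \<le> 4 turns m/2 into m/8.\<close>

lemma primitive_quadratic_lower_bound:
  fixes b1 :: "real poly" and Q :: "real \<Rightarrow> real"
  assumes pos: "\<And>x. -1 < x \<Longrightarrow> x \<le> 1 \<Longrightarrow> 0 < poly b1 x"
    and Q: "\<And>x. (Q has_real_derivative (1 - x) * poly b1 x) (at x)"
  shows "\<exists>c>0. \<forall>x\<in>{-1..1}. c * (1 - x)\<^sup>2 \<le> Q 1 - Q x"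
proof -
  have "continuous_on {0..1} (poly b1)" by (intro continuous_intros)
  then obtain x0 where x0: "x0 \<in> {0..1}" "\<And>x. x \<in> {0..1} \<Longrightarrow> poly b1 x0 \<le> poly b1 x"
    using continuous_attains_inf[of "{0..1}" "poly b1"] by auto
  define m where "m = poly b1 x0"
  have m: "0 < m" using pos[of x0] x0(1) by (simp add: m_def)
  have upper: "m / 2 * (1 - x)\<^sup>2 \<le> Q 1 - Q x" if x: "0 \<le> x" "x \<le> 1" for x
  proof -
    have "Q x + m / 2 * (1 - x)\<^sup>2 \<le> Q 1 + m / 2 * (1 - 1)\<^sup>2"
    proof (rule DERIV_nonneg_imp_nondecreasing[OF x(2)])
      fix z assume z: "x \<le> z" "z \<le> 1"
      have "((\<lambda>x. Q x + m / 2 * (1 - x)\<^sup>2) has_real_derivative (1 - z) * poly b1 z + m / 2 * (2 * (1 - z) * (- 1))) (at z)"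
        by (auto intro!: derivative_eq_intros Q)
      also have "(1 - z) * poly b1 z + m / 2 * (2 * (1 - z) * (- 1)) = (1 - z) * (poly b1 z - m)"
        by (simp add: algebra_simps)
      finally have "((\<lambda>x. Q x + m / 2 * (1 - x)\<^sup>2) has_real_derivative (1 - z) * (poly b1 z - m)) (at z)" .
      moreover have "0 \<le> (1 - z) * (poly b1 z - m)" using x0(2)[of z] x z by (simp add: m_def)
      ultimately show "\<exists>d. ((\<lambda>x. Q x + m / 2 * (1 - x)\<^sup>2) has_real_derivative d) (at z) \<and> 0 \<le> d" by blast
    qed
    then show ?thesis by simp
  qed
  have lower: "m / 8 * (1 - x)\<^sup>2 \<le> Q 1 - Q x" if x: "-1 \<le> x" "x \<le> 0" for x
  proof -
    have nn: "0 \<le> poly b1 (-1)"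
    proof (rule tendsto_lowerbound)
      show "(poly b1 \<longlongrightarrow> poly b1 (-1)) (at_right (-1))" by (intro tendsto_intros)
      have "\<forall>\<^sub>F x in at_right (-1::real). x \<in> {-1<..<0}" by (rule eventually_at_right_real) simp
      then show "\<forall>\<^sub>F x in at_right (-1). 0 \<le> poly b1 x"
        by eventually_elim (use pos in \<open>simp add: less_imp_le\<close>)
    qed simp
    have "Q x \<le> Q 0"
    proof (rule DERIV_nonneg_imp_nondecreasing[OF x(2)])
      fix z assume z: "x \<le> z" "z \<le> 0"
      have "0 \<le> poly b1 z" using nn pos[of z] z x by (cases "z = -1") auto
      then have "0 \<le> (1 - z) * poly b1 z" using z by (intro mult_nonneg_nonneg) auto
      then show "\<exists>d. (Q has_real_derivative d) (at z) \<and> 0 \<le> d" using Q[of z] by blast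
    qed
    moreover have "m / 2 \<le> Q 1 - Q 0" using upper[of 0] by simp
    moreover have "(1 - x)\<^sup>2 \<le> 2\<^sup>2" using x by (intro power_mono) auto
    then have "m / 8 * (1 - x)\<^sup>2 \<le> m / 8 * 2\<^sup>2" using m by (intro mult_left_mono) auto
    ultimately show ?thesis by simp
  qed
  show ?thesis
  proof (intro exI[of _ "m / 8"] conjI ballI)
    show "0 < m / 8" using m by simp
    fix x :: real assume x: "x \<in> {-1..1}"
    show "m / 8 * (1 - x)\<^sup>2 \<le> Q 1 - Q x"
    proof (cases "x \<le> 0")
      case True
      then show ?thesis using lower x by simp
    next
      case False
      have "m / 8 * (1 - x)\<^sup>2 \<le> m / 2 * (1 - x)\<^sup>2" using m by (intro mult_right_mono) auto
      then show ?thesis using upper[of x] x False by simp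
    qed
  qed
qed

theorem theorem1:
  fixes \<alpha> \<beta> lam :: real
    and pn :: "nat \<Rightarrow> real poly"
    and b bw :: "real poly"
    and w Q :: "real \<Rightarrow> real"
  assumes "\<alpha> > 3/2" and "\<beta> \<ge> -1/2"
    and "orthonormal_jacobi \<alpha> \<beta> pn"
    and "darboux_data \<alpha> \<beta> b w bw lam"
    and "finite_moments (exc_weight \<alpha> \<beta> b)"
    and "finite (UNIV - range (\<lambda>n. degree (exc_poly b bw pn n)))"
    and "complete_orthonormal_wrt (exc_weight \<alpha> \<beta> b) (exc_jacobi \<alpha> \<beta> b bw pn)"
    and "poly b 1 = 0" and "poly (pderiv b) 1 \<noteq> 0"
    and "\<forall>x. (Q has_real_derivative poly b x) (at x)"
  shows
    "(\<forall>p \<omega>. 1 < p \<and> muckenhoupt p \<omega> \<longrightarrow>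
        (\<exists>C. \<forall>f \<in> l2_space \<inter> lp_space p \<omega>.
           exc_maximal \<alpha> \<beta> b bw pn Q f \<in> lp_space p \<omega> \<and>
           lp_norm p \<omega> (exc_maximal \<alpha> \<beta> b bw pn Q f) \<le> C * lp_norm p \<omega> f) \<and>
        extends_uniquely (l2_space \<inter> lp_space p \<omega>) (exc_maximal \<alpha> \<beta> b bw pn Q)
          (lp_space p \<omega>) (lp_norm p \<omega>) (lp_space p \<omega>) (lp_norm p \<omega>)) \<and>
     (\<forall>\<omega>. muckenhoupt1 \<omega> \<longrightarrow>
        (\<exists>C. \<forall>f \<in> l2_space \<inter> lp_space 1 \<omega>.
           exc_maximal \<alpha> \<beta> b bw pn Q f \<in> weak_l1_space \<omega> \<and>
           weak_l1_norm \<omega> (exc_maximal \<alpha> \<beta> b bw pn Q f) \<le> C * lp_norm 1 \<omega> f) \<and>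
        extends_uniquely (l2_space \<inter> lp_space 1 \<omega>) (exc_maximal \<alpha> \<beta> b bw pn Q)
          (lp_space 1 \<omega>) (lp_norm 1 \<omega>) (weak_l1_space \<omega>) (weak_l1_norm \<omega>))"
proof -
  obtain c where c: "b = [:-1, 1:] * c"
    using assms(8) poly_eq_0_iff_dvd[of b 1] by (auto elim!: dvdE)
  \<comment> \<open>The sign makes b = (1 - x) b1 with \<open>b1\<close> positive on the open
    interval.\<close>
  define b1 where "b1 = - c"
  have b: "b = [:1, -1:] * b1" unfolding c b1_def by (rule poly_eqI) (simp add: coeff_pCons split: nat.split)
  have bx: "poly b x = (1 - x) * poly b1 x" for x by (simp add: b algebra_simps)
  have pos: "0 < poly b1 x" if "-1 < x" "x < 1" for x
  proof -
    have "0 < (1 - x) * poly b1 x"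
      unfolding bx[symmetric] using assms(4) that by (simp add: darboux_data_def)
    then show ?thesis using that by (simp add: zero_less_mult_iff)
  qed
  have "0 \<le> poly b1 1"
  proof (rule tendsto_lowerbound)
    show "(poly b1 \<longlongrightarrow> poly b1 1) (at_left 1)" by (intro tendsto_intros)
    have "\<forall>\<^sub>F x in at_left (1::real). x \<in> {0<..<1}" by (rule eventually_at_left_real) simp
    then show "\<forall>\<^sub>F x in at_left 1. 0 \<le> poly b1 x"
      by eventually_elim (use pos in \<open>simp add: less_imp_le\<close>)
  qed simp
  \<comment> \<open>The derivative of (1 - x) b1 at 1 is -b1(1), so a simple zero of b means a
    nonzero value here; the sign comes from the limit inside the interval.\<close>
  moreover have "poly b1 1 \<noteq> 0"
    using assms(9) unfolding b pderiv_mult by (simp add: pderiv_pCons)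
  ultimately have pos': "0 < poly b1 x" if "-1 < x" "x \<le> 1" for x
    using pos[of x] that by (cases "x = 1") auto
  have Q: "(Q has_real_derivative (1 - x) * poly b1 x) (at x)" for x
    using assms(10) bx by simp
  obtain c0 where c0: "0 < c0 \<and> (\<forall>x\<in>{-1..1}. c0 * (1 - x)\<^sup>2 \<le> Q 1 - Q x)"
    using primitive_quadratic_lower_bound[of b1 Q, OF pos' Q] by (rule exE)
  interpret exceptional_jacobi \<alpha> \<beta> pn b1 Q c0 b bw w lam
  proof
    show "orthonormal_wrt (exc_weight \<alpha> \<beta> b) (exc_jacobi \<alpha> \<beta> b bw pn)"
      using assms(7) by (simp add: complete_orthonormal_wrt_def)
  qed (use assms c0 Q pos' b in auto)
  obtain C where C: "0 < C \<and> (\<forall>t>0. \<exists>N\<ge>1. \<forall>n m. \<bar>exc_kernel \<alpha> \<beta> b bw pn Q t n m\<bar> \<le> C / N \<and>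
     \<bar>exc_kernel \<alpha> \<beta> b bw pn Q t n m\<bar> * (real n - real m)\<^sup>2 \<le> C * N)"
    using exc_kernel_bound by (rule exE)
  interpret K: kernel_family "exc_kernel \<alpha> \<beta> b bw pn Q" C
    by unfold_locales (use C in auto)
  have "exc_maximal \<alpha> \<beta> b bw pn Q = K.maximal_op"
    by (simp add: fun_eq_iff exc_maximal_def exc_semigroup_def K.maximal_op_def)
  then show ?thesis using K.strong_type K.weak_type by simp
qed

end
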